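(* Let $n\ge 1$ and let $X_{n+2}=(S^1)^{n+2}/O(2)$, the quotient of the product of $n+2$ unit circles $S^1\subset\mathbb R^2$ by the diagonal action of the orthogonal group $O(2)$ (equivalently, $X_{n+2}\cong T^{n+1}/\mathbb Z_2$ where the nontrivial element of $\mathbb Z_2$ acts on $T^{n+1}=(S^1)^{n+1}$, $S^1\subset\mathbb C$, by simultaneous complex conjugation). Then the reduced Betti numbers of $X_{n+2}$ with $\mathbb Z_2$ coefficients are \[\widetilde\beta_i(X_{n+2};\mathbb Z_2)=\begin{cases}\sum_{j=0}^{n-i+1}2^j\binom{n-j}{i-1}, & \text{if } n+1\ge i\ge 2,\\ 0, & \text{otherwise.}\end{cases}\] *)

theory Defs
  imports "HOL-Analysis.Analysis" "HOL-Homology.Homology"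
begin

definition quotient_topology :: "'a topology \<Rightarrow> ('a \<Rightarrow> 'b) \<Rightarrow> 'b topology" where
  "quotient_topology X f = topology (\<lambda>U. U \<subseteq> f ` topspace X \<and>
       openin X {x \<in> topspace X. f x \<in> U})"

definition circle_power :: "nat \<Rightarrow> (nat \<Rightarrow> complex) topology" where
  "circle_power m = product_topology (\<lambda>k. subtopology euclidean (sphere 0 1)) {..<m}"

definition O2_orbit :: "nat \<Rightarrow> (nat \<Rightarrow> complex) \<Rightarrow> (nat \<Rightarrow> complex) set" where
  "O2_orbit m x = {y \<in> topspace (circle_power m).
      \<exists>g. orthogonal_transformation g \<and> (\<forall>k<m. y k = g (x k))}"

definition X_space :: "nat \<Rightarrow> (nat \<Rightarrow> complex) set topology" where
  "X_space m = quotient_topology (circle_power m) (O2_orbit m)"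

text \<open>Reduced singular homology with Z_2 coefficients, i.e. homology of the
  augmented complex C_*(X) \<otimes> Z_2, computed via integral lifts: a mod-2 cycle
  lifts to an integral chain whose boundary is divisible by 2 (and, in degree 0,
  whose augmentation is even); a mod-2 boundary lifts to \<open>\<partial>d + 2e\<close>.\<close>
definition mod2_reduced_cycles :: "nat \<Rightarrow> 'a topology \<Rightarrow> 'a chain set" where
  "mod2_reduced_cycles p X = {c. singular_chain p X c \<and>
      (\<exists>e. singular_chain (p - 1) X e \<and> chain_boundary p c = e + e) \<and>
      (p = 0 \<longrightarrow> even (\<Sum>s\<in>Poly_Mapping.keys c. Poly_Mapping.lookup c s))}"

definition mod2_boundaries :: "nat \<Rightarrow> 'a topology \<Rightarrow> 'a chain set" where
  "mod2_boundaries p X = {chain_boundary (Suc p) d + (e + e) | d e.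
      singular_chain (Suc p) X d \<and> singular_chain p X e}"

definition reduced_mod2_homology_group :: "nat \<Rightarrow> 'a topology \<Rightarrow> 'a chain set monoid" where
  "reduced_mod2_homology_group p X =
     subgroup_generated (chain_group p X) (mod2_reduced_cycles p X) Mod mod2_boundaries p X"

text \<open>Reduced Z_2-Betti number: the F_2-dimension b, i.e. the group has 2^b elements.\<close>
definition reduced_mod2_betti :: "nat \<Rightarrow> 'a topology \<Rightarrow> nat" where
  "reduced_mod2_betti p X = (THE b. finite (carrier (reduced_mod2_homology_group p X)) \<and>
      card (carrier (reduced_mod2_homology_group p X)) = 2 ^ b)"

end

theory Submission
  imports Defs "HOL-Library.Z2"
begin

text \<open>Normalising the last circle coordinate to \<open>1\<close> identifies the orbit space with the quotient \<open>Y\<^sub>m\<close> of the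
  torus \<open>T\<^sup>m\<close>, \<open>m = n + 1\<close>, by simultaneous conjugation. Cutting the last circle of \<open>T\<^sup>m\<^sup>+\<^sup>1\<close> at \<open>1\<close> and \<open>-1\<close>
  presents \<open>Y\<^bsub>m+1\<^esub>\<close> as \<open>[0,1] \<times> T\<^sup>m\<close> with each end collapsed to \<open>Y\<^sub>m\<close> by the quotient map
  \<open>q : T\<^sup>m \<rightarrow> Y\<^sub>m\<close>. Modulo 2 the map \<open>q\<close> is zero on homology in positive degrees: the homology of \<open>T\<^sup>m\<close> is
  spanned by images of fundamental cycles of tori under conjugation equivariant maps, and such a cycle
  is the sum of two half turns that conjugation exchanges, so its image in the quotient is a chain
  counted twice. The exact sequence of the pair formed by \<open>Y\<^bsub>m+1\<^esub>\<close> and its two ends therefore splits into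
  short exact sequences, giving \<open>\<beta>\<^sub>i(Y\<^bsub>m+1\<^esub>) = 2 \<beta>\<^sub>i(Y\<^sub>m) + (m choose (i - 1))\<close> for \<open>i \<ge> 2\<close>, and the formula
  follows by induction. The same cutting argument gives the homology of the tori.\<close>

section \<open>Chains modulo 2\<close>

text \<open>The binomial in the recurrence is the Betti number of \<open>T\<^sup>m\<close> in degree
  i - 1; it enters as the kernel of \<open>q\<close> in that degree. In degree 0 the map
  \<open>q\<close> is injective on homology, both spaces being path connected, so degree 1 gains no
  classes and stays zero. This is why the formula starts at i = 2. Exactness is always an explicit
  decomposition of cycles modulo boundaries, and dimensions are read off from numbers of cosets,
  which multiply along short exact sequences. Excision becomes a deformation that pushes a collar of
  the ends into the ends, applied after subdividing until every simplex lies in the collar or off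
  the ends. Over F_2 signs disappear, and the cancellation in the quotient is an equality of chains:
  the two half turns have literally the same image. This needs a prism operator that commutes with
  induced maps exactly, not only up to homotopy.\<close>

type_synonym 'a chain2 = "((nat \<Rightarrow> real) \<Rightarrow> 'a) \<Rightarrow>\<^sub>0 bit"

abbreviation keys :: "('b \<Rightarrow>\<^sub>0 'c::zero) \<Rightarrow> 'b set" where
  "keys \<equiv> Poly_Mapping.keys"

abbreviation coeff :: "('b \<Rightarrow>\<^sub>0 'c::zero) \<Rightarrow> 'b \<Rightarrow> 'c" where
  "coeff \<equiv> Poly_Mapping.lookup"

lemma F2_self [simp]: "c + c = (0 :: 'b \<Rightarrow>\<^sub>0 bit)"
  by (rule poly_mapping_eqI) (simp add: lookup_add)

lemma F2_self_left [simp]: "c + (c + d) = (d :: 'b \<Rightarrow>\<^sub>0 bit)"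
  by (simp flip: add.assoc)

lemma F2_uminus [simp]: "- c = (c :: 'b \<Rightarrow>\<^sub>0 bit)"
  by (rule minus_unique) simp

lemma F2_diff [simp]: "c - d = c + (d :: 'b \<Rightarrow>\<^sub>0 bit)"
  by (subst diff_conv_add_uminus) (subst F2_uminus, rule refl)

lemma F2_eq_iff: "c = d \<longleftrightarrow> c + d = (0 :: 'b \<Rightarrow>\<^sub>0 bit)"
  using right_minus_eq[of c d] by simp

lemmas F2_ac = add.assoc add.commute add.left_commute

lemma F2_move: "a = b + c \<longleftrightarrow> a + b = (c :: 'b \<Rightarrow>\<^sub>0 bit)"
  by (auto simp: add.commute[of a b])

lemma of_int_bit_eq_0: "of_int k = (0::bit) \<longleftrightarrow> even k"
proof (cases "even k")
  case True
  then obtain l where "k = l + l" by (auto elim!: evenE)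
  then show ?thesis by simp
next
  case False
  then obtain l where "k = l + l + 1" by (auto elim!: oddE)
  then show ?thesis by simp
qed

section \<open>Reduction modulo 2 and integral lifts\<close>

definition red :: "('b \<Rightarrow>\<^sub>0 int) \<Rightarrow> ('b \<Rightarrow>\<^sub>0 bit)" where
  "red = Poly_Mapping.map of_int"

definition lift2 :: "('b \<Rightarrow>\<^sub>0 bit) \<Rightarrow> ('b \<Rightarrow>\<^sub>0 int)" where
  "lift2 = Poly_Mapping.map (\<lambda>b. if b = 0 then 0 else 1)"

lemma lookup_red: "coeff (red c) s = of_int (coeff c s)"
  by (simp add: red_def Poly_Mapping.map.rep_eq when_def)

lemma lookup_lift2: "coeff (lift2 c) s = (if coeff c s = 0 then 0 else 1)"
  by (simp add: lift2_def Poly_Mapping.map.rep_eq when_def)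

lemma keys_red: "keys (red c) = {s. odd (coeff c s)}"
  by (rule Set.set_eqI) (simp add: in_keys_iff lookup_red of_int_bit_eq_0 del: bit_not_zero_iff)

lemma keys_red_subset: "keys (red c) \<subseteq> keys c"
proof
  fix s assume "s \<in> keys (red c)"
  then have "coeff c s \<noteq> 0" by (auto simp: keys_red)
  then show "s \<in> keys c" by (simp add: in_keys_iff)
qed

lemma keys_lift2 [simp]: "keys (lift2 c) = keys c"
  by (auto simp: in_keys_iff lookup_lift2 split: if_splits)

lemma red_lift2 [simp]: "red (lift2 c) = c"
  by (rule poly_mapping_eqI) (auto simp: lookup_red lookup_lift2)

lemma red_add: "red (c + d) = red c + red d"
  by (rule poly_mapping_eqI) (simp add: lookup_red lookup_add)

lemma red_0 [simp]: "red 0 = 0"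
  by (rule poly_mapping_eqI) (simp add: lookup_red)

lemma red_minus [simp]: "red (- c) = red c"
proof -
  have "red (- c) + red c = 0" using red_add[of "- c" c] by simp
  then show ?thesis using F2_eq_iff by blast
qed

lemma red_diff: "red (c - d) = red c + red d"
  using red_add[of c "- d"] by simp

text \<open>The support condition on the half \<open>e\<close> makes it a singular chain of whatever
  space carries \<open>c\<close>.\<close>

lemma red_eq_0_iff: "red c = 0 \<longleftrightarrow> (\<exists>e. keys e \<subseteq> keys c \<and> c = e + e)"
proof
  assume "red c = 0"
  then have ev: "even (coeff c s)" for s
    by (metis lookup_red lookup_zero of_int_bit_eq_0)
  define e where "e = Poly_Mapping.map (\<lambda>k. k div 2) c"
  have le: "coeff e s = coeff c s div 2" for s
    by (simp add: e_def Poly_Mapping.map.rep_eq when_def)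
  have "c = e + e"
    using ev by (intro poly_mapping_eqI) (simp add: lookup_add le flip: mult_2)
  moreover have "keys e \<subseteq> keys c"
    by (auto simp: in_keys_iff le)
  ultimately show "\<exists>e. keys e \<subseteq> keys c \<and> c = e + e" by blast
qed (auto simp: red_add)

lemma red_eq_iff: "red c = red d \<longleftrightarrow> (\<exists>e. c - d = e + e)"
proof -
  have "red c = red d \<longleftrightarrow> red (c - d) = 0"
    unfolding red_diff by (rule F2_eq_iff)
  then show ?thesis
    using red_eq_0_iff[of "c - d"] by (auto simp: red_add)
qed

text \<open>The map that \<open>\<phi>\<close> induces modulo 2. The section \<open>lift2\<close> is
  not additive, but for additive \<open>\<phi>\<close> the choice of lift does not matter.\<close>

definition ext2 :: "(('b \<Rightarrow>\<^sub>0 int) \<Rightarrow> ('c \<Rightarrow>\<^sub>0 int)) \<Rightarrow> ('b \<Rightarrow>\<^sub>0 bit) \<Rightarrow> ('c \<Rightarrow>\<^sub>0 bit)" where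
  "ext2 \<phi> c = red (\<phi> (lift2 c))"

text \<open>Two lifts of the same chain differ by a doubled chain, and additive maps send doubled
  chains to doubled chains.\<close>

lemma additive_red:
  assumes "Modules.additive \<phi>" "red c = red d" shows "red (\<phi> c) = red (\<phi> d)"
proof -
  interpret additive \<phi> by fact
  obtain e where "c - d = e + e" using assms(2) unfolding red_eq_iff by blast
  then have "\<phi> c - \<phi> d = \<phi> e + \<phi> e" using diff[of c d] add[of e e] by simp
  then show ?thesis unfolding red_eq_iff by blast
qed

lemma ext2_red: "Modules.additive \<phi> \<Longrightarrow> ext2 \<phi> (red c) = red (\<phi> c)"
  unfolding ext2_def by (rule additive_red) simp_all

lemma ext2_add: assumes "Modules.additive \<phi>" shows "ext2 \<phi> (c + d) = ext2 \<phi> c + ext2 \<phi> d"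
proof -
  interpret additive \<phi> by fact
  have "ext2 \<phi> (red (lift2 c + lift2 d)) = red (\<phi> (lift2 c)) + red (\<phi> (lift2 d))"
    using ext2_red[OF assms, of "lift2 c + lift2 d"] by (simp only: add red_add)
  then show ?thesis unfolding red_add red_lift2 by (simp only: ext2_def)
qed

lemma ext2_0: assumes "Modules.additive \<phi>" shows "ext2 \<phi> 0 = 0"
  using ext2_add[OF assms, of 0 0] by simp

section \<open>Singular chains with coefficients in F_2\<close>

definition ch :: "nat \<Rightarrow> 'a topology \<Rightarrow> 'a chain2 set" where
  "ch p X = {c. keys c \<subseteq> singular_simplex_set p X}"

lemma ch_red: "singular_chain p X c \<Longrightarrow> red c \<in> ch p X"
  using keys_red_subset[of c] by (auto simp: ch_def singular_chain_def)

lemma ch_lift2: "c \<in> ch p X \<Longrightarrow> singular_chain p X (lift2 c)"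
  by (simp add: ch_def singular_chain_def)

lemma ch_cases:
  assumes "c \<in> ch p X" obtains c' where "c = red c'" "singular_chain p X c'"
  using that[of "lift2 c"] assms by (simp add: ch_lift2)

lemma ch_0 [simp]: "0 \<in> ch p X"
  by (simp add: ch_def)

lemma ch_add [intro]: "c \<in> ch p X \<Longrightarrow> d \<in> ch p X \<Longrightarrow> c + d \<in> ch p X"
  using keys_add[of c d] by (auto simp: ch_def)

lemma ch_mono: "c \<in> ch p (subtopology X S) \<Longrightarrow> S \<subseteq> T \<Longrightarrow> c \<in> ch p (subtopology X T)"
  unfolding ch_def using singular_simplex_mono by blast

lemma ch_Int: "c \<in> ch p (subtopology X S) \<Longrightarrow> c \<in> ch p (subtopology X T) \<Longrightarrow> c \<in> ch p (subtopology X (S \<inter> T))"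
  by (auto simp: ch_def singular_simplex_subtopology subset_iff)

lemma ch_empty: "c \<in> ch p (subtopology X {}) \<Longrightarrow> c = 0"
proof -
  assume c: "c \<in> ch p (subtopology X {})"
  have "topspace (subtopology X {}) = {}" by simp
  then have "keys c \<subseteq> {}"
    using c singular_simplex_empty unfolding ch_def by blast
  then show ?thesis by simp
qed

text \<open>Modulo 2 a vanishing sum means that the two chains are equal, hence carried by the empty
  intersection.\<close>

lemma ch_disjoint:
  assumes "c \<in> ch p (subtopology X S)" "d \<in> ch p (subtopology X T)" "S \<inter> T = {}" "c + d = 0"
  shows "c = 0" "d = 0"
proof -
  have "c = d" using assms(4) F2_eq_iff by blast
  then show "c = 0" "d = 0" using assms ch_Int ch_empty by metis+
qed

lemma keys_restrict_split:
  fixes c :: "'b \<Rightarrow>\<^sub>0 bit"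
  assumes "keys c \<subseteq> S \<union> T"
  obtains d e where "keys d \<subseteq> S" "keys e \<subseteq> T" "c = d + e"
proof -
  obtain d e where de: "keys d \<subseteq> S" "keys e \<subseteq> T" "d + e = lift2 c"
    using frag_split[of "lift2 c" S T] assms by auto
  have "c = red d + red e" by (metis de(3) red_add red_lift2)
  then show ?thesis
    using de keys_red_subset[of d] keys_red_subset[of e] that[of "red d" "red e"] by blast
qed

subsection \<open>Boundaries and induced maps\<close>

definition bd :: "nat \<Rightarrow> 'a chain2 \<Rightarrow> 'a chain2" where
  "bd p = ext2 (chain_boundary p)"

definition cmap :: "nat \<Rightarrow> ('a \<Rightarrow> 'b) \<Rightarrow> 'a chain2 \<Rightarrow> 'b chain2" where
  "cmap p f = ext2 (chain_map p f)"

lemma additive_chain_boundary: "Modules.additive (chain_boundary p)"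
  by unfold_locales (rule chain_boundary_add)

lemma additive_chain_map: "Modules.additive (chain_map p f)"
  by unfold_locales (rule chain_map_add)

lemma bd_red: "bd p (red c) = red (chain_boundary p c)"
  by (simp add: bd_def ext2_red additive_chain_boundary)

lemma bd_add: "bd p (c + d) = bd p c + bd p d"
  by (simp add: bd_def ext2_add additive_chain_boundary)

lemma bd_0 [simp]: "bd p 0 = 0"
  by (simp add: bd_def ext2_0 additive_chain_boundary)

lemma bd_0' [simp]: "bd 0 c = 0"
  by (simp add: bd_def ext2_def chain_boundary_def)

lemma bd_in: "c \<in> ch p X \<Longrightarrow> bd p c \<in> ch (p - 1) X"
  by (erule ch_cases) (simp add: bd_red ch_red singular_chain_boundary)

lemma bd_in_Suc: "c \<in> ch (Suc p) X \<Longrightarrow> bd (Suc p) c \<in> ch p X"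
  using bd_in by fastforce

lemma bd_bd: "c \<in> ch p X \<Longrightarrow> bd (p - 1) (bd p c) = 0"
  by (erule ch_cases) (simp add: bd_red chain_boundary_boundary)

lemma bd_bd_Suc: "c \<in> ch (Suc p) X \<Longrightarrow> bd p (bd (Suc p) c) = 0"
  using bd_bd by fastforce

lemma cmap_red: "cmap p f (red c) = red (chain_map p f c)"
  by (simp add: cmap_def ext2_red additive_chain_map)

lemma cmap_add: "cmap p f (c + d) = cmap p f c + cmap p f d"
  by (simp add: cmap_def ext2_add additive_chain_map)

lemma cmap_0 [simp]: "cmap p f 0 = 0"
  by (simp add: cmap_def ext2_0 additive_chain_map)

lemma cmap_in: "c \<in> ch p X \<Longrightarrow> continuous_map X Y f \<Longrightarrow> cmap p f c \<in> ch p Y"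
  by (erule ch_cases) (auto simp: cmap_red intro!: ch_red singular_chain_chain_map)

lemma bd_cmap: "c \<in> ch p X \<Longrightarrow> bd p (cmap p f c) = cmap (p - 1) f (bd p c)"
  by (erule ch_cases) (simp add: cmap_red bd_red chain_boundary_chain_map)

lemma bd_cmap_Suc: "c \<in> ch (Suc p) X \<Longrightarrow> bd (Suc p) (cmap (Suc p) f c) = cmap p f (bd (Suc p) c)"
  using bd_cmap by fastforce

lemma cmap_cmap: "cmap p g (cmap p f c) = cmap p (g \<circ> f) c"
proof -
  have "cmap p g (cmap p f (red (lift2 c))) = cmap p (g \<circ> f) (red (lift2 c))"
    unfolding cmap_red by (simp add: chain_map_compose)
  then show ?thesis by simp
qed

lemma cmap_eq: "c \<in> ch p X \<Longrightarrow> (\<And>x. x \<in> topspace X \<Longrightarrow> f x = g x) \<Longrightarrow> cmap p f c = cmap p g c"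
  by (erule ch_cases) (auto simp: cmap_red intro!: arg_cong[of _ _ red] chain_map_eq)

lemma cmap_id: "c \<in> ch p X \<Longrightarrow> (\<And>x. x \<in> topspace X \<Longrightarrow> f x = x) \<Longrightarrow> cmap p f c = c"
  by (erule ch_cases) (auto simp: cmap_red intro!: arg_cong[of _ _ red] chain_map_id_gen)

lemma cmap_in_top_of_set:
  "c \<in> ch p (top_of_set S) \<Longrightarrow> continuous_on S f \<Longrightarrow> f ` S \<subseteq> T \<Longrightarrow> cmap p f c \<in> ch p (top_of_set T)"
  by (rule cmap_in) (auto simp: continuous_map_subtopology_eu image_subset_iff)

subsection \<open>Subdivision\<close>

definition sd :: "nat \<Rightarrow> nat \<Rightarrow> 'a chain2 \<Rightarrow> 'a chain2" where
  "sd n p = ext2 (singular_subdivision p ^^ n)"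

lemma additive_sd: "Modules.additive (singular_subdivision p ^^ n)"
proof
  show "(singular_subdivision p ^^ n) (x + y) = (singular_subdivision p ^^ n) x + (singular_subdivision p ^^ n) y" for x y :: "'a chain"
    by (induction n) (auto simp: singular_subdivision_add)
qed

lemma singular_chain_sd: "singular_chain p X c \<Longrightarrow> singular_chain p X ((singular_subdivision p ^^ n) c)"
  by (induction n) (auto simp: singular_chain_singular_subdivision)

lemma sd_red: "sd n p (red c) = red ((singular_subdivision p ^^ n) c)"
  by (simp add: sd_def ext2_red additive_sd)

lemma sd_add: "sd n p (c + d) = sd n p c + sd n p d"
  by (simp add: sd_def ext2_add additive_sd)

lemma sd_in: "c \<in> ch p X \<Longrightarrow> sd n p c \<in> ch p X"
  by (erule ch_cases) (simp add: sd_red ch_red singular_chain_sd)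

lemma bd_sd: "c \<in> ch p X \<Longrightarrow> bd p (sd n p c) = sd n (p - 1) (bd p c)"
proof (erule ch_cases)
  fix c' assume c: "c = red c'" "singular_chain p X c'"
  have "chain_boundary p ((singular_subdivision p ^^ n) c') = (singular_subdivision (p - 1) ^^ n) (chain_boundary p c')"
    by (induction n) (auto simp: chain_boundary_singular_subdivision[OF singular_chain_sd[OF c(2)]])
  then show ?thesis by (simp add: c sd_red bd_red)
qed

lemma sd_cmap: "c \<in> ch p X \<Longrightarrow> sd n p (cmap p f c) = cmap p f (sd n p c)"
proof (erule ch_cases)
  fix c' assume c: "c = red c'" "singular_chain p X c'"
  have "(singular_subdivision p ^^ n) (chain_map p f c') = chain_map p f ((singular_subdivision p ^^ n) c')"
    by (induction n) (auto simp: naturality_singular_subdivision[OF singular_chain_sd[OF c(2)]])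
  then show ?thesis by (simp add: c sd_red cmap_red)
qed

text \<open>A single \<open>h\<close> serves all spaces \<open>X\<close>, so it sends chains of a
  subspace to chains of the same subspace. This is what lets subdivision preserve relative
  classes.\<close>

lemma sd_homotopy:
  obtains h :: "nat \<Rightarrow> 'a chain2 \<Rightarrow> 'a chain2" where
    "\<And>p X c. c \<in> ch p X \<Longrightarrow> h p c \<in> ch (Suc p) X"
    "\<And>p X c. c \<in> ch p X \<Longrightarrow> sd n p c = c + bd (Suc p) (h p c) + h (p - 1) (bd p c)"
proof -
  obtain h where h: "\<And>p. h p 0 = (0 :: 'a chain)"
        "\<And>p c1 c2. h p (c1-c2) = h p c1 - h p c2"
        "\<And>p X c. singular_chain p X c \<Longrightarrow> singular_chain (Suc p) X (h p c)"
        "\<And>p X c. singular_chain p X c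
                 \<Longrightarrow> chain_boundary (Suc p) (h p c) + h (p - Suc 0) (chain_boundary p c)
                   = (singular_subdivision p ^^ n) c - c"
    by (rule chain_homotopic_iterated_singular_subdivision[of n]) (rule that; assumption)
  have ad: "Modules.additive (h p)" for p
  proof
    fix x y :: "'a chain"
    have "h p (- y) = - h p y" using h(1)[of p] h(2)[of p 0 y] by simp
    then show "h p (x + y) = h p x + h p y" using h(2)[of p x "-y"] by simp
  qed
  show ?thesis
  proof (rule that[of "\<lambda>p. ext2 (h p)"])
    fix p X and c :: "'a chain2" assume c: "c \<in> ch p X"
    then show "ext2 (h p) c \<in> ch (Suc p) X"
      by (auto elim!: ch_cases simp: ext2_red[OF ad] intro!: ch_red h)
    obtain c' where c': "c = red c'" "singular_chain p X c'" using c ch_cases by metis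
    have "(singular_subdivision p ^^ n) c' = c' + chain_boundary (Suc p) (h p c') + h (p - 1) (chain_boundary p c')"
      using h(4)[OF c'(2)] by (simp add: algebra_simps)
    then show "sd n p c = c + bd (Suc p) (ext2 (h p) c) + ext2 (h (p - 1)) (bd p c)"
      by (simp only: c'(1) sd_red bd_red ext2_red[OF ad] red_add)
  qed
qed

text \<open>Every exponent beyond a bound works, so that two chains can be subdivided equally
  often.\<close>

lemma sd_split:
  assumes U: "openin X U" "openin X V" "topspace X \<subseteq> U \<union> V" and c: "c \<in> ch p X"
  obtains N where "\<And>n. n \<ge> N \<Longrightarrow> \<exists>c1\<in>ch p (subtopology X U). \<exists>c2\<in>ch p (subtopology X V). sd n p c = c1 + c2"
proof -
  obtain c' where c': "c = red c'" "singular_chain p X c'" using c ch_cases by metis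
  obtain N where N: "\<And>m f. \<lbrakk>N \<le> m; f \<in> keys ((singular_subdivision p ^^ m) c')\<rbrakk>
                      \<Longrightarrow> \<exists>V \<in> {U,V}. f \<in> (standard_simplex p) \<rightarrow> V"
  proof (rule sufficient_iterated_singular_subdivision_exists[of "{U,V}" X p c'])
    show "openin X W" if "W \<in> {U,V}" for W using that U by auto
    show "topspace X \<subseteq> \<Union>{U,V}" using U by simp
    show "singular_chain p X c'" by fact
  qed blast
  show ?thesis
  proof
    fix n assume n: "n \<ge> N"
    have "f \<in> singular_simplex_set p (subtopology X U) \<union> singular_simplex_set p (subtopology X V)"
      if that: "f \<in> keys (sd n p c)" for f
    proof -
      have "f \<in> keys ((singular_subdivision p ^^ n) c')"
        using that keys_red_subset[of "(singular_subdivision p ^^ n) c'"] by (simp add: c' sd_red subset_iff)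
      moreover have "singular_simplex p X f"
        using sd_in[OF c] that by (auto simp: ch_def)
      moreover have "f \<in> (standard_simplex p) \<rightarrow> U \<or> f \<in> (standard_simplex p) \<rightarrow> V"
        using N[OF n calculation(1)] by simp
      ultimately show ?thesis unfolding Un_iff mem_Collect_eq singular_simplex_subtopology image_subset_iff Pi_iff
        by metis
    qed
    then have "keys (sd n p c) \<subseteq> singular_simplex_set p (subtopology X U) \<union> singular_simplex_set p (subtopology X V)"
      by (rule subsetI)
    then obtain c1 c2 where "keys c1 \<subseteq> singular_simplex_set p (subtopology X U)"
        "keys c2 \<subseteq> singular_simplex_set p (subtopology X V)" "sd n p c = c1 + c2"
      by (rule keys_restrict_split)
    then have "c1 \<in> ch p (subtopology X U)" "c2 \<in> ch p (subtopology X V)" "sd n p c = c1 + c2"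
      by (simp_all add: ch_def)
    then show "\<exists>c1\<in>ch p (subtopology X U). \<exists>c2\<in>ch p (subtopology X V). sd n p c = c1 + c2"
      by (intro bexI)
  qed
qed

text \<open>The image of a simplex is connected, so it lies entirely in one of two disjoint
  relatively closed pieces.\<close>

lemma ch_split_disjoint:
  assumes c: "c \<in> ch p (subtopology X (S \<union> T))"
    and S: "closedin (subtopology X (S \<union> T)) S" and T: "closedin (subtopology X (S \<union> T)) T" and "S \<inter> T = {}"
  obtains c1 c2 where "c1 \<in> ch p (subtopology X S)" "c2 \<in> ch p (subtopology X T)" "c = c1 + c2"
proof -
  let ?X = "subtopology X (S \<union> T)"
  have "f \<in> singular_simplex_set p (subtopology X S) \<union> singular_simplex_set p (subtopology X T)"
      if f: "singular_simplex p ?X f" for f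
  proof -
    have "connectedin ?X (f ` standard_simplex p)"
      using f connectedin_continuous_map_image[of "subtopology (powertop_real UNIV) (standard_simplex p)" ?X f "standard_simplex p"]
      by (simp add: singular_simplex_def connectedin_standard_simplex connectedin_subtopology)
    moreover have sub: "f ` standard_simplex p \<subseteq> S \<union> T"
      using f by (simp add: singular_simplex_subtopology)
    moreover have "S \<inter> T \<inter> f ` standard_simplex p = {}" using assms(4) by blast
    ultimately have "S \<inter> f ` standard_simplex p = {} \<or> T \<inter> f ` standard_simplex p = {}"
      using S T unfolding connectedin_closedin by metis
    then have "f ` standard_simplex p \<subseteq> S \<or> f ` standard_simplex p \<subseteq> T"
      using sub by blast
    then show ?thesis using f by (auto simp: singular_simplex_subtopology)
  qed
  then have "keys c \<subseteq> singular_simplex_set p (subtopology X S) \<union> singular_simplex_set p (subtopology X T)"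
    using c unfolding ch_def by blast
  then obtain c1 c2 where "keys c1 \<subseteq> singular_simplex_set p (subtopology X S)"
        "keys c2 \<subseteq> singular_simplex_set p (subtopology X T)" "c = c1 + c2"
    by (rule keys_restrict_split)
  then show ?thesis
    using that[of c1 c2] unfolding ch_def by simp
qed

section \<open>The prism operator\<close>

text \<open>A natural prism operator by acyclic models: its value on the identity of each simplex is chosen
  inductively, the obstruction being a cycle in a contractible space.\<close>

abbreviation simplex_top :: "nat \<Rightarrow> (nat \<Rightarrow> real) topology" where
  "simplex_top q \<equiv> subtopology (powertop_real UNIV) (standard_simplex q)"

abbreviation simplex_id :: "nat \<Rightarrow> (nat \<Rightarrow> real) chain" where
  "simplex_id q \<equiv> frag_of (restrict id (standard_simplex q))"

abbreviation cyl_top :: "'a topology \<Rightarrow> (real \<times> 'a) topology" where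
  "cyl_top X \<equiv> prod_topology (top_of_set {0..1}) X"

lemma singular_chain_simplex_id: "singular_chain q (simplex_top q) (simplex_id q)"
  unfolding singular_chain_of by (auto simp: singular_simplex_def intro: continuous_map_eq[OF continuous_map_id])

text \<open>The contraction makes \<open>z\<close> homologous to its image under a constant map, and
  in positive degrees every integral cycle of a one-point space bounds.\<close>

lemma cycle_bounds_if_contractible:
  assumes "homotopic_with (\<lambda>h. True) X X id (\<lambda>x. a)" "a \<in> topspace X"
    and z: "singular_chain p X z" "chain_boundary p z = 0" and p: "p \<ge> 1"
  obtains d where "singular_chain (Suc p) X d" "chain_boundary (Suc p) d = z"
proof -
  let ?w = "chain_map p (\<lambda>x. a) z" and ?A = "subtopology X {a}"
  have "singular_relcycle p X {} z"
    using z by (simp add: singular_cycle)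
  then have "homologous_rel p X {} (chain_map p id z) ?w"
    using assms(1) by (intro homotopic_imp_homologous_rel_chain_maps[where T="{}"]) auto
  moreover have "chain_map p id z = z" using z(1) by (rule chain_map_id_gen) simp
  ultimately have 1: "singular_relboundary p X {} (z - ?w)" by (simp add: homologous_rel_def)
  have "continuous_map X ?A (\<lambda>x. a)" using assms(2) by (auto simp: continuous_map_in_subtopology)
  then have "singular_chain p ?A ?w" using z(1) singular_chain_chain_map by blast
  moreover have "chain_boundary p ?w = 0" using z chain_boundary_chain_map by fastforce
  ultimately have "singular_relboundary p ?A {} ?w"
    using singular_boundary_eq_cycle_singleton[of ?A a p] assms(2) p by (simp add: singular_cycle)
  then have "singular_relboundary p X {} ?w"
    by (metis singular_boundary_mono subtopology_topspace inf.cobounded1 topspace_subtopology subtopology_subtopology singular_boundary singular_chain_subtopology)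
  then have "singular_relboundary p X {} z"
    using 1 singular_relboundary_add[of p X "{}" "z - ?w" ?w] by simp
  then show ?thesis using that by (auto simp: singular_boundary)
qed

text \<open>Straight-line contraction to the vertex e_0 at the bottom end; convexity keeps it inside
  the cylinder.\<close>

lemma contractible_cyl_simplex:
  "homotopic_with (\<lambda>h. True) (cyl_top (simplex_top q)) (cyl_top (simplex_top q)) id (\<lambda>x. (0, \<lambda>j. if j = 0 then 1 else 0))"
proof -
  let ?e = "\<lambda>j::nat. if j = 0 then 1 else (0::real)"
  let ?h = "\<lambda>(s::real, (t::real, u::nat \<Rightarrow> real)). ((1 - s) * t, \<lambda>j. (1 - s) * u j + s * ?e j)"
  let ?Y = "cyl_top (cyl_top (simplex_top q))"
  have s: "continuous_map ?Y euclideanreal fst"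
    using continuous_map_fst continuous_map_into_fulltopology by blast
  have t: "continuous_map ?Y euclideanreal (\<lambda>x. fst (snd x))"
    using continuous_map_compose[OF continuous_map_snd continuous_map_fst] continuous_map_into_fulltopology
    by (metis (no_types, lifting) comp_apply continuous_map_eq)
  have u: "continuous_map ?Y (powertop_real UNIV) (\<lambda>x. snd (snd x))"
    using continuous_map_compose[OF continuous_map_snd continuous_map_snd] continuous_map_into_fulltopology
    by (metis (no_types, lifting) comp_apply continuous_map_eq)
  have uj: "continuous_map ?Y euclideanreal (\<lambda>x. snd (snd x) j)" for j
    using u by (simp add: continuous_map_componentwise_UNIV)
  have 1: "continuous_map ?Y (powertop_real UNIV) (\<lambda>x. (\<lambda>j. (1 - fst x) * snd (snd x) j + fst x * ?e j))"
    unfolding continuous_map_componentwise_UNIV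
    by (intro allI continuous_intros s uj)
  have "(1 - s) * t \<le> 1" if "0 \<le> s" "s \<le> 1" "0 \<le> t" "t \<le> 1" for s t :: real
    using that by (simp add: mult_le_one)
  moreover have "(\<lambda>j. (1 - s) * u j + s * ?e j) \<in> standard_simplex q"
    if "0 \<le> s" "s \<le> 1" "u \<in> standard_simplex q" for s u
  proof -
    have "?e \<in> standard_simplex q" by (simp)
    then show ?thesis using convex_standard_simplex[of u q ?e "s"] that
      by (simp add: add.commute)
  qed
  ultimately have "continuous_map ?Y (cyl_top (simplex_top q)) (\<lambda>x. ((1 - fst x) * fst (snd x), \<lambda>j. (1 - fst x) * snd (snd x) j + fst x * ?e j))"
    unfolding continuous_map_pairwise o_def fst_conv snd_conv continuous_map_in_subtopology
    by (intro conjI 1 continuous_intros s t) auto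
  then have "continuous_map ?Y (cyl_top (simplex_top q)) ?h"
    by (simp add: case_prod_unfold)
  then show ?thesis
    unfolding homotopic_with_def by (intro exI[of _ ?h]) auto
qed

text \<open>Since one model chain \<open>m\<close> is pushed forward along every simplex, naturality
  holds as an equality of chains and not just up to homotopy.\<close>

definition prismz :: "(real \<times> (nat \<Rightarrow> real)) chain \<Rightarrow> nat \<Rightarrow> 'a chain \<Rightarrow> (real \<times> 'a) chain" where
  "prismz m q = frag_extend (\<lambda>\<sigma>. chain_map (Suc q) (\<lambda>(t, u). (t, \<sigma> u)) m)"

lemma prismz_diff: "prismz m q (a - b) = prismz m q a - prismz m q b"
  by (simp add: prismz_def frag_extend_diff)

lemma prismz_0 [simp]: "prismz m q 0 = 0"
  by (simp add: prismz_def)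

lemma prismz_of: "prismz m q (frag_of \<sigma>) = chain_map (Suc q) (\<lambda>(t, u). (t, \<sigma> u)) m"
  by (simp add: prismz_def)

lemma continuous_map_cyl:
  "continuous_map X Y f \<Longrightarrow> continuous_map (cyl_top X) (cyl_top Y) (\<lambda>(t, u). (t, f u))"
  unfolding case_prod_unfold continuous_map_pairwise o_def
  using continuous_map_compose[OF continuous_map_snd, of X Y f "top_of_set {0..1}"] continuous_map_fst by (auto simp: o_def)

lemma singular_chain_prismz:
  assumes "singular_chain (Suc q) (cyl_top (simplex_top q)) m" "singular_chain q X c"
  shows "singular_chain (Suc q) (cyl_top X) (prismz m q c)"
  unfolding prismz_def
proof (rule singular_chain_extend)
  fix \<sigma> assume "\<sigma> \<in> keys c"
  then have "continuous_map (simplex_top q) X \<sigma>"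
    using assms(2) by (auto simp: singular_chain_def singular_simplex_def)
  then show "singular_chain (Suc q) (cyl_top X) (chain_map (Suc q) (\<lambda>(t, u). (t, \<sigma> u)) m)"
    using assms(1) continuous_map_cyl singular_chain_chain_map by blast
qed

lemma prismz_natural:
  assumes m: "singular_chain (Suc q) (cyl_top (simplex_top q)) m" and "singular_chain q X c"
  shows "chain_map (Suc q) (\<lambda>(t, x). (t, f x)) (prismz m q c) = prismz m q (chain_map q f c)"
  using assms(2) unfolding singular_chain_def
proof (induction c rule: frag_induction)
  case (one \<sigma>)
  have "chain_map (Suc q) (\<lambda>(t, x). (t, f x)) (prismz m q (frag_of \<sigma>)) = chain_map (Suc q) ((\<lambda>(t, x). (t, f x)) \<circ> (\<lambda>(t, u). (t, \<sigma> u))) m"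
    by (simp add: prismz_of chain_map_compose)
  also have "\<dots> = chain_map (Suc q) (\<lambda>(t, u). (t, simplex_map q f \<sigma> u)) m"
    by (rule chain_map_eq[OF m]) (auto simp: simplex_map_def)
  finally show ?case by (simp add: prismz_of)
qed (auto simp: prismz_diff chain_map_diff)

text \<open>The prism identity on the identity simplex, with \<open>m'\<close> the model one degree
  lower. At \<open>q = 0\<close> the boundary term vanishes and \<open>q - 1\<close> is again 0, so
  \<open>m'\<close> is then just some 1-chain on the cylinder over the 0-simplex.\<close>

definition prism_step :: "nat \<Rightarrow> (real \<times> (nat \<Rightarrow> real)) chain \<Rightarrow> (real \<times> (nat \<Rightarrow> real)) chain \<Rightarrow> bool" where
  "prism_step q m' m \<longleftrightarrow> singular_chain (Suc q) (cyl_top (simplex_top q)) m \<and>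
     singular_chain (Suc (q - 1)) (cyl_top (simplex_top (q - 1))) m' \<and>
     chain_boundary (Suc q) m = chain_map q (Pair 1) (simplex_id q) - chain_map q (Pair 0) (simplex_id q)
       - prismz m' (q - 1) (chain_boundary q (simplex_id q))"

text \<open>On one simplex \<sigma> every term is the push-forward along (t, u) \<mapsto> (t,
  \<sigma> u) of the corresponding term of the model identity; additivity does the rest.\<close>

lemma boundary_prismz:
  assumes st: "prism_step q m' m" and "singular_chain q X c"
  shows "chain_boundary (Suc q) (prismz m q c) =
    chain_map q (Pair 1) c - chain_map q (Pair 0) c - prismz m' (q - 1) (chain_boundary q c)"
  using assms(2) unfolding singular_chain_def
proof (induction c rule: frag_induction)
  case (one \<sigma>)
  then have \<sigma>: "singular_simplex q X \<sigma>" by simp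
  let ?g = "\<lambda>(t::real, u). (t, \<sigma> u)"
  have id: "chain_map q \<sigma> (simplex_id q) = frag_of \<sigma>"
    by (rule singular_simplex_chain_map_id[OF \<sigma>])
  have m: "singular_chain (Suc q) (cyl_top (simplex_top q)) m"
    and m': "singular_chain (Suc (q - 1)) (cyl_top (simplex_top (q - 1))) m'"
    using st by (auto simp: prism_step_def)
  have ends: "chain_map q ?g (chain_map q (Pair t) (simplex_id q)) = chain_map q (Pair t) (frag_of \<sigma>)" for t :: real
  proof -
    have "chain_map q ?g (chain_map q (Pair t) (simplex_id q)) = chain_map q (?g \<circ> Pair t) (simplex_id q)"
      unfolding chain_map_compose by simp
    also have "?g \<circ> Pair t = Pair t \<circ> \<sigma>" by auto
    also have "chain_map q (Pair t \<circ> \<sigma>) (simplex_id q) = chain_map q (Pair t) (frag_of \<sigma>)"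
      unfolding chain_map_compose o_apply id ..
    finally show ?thesis .
  qed
  have pr: "chain_map q ?g (prismz m' (q - 1) (chain_boundary q (simplex_id q))) = prismz m' (q - 1) (chain_boundary q (frag_of \<sigma>))"
  proof (cases "q = 0")
    case True then show ?thesis by (simp add: chain_boundary_def)
  next
    case False
    then have "chain_map q ?g (prismz m' (q - 1) (chain_boundary q (simplex_id q))) = prismz m' (q - 1) (chain_map (q - 1) \<sigma> (chain_boundary q (simplex_id q)))"
      using prismz_natural[OF m' , of "simplex_top q" "chain_boundary q (simplex_id q)" \<sigma>]
        singular_chain_boundary[OF singular_chain_simplex_id, of q] by simp
    also have "chain_map (q - 1) \<sigma> (chain_boundary q (simplex_id q)) = chain_boundary q (frag_of \<sigma>)"
      using chain_boundary_chain_map[OF singular_chain_simplex_id, of q \<sigma>] unfolding id by simp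
    finally show ?thesis .
  qed
  have "chain_boundary (Suc q) (prismz m q (frag_of \<sigma>)) = chain_map q ?g (chain_boundary (Suc q) m)"
    using chain_boundary_chain_map[OF m, of ?g] by (simp add: prismz_of)
  also have "\<dots> = chain_map q (Pair 1) (frag_of \<sigma>) - chain_map q (Pair 0) (frag_of \<sigma>) - prismz m' (q - 1) (chain_boundary q (frag_of \<sigma>))"
    using st unfolding prism_step_def by (simp only: chain_map_diff ends pr)
  finally show ?case .
next
  case (diff a b)
  then show ?case by (simp add: prismz_diff chain_boundary_diff chain_map_diff)
qed auto

lemma prism_step_exists:
  assumes st: "prism_step q m' m"
  shows "\<exists>n. prism_step (Suc q) m n"
proof -
  let ?X = "simplex_top (Suc q)" and ?i = "simplex_id (Suc q)"
  define b where "b = chain_boundary (Suc q) ?i"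
  define z where "z = chain_map (Suc q) (Pair 1) ?i - chain_map (Suc q) (Pair 0) ?i - prismz m q b"
  have b: "singular_chain q ?X b" "chain_boundary q b = 0"
    using singular_chain_boundary[OF singular_chain_simplex_id, of "Suc q"]
      chain_boundary_boundary[OF singular_chain_simplex_id, of "Suc q"] by (simp_all add: b_def)
  have m: "singular_chain (Suc q) (cyl_top (simplex_top q)) m"
    using st by (auto simp: prism_step_def)
  have P: "continuous_map ?X (cyl_top ?X) (Pair t)" if "t \<in> {0..1}" for t
    using that by (simp add: continuous_map_pairwise o_def)
  have Pi: "singular_chain (Suc q) (cyl_top ?X) (chain_map (Suc q) (Pair t) ?i)" if "t \<in> {0..1}" for t
    using singular_chain_chain_map[OF singular_chain_simplex_id P[OF that]] .
  have zc: "singular_chain (Suc q) (cyl_top ?X) z"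
    unfolding z_def by (intro singular_chain_diff Pi singular_chain_prismz[OF m b(1)]) auto
  \<comment> \<open>The boundary formula one degree lower, applied to \<open>b\<close>, reproduces
    exactly the boundaries of the two end terms, and its own last term dies because \<open>b\<close>
    is a cycle.\<close>
  have "chain_boundary (Suc q) z = 0"
    unfolding z_def chain_boundary_diff boundary_prismz[OF st b(1)]
    by (simp add: b chain_boundary_chain_map[OF singular_chain_simplex_id] del: chain_map_of flip: b_def)
  then obtain d where "singular_chain (Suc (Suc q)) (cyl_top ?X) d" "chain_boundary (Suc (Suc q)) d = z"
    using cycle_bounds_if_contractible[OF contractible_cyl_simplex _ zc] by auto
  then show ?thesis
    using m unfolding prism_step_def z_def b_def by auto
qed

lemma prism_step_0: "\<exists>m. prism_step 0 0 m"
proof -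
  let ?X = "simplex_top 0"
  have hom: "homotopic_with (\<lambda>h. h \<in> {} \<rightarrow> {}) ?X (cyl_top ?X) (Pair 1) (Pair (0::real))"
    unfolding homotopic_with_def
    \<comment> \<open>Time runs backwards so that the resulting homology has top minus bottom as its
      boundary.\<close>
    by (intro exI[of _ "\<lambda>(t, u). (1 - t, u)"])
      (auto simp: case_prod_unfold continuous_map_pairwise o_def continuous_map_in_subtopology continuous_map_snd
        intro!: continuous_intros continuous_map_into_fulltopology[OF continuous_map_fst]
          continuous_map_into_fulltopology[OF continuous_map_snd])
  have "singular_relcycle 0 ?X {} (simplex_id 0)"
    by (simp add: singular_cycle singular_chain_simplex_id chain_boundary_def)
  then have "homologous_rel 0 (cyl_top ?X) {} (chain_map 0 (Pair 1) (simplex_id 0)) (chain_map 0 (Pair 0) (simplex_id 0))"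
    by (rule homotopic_imp_homologous_rel_chain_maps[OF hom])
  then obtain d where "singular_chain 1 (cyl_top ?X) d" "chain_boundary 1 d = chain_map 0 (Pair 1) (simplex_id 0) - chain_map 0 (Pair 0) (simplex_id 0)"
    by (auto simp: homologous_rel_def singular_boundary)
  then show ?thesis
    by (intro exI[of _ d]) (simp add: prism_step_def chain_boundary_def)
qed

lemma prism_models: "\<exists>M. \<forall>q. prism_step q (M (q - 1)) (M q)"
proof -
  have "\<exists>f. \<forall>n. (case f n of (a, b) \<Rightarrow> prism_step n a b) \<and> fst (f (Suc n)) = snd (f n)"
    by (rule dependent_nat_choice) (use prism_step_0 prism_step_exists in auto)
  then obtain f where f: "\<And>n. prism_step n (fst (f n)) (snd (f n))" "\<And>n. fst (f (Suc n)) = snd (f n)"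
    by (auto simp: case_prod_unfold)
  have "prism_step q (snd (f (q - 1))) (snd (f q))" for q
  proof (cases q)
    case 0
    \<comment> \<open>For \<open>q = 0\<close> the index \<open>q - 1\<close> is 0 itself; the model
      may serve as its own predecessor because the boundary term is zero.\<close>
    have "prism_step 0 (snd (f 0)) (snd (f 0))"
      using f(1)[of 0] by (simp add: prism_step_def chain_boundary_def)
    then show ?thesis using 0 by simp
  next
    case (Suc k)
    then show ?thesis using f(1)[of q] f(2)[of k] by simp
  qed
  then show ?thesis by (intro exI[of _ "\<lambda>q. snd (f q)"] allI)
qed

definition prism_model :: "nat \<Rightarrow> (real \<times> (nat \<Rightarrow> real)) chain" where
  "prism_model = (SOME M. \<forall>q. prism_step q (M (q - 1)) (M q))"

lemma prism_step_model: "prism_step q (prism_model (q - 1)) (prism_model q)"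
  using someI_ex[OF prism_models] unfolding prism_model_def by blast

definition prism :: "nat \<Rightarrow> 'a chain2 \<Rightarrow> (real \<times> 'a) chain2" where
  "prism q = ext2 (prismz (prism_model q) q)"

lemma additive_prismz: "Modules.additive (prismz m q)"
  by unfold_locales (simp add: prismz_def frag_extend_add)

lemma prism_red: "prism q (red c) = red (prismz (prism_model q) q c)"
  by (simp add: prism_def ext2_red additive_prismz)

lemma prism_add: "prism q (c + d) = prism q c + prism q d"
  by (simp add: prism_def ext2_add additive_prismz)

lemma prism_0 [simp]: "prism q 0 = 0"
  by (simp add: prism_def ext2_0 additive_prismz)

lemma prism_in: "c \<in> ch q X \<Longrightarrow> prism q c \<in> ch (Suc q) (cyl_top X)"
  using prism_step_model[of q] unfolding prism_step_def
  by (auto elim!: ch_cases simp: prism_red intro!: ch_red singular_chain_prismz)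

lemma bd_prism:
  "c \<in> ch q X \<Longrightarrow> bd (Suc q) (prism q c) = cmap q (Pair 1) c + cmap q (Pair 0) c + prism (q - 1) (bd q c)"
  by (erule ch_cases) (simp add: prism_red bd_red cmap_red boundary_prismz[OF prism_step_model] red_diff)

lemma prism_natural:
  assumes "c \<in> ch q X"
  shows "cmap (Suc q) (\<lambda>(t, x). (t, f x)) (prism q c) = prism q (cmap q f c)"
  using assms
proof (rule ch_cases)
  fix c' assume c: "c = red c'" "singular_chain q X c'"
  have m: "singular_chain (Suc q) (cyl_top (simplex_top q)) (prism_model q)"
    using prism_step_model[of q] by (simp add: prism_step_def)
  show ?thesis
    unfolding c(1) prism_red cmap_red prismz_natural[OF m c(2)] ..
qed

section \<open>Relative boundaries and cylinders\<close>

lemma F2_swap: "a + b = c + d \<Longrightarrow> a + c = b + (d :: 'b \<Rightarrow>\<^sub>0 bit)"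
  by (metis F2_self_left add.commute add.left_commute)

abbreviation chS :: "nat \<Rightarrow> 'a::topological_space set \<Rightarrow> 'a chain2 set" where
  "chS p S \<equiv> ch p (top_of_set S)"

lemma chS_mono: "c \<in> chS p S \<Longrightarrow> S \<subseteq> T \<Longrightarrow> c \<in> chS p T"
  by (rule ch_mono)

lemma chS_Int: "c \<in> chS p S \<Longrightarrow> c \<in> chS p T \<Longrightarrow> c \<in> chS p (S \<inter> T)"
  by (rule ch_Int)

lemma cmapS_in: "c \<in> chS p S \<Longrightarrow> continuous_on S f \<Longrightarrow> (\<And>x. x \<in> S \<Longrightarrow> f x \<in> T) \<Longrightarrow> cmap p f c \<in> chS p T"
  by (rule cmap_in_top_of_set) auto

lemma cmapS_eq: "c \<in> chS p S \<Longrightarrow> (\<And>x. x \<in> S \<Longrightarrow> f x = g x) \<Longrightarrow> cmap p f c = cmap p g c"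
  by (rule cmap_eq) auto

lemma cmapS_id: "c \<in> chS p S \<Longrightarrow> (\<And>x. x \<in> S \<Longrightarrow> f x = x) \<Longrightarrow> cmap p f c = c"
  by (rule cmap_id) auto

lemma prismS_in: "c \<in> chS q A \<Longrightarrow> prism q c \<in> chS (Suc q) ({0..1} \<times> A)"
  using prism_in[of c q "top_of_set A"] by (simp add: prod_topology_subtopology subtopology_subtopology Times_Int_Times)

lemma sdS_split:
  assumes U: "openin (top_of_set D) U" "openin (top_of_set D) V" "D \<subseteq> U \<union> V" and c: "c \<in> chS p D"
  obtains K where "\<And>n. n \<ge> K \<Longrightarrow> \<exists>c1\<in>chS p U. \<exists>c2\<in>chS p V. sd n p c = c1 + c2"
proof -
  have UV: "U \<subseteq> D" "V \<subseteq> D" using U openin_imp_subset by blast+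
  then have "subtopology (top_of_set D) U = top_of_set U" "subtopology (top_of_set D) V = top_of_set V"
    by (simp_all add: subtopology_subtopology Int_absorb1)
  then show ?thesis
    using sd_split[OF U(1,2) _ c] U(3) that by (metis topspace_euclidean_subtopology)
qed

lemma bd_prism_cmap:
  assumes c: "c \<in> chS q S"
  shows "bd (Suc q) (cmap (Suc q) H (prism q c)) =
    cmap q (\<lambda>x. H (1, x)) c + cmap q (\<lambda>x. H (0, x)) c + cmap q H (prism (q - 1) (bd q c))"
  unfolding bd_cmap_Suc[OF prism_in[OF c]] bd_prism[OF c] cmap_add cmap_cmap by (simp add: o_def)

definition relb :: "nat \<Rightarrow> 'a::topological_space set \<Rightarrow> 'a set \<Rightarrow> 'a chain2 set" where
  "relb p D E = {bd (Suc p) d + s | d s. d \<in> chS (Suc p) D \<and> s \<in> chS p E}"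

lemma relb_I: "d \<in> chS (Suc p) D \<Longrightarrow> s \<in> chS p E \<Longrightarrow> c = bd (Suc p) d + s \<Longrightarrow> c \<in> relb p D E"
  by (auto simp: relb_def)

lemma relb_E:
  assumes "c \<in> relb p D E" obtains d s where "d \<in> chS (Suc p) D" "s \<in> chS p E" "c = bd (Suc p) d + s"
  using assms by (auto simp: relb_def)

lemma relb_sub: "s \<in> chS p E \<Longrightarrow> s \<in> relb p D E"
  by (rule relb_I[where d=0]) auto

lemma relb_add: "c \<in> relb p D E \<Longrightarrow> d \<in> relb p D E \<Longrightarrow> c + d \<in> relb p D E"
proof (elim relb_E)
  fix d1 s1 d2 s2 assume *: "d1 \<in> chS (Suc p) D" "s1 \<in> chS p E" "c = bd (Suc p) d1 + s1" "d2 \<in> chS (Suc p) D" "s2 \<in> chS p E" "d = bd (Suc p) d2 + s2"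
  then show ?thesis
    by (intro relb_I[of "d1 + d2" _ _ "s1 + s2"]) (auto simp: bd_add F2_ac)
qed

lemma relb_trans: "c + d \<in> relb p D E \<Longrightarrow> d + e \<in> relb p D E \<Longrightarrow> c + e \<in> relb p D E"
  using relb_add[of "c + d" p D E "d + e"] by (simp add: F2_ac)

lemma relb_cmap:
  assumes "c \<in> relb p D E" "continuous_on D f" "f ` D \<subseteq> D'" "f ` E \<subseteq> E'" "E \<subseteq> D"
  shows "cmap p f c \<in> relb p D' E'"
proof -
  obtain d s where ds: "d \<in> chS (Suc p) D" "s \<in> chS p E" "c = bd (Suc p) d + s"
    using assms(1) by (rule relb_E)
  show ?thesis
  proof (rule relb_I)
    show "cmap (Suc p) f d \<in> chS (Suc p) D'" by (rule cmapS_in[OF ds(1)]) (use assms in auto)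
    show "cmap p f s \<in> chS p E'" by (rule cmapS_in[OF ds(2)]) (use assms continuous_on_subset in auto)
    show "cmap p f c = bd (Suc p) (cmap (Suc p) f d) + cmap p f s"
      by (simp add: bd_cmap_Suc[OF ds(1)] ds(3) cmap_add)
  qed
qed

text \<open>The prism over \<open>c\<close> bounds the difference of the two ends up to the prism
  over the boundary of \<open>c\<close>, which the homotopy keeps in \<open>E'\<close>.\<close>

lemma relb_homotopy:
  fixes H :: "real \<times> 'a::topological_space \<Rightarrow> 'c::topological_space"
  assumes c: "c \<in> chS p D" "bd p c \<in> chS (p - 1) E"
    and H: "continuous_on ({0..1} \<times> D) H" "H ` ({0..1} \<times> D) \<subseteq> D'" "H ` ({0..1} \<times> E) \<subseteq> E'" "E \<subseteq> D"
  shows "cmap p (\<lambda>x. H (1, x)) c + cmap p (\<lambda>x. H (0, x)) c \<in> relb p D' E'"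
proof (rule relb_I)
  show "cmap (Suc p) H (prism p c) \<in> chS (Suc p) D'"
    by (rule cmapS_in[OF prismS_in[OF c(1)]]) (use H in auto)
  show "cmap p H (prism (p - 1) (bd p c)) \<in> chS p E'"
  \<comment> \<open>In degree 0 the term has the wrong formal degree \<open>Suc (0 - 1)\<close>, but
    there the boundary is zero.\<close>
  proof (cases p)
    case (Suc q)
    have "continuous_on ({0..1} \<times> E) H" by (rule continuous_on_subset[OF H(1)]) (use H(4) in auto)
    then show ?thesis
      by (rule cmapS_in[of _ _ "{0..1} \<times> E", rotated]) (use prismS_in[OF c(2)] Suc H(3) in auto)
  qed simp
  show "cmap p (\<lambda>x. H (1, x)) c + cmap p (\<lambda>x. H (0, x)) c =
      bd (Suc p) (cmap (Suc p) H (prism p c)) + cmap p H (prism (p - 1) (bd p c))"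
    unfolding bd_prism_cmap[OF c(1)] by (simp add: F2_ac)
qed

lemma relb_sd:
  assumes c: "c \<in> chS p D" "bd p c \<in> chS (p - 1) E"
  shows "sd n p c + c \<in> relb p D E"
proof -
  obtain h :: "nat \<Rightarrow> 'a chain2 \<Rightarrow> 'a chain2" where
    h: "\<And>p X c. c \<in> ch p X \<Longrightarrow> h p c \<in> ch (Suc p) X"
    "\<And>p X c. c \<in> ch p X \<Longrightarrow> sd n p c = c + bd (Suc p) (h p c) + h (p - 1) (bd p c)"
    using sd_homotopy[where n=n] by metis
  show ?thesis
  proof (rule relb_I)
    show "h p c \<in> chS (Suc p) D" by (rule h(1)[OF c(1)])
    show "(if p = 0 then 0 else h (p - 1) (bd p c)) \<in> chS p E"
      using h(1)[OF c(2)] by auto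
    have "h (p - 1) (bd p c) = 0" if "p = 0"
    proof -
      \<comment> \<open>Additivity of \<open>h\<close> is not at hand, but 0 is a chain of the empty
        space, so \<open>h\<close> sends it to a chain of the empty space, which is 0.\<close>
      have "(0::'a chain2) \<in> ch 0 (top_of_set {})" by simp
      from h(1)[OF this] show ?thesis using that ch_empty by fastforce
    qed
    then show "sd n p c + c = bd (Suc p) (h p c) + (if p = 0 then 0 else h (p - 1) (bd p c))"
      unfolding h(2)[OF c(1)] by (simp add: F2_ac)
  qed
qed

lemma chS_ends_split:
  fixes A :: "'a::topological_space set" and \<alpha> \<beta> :: "'b::t1_space"
  assumes "c \<in> chS p ({\<alpha>, \<beta>} \<times> A)" "\<alpha> \<noteq> \<beta>"
  obtains x y where "x \<in> chS p A" "y \<in> chS p A" "c = cmap p (Pair \<alpha>) x + cmap p (Pair \<beta>) y"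
proof -
  have U: "{\<alpha>, \<beta>} \<times> A = ({\<alpha>} \<times> A) \<union> ({\<beta>} \<times> A)" by auto
  have cl: "closedin (top_of_set ({\<alpha>} \<times> A \<union> {\<beta>} \<times> A)) ({\<gamma>} \<times> A)" if "\<gamma> = \<alpha> \<or> \<gamma> = \<beta>" for \<gamma> :: 'b
  proof -
    have "{\<gamma>} \<times> A = ({\<alpha>} \<times> A \<union> {\<beta>} \<times> A) \<inter> ({\<gamma>} \<times> UNIV)" using that assms(2) by auto
    moreover have "closed ({\<gamma>} \<times> (UNIV :: 'a set))" by (intro closed_Times) auto
    ultimately show ?thesis by (metis closedin_closed_Int)
  qed
  obtain c1 c2 where c: "c1 \<in> chS p ({\<alpha>} \<times> A)" "c2 \<in> chS p ({\<beta>} \<times> A)" "c = c1 + c2"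
    using ch_split_disjoint[of c p euclidean "{\<alpha>} \<times> A" "{\<beta>} \<times> A"] assms cl unfolding U by blast
  have s: "cmap p snd d \<in> chS p A \<and> d = cmap p (Pair \<gamma>) (cmap p snd d)" if "d \<in> chS p ({\<gamma>} \<times> A)" for d :: "('b \<times> 'a) chain2" and \<gamma>
  proof
    show "cmap p snd d \<in> chS p A" by (rule cmapS_in[OF that]) (auto intro: continuous_intros)
    show "d = cmap p (Pair \<gamma>) (cmap p snd d)" unfolding cmap_cmap by (rule cmapS_id[OF that, symmetric]) auto
  qed
  show ?thesis
    by (rule that[of "cmap p snd c1" "cmap p snd c2"]) (use s[OF c(1)] s[OF c(2)] c(3) in auto)
qed

lemma cmap_Pair_in: "x \<in> chS p A \<Longrightarrow> \<alpha> \<in> B \<Longrightarrow> cmap p (Pair \<alpha>) x \<in> chS p (B \<times> A)"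
  by (rule cmapS_in) (auto intro: continuous_intros)

lemma cmap_snd_Pair: "x \<in> chS p A \<Longrightarrow> cmap p snd (cmap p (Pair \<alpha>) x) = x"
  unfolding cmap_cmap by (rule cmapS_id) auto

lemma chS_ends_unique:
  fixes \<alpha> \<beta> :: "'b::topological_space"
  assumes "x \<in> chS p A" "y \<in> chS p A" "\<alpha> \<noteq> \<beta>" "cmap p (Pair \<alpha>) x + cmap p (Pair \<beta>) y = 0"
  shows "x = 0" "y = 0"
proof -
  have "cmap p (Pair \<alpha>) x \<in> chS p ({\<alpha>} \<times> A)" "cmap p (Pair \<beta>) y \<in> chS p ({\<beta>} \<times> A)"
    using assms cmap_Pair_in by blast+
  then have "cmap p (Pair \<alpha>) x = 0" "cmap p (Pair \<beta>) y = 0"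
    using ch_disjoint[of "cmap p (Pair \<alpha>) x" p euclidean "{\<alpha>} \<times> A" "cmap p (Pair \<beta>) y" "{\<beta>} \<times> A"] assms
    by (auto simp: Times_Int_Times)
  then show "x = 0" "y = 0" using cmap_snd_Pair assms cmap_0 by metis+
qed

text \<open>Subtracting the prism over the top end leaves a chain whose boundary lies in the bottom end;
  the cylinder retracts onto that end.\<close>
lemma relcycle_cylinder:
  assumes w: "w \<in> chS (Suc q) ({0..1} \<times> A)" "bd (Suc q) w \<in> chS q ({0,1} \<times> A)"
  obtains a where "a \<in> chS q A" "bd q a = 0" "w + prism q a \<in> relb (Suc q) ({0..1} \<times> A) ({0,1} \<times> A)"
proof -
  obtain b a where ba: "b \<in> chS q A" "a \<in> chS q A" "bd (Suc q) w = cmap q (Pair 0) b + cmap q (Pair 1) a"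
    using chS_ends_split[OF w(2)] by auto
  have "cmap (q - 1) (Pair (0::real)) (bd q b) + cmap (q - 1) (Pair 1) (bd q a) = 0"
    using bd_bd_Suc[OF w(1)] unfolding ba(3) bd_add bd_cmap[OF ba(1)] bd_cmap[OF ba(2)] .
  then have z: "bd q a = 0"
    by (rule chS_ends_unique(2)[OF bd_in[OF ba(1)] bd_in[OF ba(2)], rotated]) simp
  let ?w = "w + prism q a"
  have wc: "?w \<in> chS (Suc q) ({0..1} \<times> A)" using w prismS_in[OF ba(2)] by auto
  have "bd (Suc q) ?w = cmap q (Pair 0) (b + a)"
    unfolding bd_add bd_prism[OF ba(2)] z ba(3) by (simp add: cmap_add F2_ac)
  then have bw: "bd (Suc q) ?w \<in> chS (Suc q - 1) ({0} \<times> A)"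
    using cmap_Pair_in[of "b + a" q A 0 "{0}"] ba by auto
  let ?H = "\<lambda>(s::real, (t::real, x::'a)). (s * t, x)"
  have "cmap (Suc q) (\<lambda>x. ?H (1, x)) ?w + cmap (Suc q) (\<lambda>x. ?H (0, x)) ?w \<in> relb (Suc q) ({0..1} \<times> A) ({0,1} \<times> A)"
    by (rule relb_homotopy[OF wc bw])
      (auto simp: case_prod_unfold mult_le_one intro!: continuous_intros)
  moreover have "cmap (Suc q) (\<lambda>x. ?H (1, x)) ?w = ?w"
    by (rule cmapS_id[OF wc]) auto
  moreover have "cmap (Suc q) (\<lambda>x. ?H (0, x)) ?w \<in> chS (Suc q) ({0,1} \<times> A)"
    by (rule cmapS_in[OF wc]) (auto simp: case_prod_unfold intro!: continuous_intros)
  ultimately have "?w \<in> relb (Suc q) ({0..1} \<times> A) ({0,1} \<times> A)"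
    using relb_add[OF _ relb_sub] by (metis (no_types, lifting) F2_self_left add.commute)
  then show ?thesis using that ba z by blast
qed

text \<open>The boundary of the prism is a copy of \<open>a\<close> at each end, and it equals the
  boundary of \<open>s\<close>, a chain on the two ends. Comparing the components at the top end
  exhibits \<open>a\<close> as a boundary.\<close>

lemma relbound_cylinder:
  assumes a: "a \<in> chS q A" "bd q a = 0" and "prism q a \<in> relb (Suc q) ({0..1} \<times> A) ({0,1} \<times> A)"
  obtains e where "e \<in> chS (Suc q) A" "a = bd (Suc q) e"
proof -
  obtain d s where ds: "d \<in> chS (Suc (Suc q)) ({0..1} \<times> A)" "s \<in> chS (Suc q) ({0,1} \<times> A)" "prism q a = bd (Suc (Suc q)) d + s"
    using assms(3) by (rule relb_E)
  obtain x y where xy: "x \<in> chS (Suc q) A" "y \<in> chS (Suc q) A" "s = cmap (Suc q) (Pair 0) x + cmap (Suc q) (Pair 1) y"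
    using chS_ends_split[OF ds(2)] by auto
  have "bd (Suc q) (prism q a) = bd (Suc q) s"
    unfolding ds(3) bd_add bd_bd_Suc[OF ds(1)] by simp
  then have "cmap q (Pair (1::real)) a + cmap q (Pair 0) a = cmap q (Pair 0) (bd (Suc q) x) + cmap q (Pair 1) (bd (Suc q) y)"
    unfolding bd_prism[OF a(1)] a(2) xy(3) bd_add bd_cmap_Suc[OF xy(1)] bd_cmap_Suc[OF xy(2)] by simp
  then have "cmap q (Pair (0::real)) (a + bd (Suc q) x) + cmap q (Pair 1) (a + bd (Suc q) y) = 0"
    unfolding cmap_add by (subst (asm) F2_eq_iff) (simp add: F2_ac)
  then have "a + bd (Suc q) y = 0"
    using chS_ends_unique(2)[of "a + bd (Suc q) x" q A "a + bd (Suc q) y" "0::real" 1] a bd_in_Suc xy by auto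
  then show ?thesis using that[OF xy(2)] F2_eq_iff by blast
qed

text \<open>Here \<open>D\<close> is \<open>[0,1] \<times> A\<close> with its ends glued onto \<open>E\<close>; \<open>G\<close> stretches the collar \<open>N\<close> of \<open>E\<close> into \<open>E\<close>,
  and \<open>k\<close> recovers the cylinder coordinates of the stretched complement \<open>M\<close> of \<open>E\<close>.\<close>
locale glued_cylinder =
  fixes A :: "'a::topological_space set" and D E M N :: "'d::topological_space set"
    and h :: "real \<times> 'a \<Rightarrow> 'd" and G :: "real \<times> 'd \<Rightarrow> 'd" and k :: "'d \<Rightarrow> real \<times> 'a" and \<rho> :: "real \<Rightarrow> real"
  assumes h: "continuous_on ({0..1} \<times> A) h" "h ` ({0..1} \<times> A) \<subseteq> D" "h ` ({0,1} \<times> A) \<subseteq> E"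
    and MN: "openin (top_of_set D) M" "openin (top_of_set D) N" "D \<subseteq> M \<union> N" "E \<subseteq> N"
    and G: "continuous_on ({0..1} \<times> D) G" "G ` ({0..1} \<times> D) \<subseteq> D" "\<And>x. x \<in> D \<Longrightarrow> G (0, x) = x"
      "G ` ({0..1} \<times> E) \<subseteq> E" "\<And>x. x \<in> N \<Longrightarrow> G (1, x) \<in> E"
    and k: "continuous_on M k" "k ` M \<subseteq> {0..1} \<times> A" "\<And>x. x \<in> M \<Longrightarrow> h (k x) = G (1, x)" "k ` (M \<inter> N) \<subseteq> {0,1} \<times> A"
    and \<rho>: "continuous_on {0..1} \<rho>" "\<rho> ` {0..1} \<subseteq> {0..1}" "\<rho> 0 = 0" "\<rho> 1 = 1"
      "\<And>t a. t \<in> {0..1} \<Longrightarrow> a \<in> A \<Longrightarrow> h (t, a) \<in> M \<Longrightarrow> k (h (t, a)) = (\<rho> t, a)"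
      "\<And>t a. t \<in> {0..1} \<Longrightarrow> a \<in> A \<Longrightarrow> h (t, a) \<in> N \<Longrightarrow> \<rho> t \<in> {0,1}"
begin

lemma subs: "M \<subseteq> D" "N \<subseteq> D" "E \<subseteq> D"
  using MN openin_imp_subset by blast+

lemma ends_h_relb: "w \<in> relb p ({0..1} \<times> A) ({0,1} \<times> A) \<Longrightarrow> cmap p h w \<in> relb p D E"
  by (rule relb_cmap[OF _ h]) auto

lemma G1_relb:
  assumes "z \<in> chS p D" "bd p z \<in> chS (p - 1) E"
  shows "z + cmap p (\<lambda>x. G (1, x)) z \<in> relb p D E"
proof -
  have "cmap p (\<lambda>x. G (1, x)) z + cmap p (\<lambda>x. G (0, x)) z \<in> relb p D E"
    by (rule relb_homotopy[OF assms G(1,2,4) subs(3)])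
  moreover have "cmap p (\<lambda>x. G (0, x)) z = z" by (rule cmapS_id[OF assms(1)]) (rule G(3))
  ultimately show ?thesis by (simp add: add.commute)
qed

lemma cont_G1: "continuous_on D (\<lambda>x. G (1, x))"
  by (rule continuous_on_compose2[OF G(1), of _ "Pair 1"]) (auto intro: continuous_intros)

text \<open>Surjectivity of the prism map from homology of \<open>A\<close> to relative homology of
  \<open>D\<close> modulo \<open>E\<close>. After subdivision and stretching, the part in the collar
  \<open>N\<close> falls into \<open>E\<close>, while the part in \<open>M\<close> factors through
  the cylinder by \<open>k\<close>, where \<open>relcycle_cylinder\<close> applies.\<close>

lemma relcycle_prism:
  assumes z: "z \<in> chS (Suc q) D" "bd (Suc q) z \<in> chS q E"
  obtains a where "a \<in> chS q A" "bd q a = 0" "z + cmap (Suc q) h (prism q a) \<in> relb (Suc q) D E"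
proof -
  let ?p = "Suc q" and ?G = "\<lambda>x. G (1, x)"
  obtain n c1 c2 where c: "c1 \<in> chS ?p M" "c2 \<in> chS ?p N" "sd n ?p z = c1 + c2"
    using sdS_split[OF MN(1-3) z(1)] by (metis order_refl)
  let ?z = "sd n ?p z"
  have bz: "bd ?p ?z \<in> chS q E" using bd_sd[OF z(1), of n] sd_in[OF z(2), of n] by simp
  have zc: "?z \<in> chS ?p D" by (rule sd_in[OF z(1)])
  have z1: "z + ?z \<in> relb ?p D E" using relb_sd[of z ?p D E n] z by (simp add: add.commute)
  have z2: "?z + cmap ?p ?G ?z \<in> relb ?p D E" using G1_relb[OF zc] bz by simp
  let ?w = "cmap ?p k c1"
  have wc: "?w \<in> chS ?p ({0..1} \<times> A)" by (rule cmapS_in[OF c(1) k(1)]) (use k(2) in auto)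
  have hw: "cmap ?p h ?w = cmap ?p ?G c1"
    unfolding cmap_cmap by (rule cmapS_eq[OF c(1)]) (simp add: k(3))
  have "cmap ?p ?G c2 \<in> chS ?p E"
    by (rule cmapS_in[OF c(2)]) (use continuous_on_subset[OF cont_G1 subs(2)] G(5) in auto)
  then have z3: "cmap ?p ?G ?z + cmap ?p h ?w \<in> relb ?p D E"
    unfolding c(3) cmap_add hw by (simp add: F2_ac relb_sub)
  \<comment> \<open>The boundary of the whole chain lies in \<open>E\<close>, hence in
    \<open>N\<close>, and that of \<open>c2\<close> lies in \<open>N\<close>; so the boundary of
    \<open>c1\<close> lies in \<open>M \<inter> N\<close>, which \<open>k\<close> sends to the ends
    of the cylinder.\<close>
  have "bd ?p c1 = bd ?p ?z + bd ?p c2" unfolding c(3) bd_add by (simp add: F2_ac)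
  moreover have "bd ?p c2 \<in> chS q N" by (rule bd_in_Suc[OF c(2)])
  ultimately have "bd ?p c1 \<in> chS q N" using chS_mono[OF bz MN(4)] by auto
  then have bc1: "bd ?p c1 \<in> chS q (M \<inter> N)" using chS_Int bd_in_Suc[OF c(1)] by blast
  have "bd ?p ?w \<in> chS q ({0,1} \<times> A)"
    unfolding bd_cmap_Suc[OF c(1)]
    by (rule cmapS_in[OF bc1]) (use continuous_on_subset[OF k(1)] k(4) in auto)
  then obtain a where a: "a \<in> chS q A" "bd q a = 0" "?w + prism q a \<in> relb ?p ({0..1} \<times> A) ({0,1} \<times> A)"
    using relcycle_cylinder[OF wc] by blast
  have "cmap ?p h ?w + cmap ?p h (prism q a) \<in> relb ?p D E"
    using ends_h_relb[OF a(3)] by (simp add: cmap_add)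
  then have "z + cmap ?p h (prism q a) \<in> relb ?p D E"
    using relb_trans z1 z2 z3 by blast
  then show ?thesis using that a by blast
qed

text \<open>Injectivity of the same map. The relative null-homology \<open>d\<close> is carried back
  to the cylinder by \<open>k\<close> where \<open>k\<close> is defined. There \<open>k\<close>
  after \<open>h\<close> is not the identity but the reparametrisation \<rho> of the interval, which
  is homotopic to the identity relative to the ends.\<close>

lemma prism_relbound:
  assumes a: "a \<in> chS q A" "bd q a = 0" and "cmap (Suc q) h (prism q a) \<in> relb (Suc q) D E"
  obtains e where "e \<in> chS (Suc q) A" "a = bd (Suc q) e"
proof -
  let ?p = "Suc q" and ?C = "{0..1} \<times> A" and ?B = "{0,1} \<times> A"
  obtain d s where ds: "d \<in> chS (Suc ?p) D" "s \<in> chS ?p E" "cmap ?p h (prism q a) = bd (Suc ?p) d + s"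
    using assms(3) by (rule relb_E)
  let ?v = "prism q a" and ?R = "\<lambda>(t, x). (\<rho> t, x)"
  have v: "?v \<in> chS ?p ?C" by (rule prismS_in[OF a(1)])
  have bv: "bd ?p ?v \<in> chS q ?B"
    unfolding bd_prism[OF a(1)] a(2) using cmap_Pair_in[OF a(1), of 1 "{0,1}"] cmap_Pair_in[OF a(1), of 0 "{0,1}"] by auto
  define M' N' where "M' = ?C \<inter> h -` M" "N' = ?C \<inter> h -` N"
  have MN': "openin (top_of_set ?C) M'" "openin (top_of_set ?C) N'" "?C \<subseteq> M' \<union> N'"
  proof -
    have hD: "h \<in> ?C \<rightarrow> D" using h(2) by auto
    show "openin (top_of_set ?C) M'" "openin (top_of_set ?C) N'"
      unfolding M'_N'_def using continuous_openin_preimage[OF h(1) hD] MN by auto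
    show "?C \<subseteq> M' \<union> N'"
      unfolding M'_N'_def using hD MN(3) by (auto simp: Pi_iff subset_iff)
  qed
  obtain K1 where K1: "\<And>n. n \<ge> K1 \<Longrightarrow> \<exists>c1\<in>chS (Suc ?p) M. \<exists>c2\<in>chS (Suc ?p) N. sd n (Suc ?p) d = c1 + c2"
    using sdS_split[OF MN(1-3) ds(1)] by blast
  obtain K2 where K2: "\<And>n. n \<ge> K2 \<Longrightarrow> \<exists>c1\<in>chS ?p M'. \<exists>c2\<in>chS ?p N'. sd n ?p ?v = c1 + c2"
    using sdS_split[OF MN' v] by blast
  \<comment> \<open>The same exponent for both chains, so that the subdivided relation can be
    compared piece by piece.\<close>
  define n where "n = max K1 K2"
  obtain d1 d2 where d: "d1 \<in> chS (Suc ?p) M" "d2 \<in> chS (Suc ?p) N" "sd n (Suc ?p) d = d1 + d2"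
    using K1[of n] by (auto simp: n_def)
  obtain w1 w2 where w: "w1 \<in> chS ?p M'" "w2 \<in> chS ?p N'" "sd n ?p ?v = w1 + w2"
    using K2[of n] by (auto simp: n_def)
  have hsub: "continuous_on M' h" "continuous_on N' h"
    using h(1) continuous_on_subset unfolding M'_N'_def by blast+
  have hw1: "cmap ?p h w1 \<in> chS ?p M" by (rule cmapS_in[OF w(1) hsub(1)]) (auto simp: M'_N'_def)
  have hw2: "cmap ?p h w2 \<in> chS ?p N" by (rule cmapS_in[OF w(2) hsub(2)]) (auto simp: M'_N'_def)
  have "cmap ?p h w1 + cmap ?p h w2 = sd n ?p (cmap ?p h ?v)"
    unfolding sd_cmap[OF v] w(3) cmap_add ..
  also have "\<dots> = bd (Suc ?p) d1 + bd (Suc ?p) d2 + sd n ?p s"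
    using bd_sd[OF ds(1), of n] by (simp add: ds(3) sd_add d(3) bd_add)
  \<comment> \<open>The left side is a chain of \<open>M\<close>, the right side one of
    \<open>N\<close>; being equal, both lie in the intersection and \<open>k\<close> sends them to
    the ends.\<close>
  finally have eq: "cmap ?p h w1 + bd (Suc ?p) d1 = cmap ?p h w2 + bd (Suc ?p) d2 + sd n ?p s"
    unfolding add.assoc by (rule F2_swap)
  have "cmap ?p h w1 + bd (Suc ?p) d1 \<in> chS ?p M"
    using hw1 bd_in_Suc[OF d(1)] by auto
  moreover have "cmap ?p h w1 + bd (Suc ?p) d1 \<in> chS ?p N"
    unfolding eq using hw2 bd_in_Suc[OF d(2)] chS_mono[OF sd_in[OF ds(2)] MN(4)] by auto
  ultimately have "cmap ?p h w1 + bd (Suc ?p) d1 \<in> chS ?p (M \<inter> N)" by (rule chS_Int)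
  then have "cmap ?p k (cmap ?p h w1 + bd (Suc ?p) d1) \<in> chS ?p ?B"
    by (rule cmapS_in) (use continuous_on_subset[OF k(1)] k(4) in auto)
  then have 1: "cmap ?p k (cmap ?p h w1) + bd (Suc ?p) (cmap (Suc ?p) k d1) \<in> chS ?p ?B"
    by (simp add: cmap_add bd_cmap_Suc[OF d(1)])
  have "cmap ?p k (cmap ?p h w1) = cmap ?p ?R w1"
    unfolding cmap_cmap by (rule cmapS_eq[OF w(1)]) (auto simp: M'_N'_def \<rho>(5))
  moreover have "cmap (Suc ?p) k d1 \<in> chS (Suc ?p) ?C"
    by (rule cmapS_in[OF d(1) k(1)]) (use k(2) in auto)
  ultimately have Rw1: "cmap ?p ?R w1 \<in> relb ?p ?C ?B"
    using 1 by (intro relb_I[of "cmap (Suc ?p) k d1" ?p _ "cmap ?p ?R w1 + bd (Suc ?p) (cmap (Suc ?p) k d1)"]) (auto simp: F2_ac)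
  have cR: "continuous_on ?C ?R"
    unfolding case_prod_unfold by (intro continuous_intros continuous_on_compose2[OF \<rho>(1)]) auto
  have "cmap ?p ?R w2 \<in> chS ?p ?B"
  proof (rule cmapS_in[OF w(2) continuous_on_subset[OF cR]])
    show "?R x \<in> ?B" if "x \<in> N'" for x
      using that \<rho>(6)[of "fst x" "snd x"] by (cases x) (auto simp: M'_N'_def)
  qed (auto simp: M'_N'_def)
  then have R1: "cmap ?p ?R (sd n ?p ?v) \<in> relb ?p ?C ?B"
    unfolding w(3) cmap_add by (intro relb_add[OF Rw1] relb_sub)
  have "sd n ?p ?v + ?v \<in> relb ?p ?C ?B"
    using relb_sd[OF v] bv by simp
  then have "cmap ?p ?R (sd n ?p ?v + ?v) \<in> relb ?p ?C ?B"
    by (rule relb_cmap[OF _ cR]) (use \<rho> in \<open>auto simp: image_subset_iff\<close>)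
  then have "cmap ?p ?R ?v \<in> relb ?p ?C ?B"
    using relb_add[OF R1] by (fastforce simp: cmap_add)
  moreover
  \<comment> \<open>Linear interpolation between the identity and \<rho>; it fixes the ends because
    \<rho> does.\<close>
  let ?H = "\<lambda>(u::real, (t::real, x::'a)). ((1 - u) * t + u * \<rho> t, x)"
  have "cmap ?p (\<lambda>x. ?H (1, x)) ?v + cmap ?p (\<lambda>x. ?H (0, x)) ?v \<in> relb ?p ?C ?B"
  proof (rule relb_homotopy[OF v, of ?B])
    have "(1 - u) * t + u * \<rho> t \<le> 1 \<and> 0 \<le> (1 - u) * t + u * \<rho> t" if "0 \<le> u" "u \<le> 1" "0 \<le> t" "t \<le> 1" for u t
    proof -
      have "0 \<le> \<rho> t" "\<rho> t \<le> 1" using \<rho>(2) that by (auto simp: image_subset_iff)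
      then show ?thesis using that convex_bound_le[of t 1 "\<rho> t" "1 - u" u] by simp
    qed
    then show "?H ` ({0..1} \<times> ?C) \<subseteq> ?C" by auto
    show "continuous_on ({0..1} \<times> ?C) ?H"
      unfolding case_prod_unfold by (intro continuous_intros continuous_on_compose2[OF \<rho>(1)]) auto
  qed (use bv \<rho> in auto)
  moreover have "cmap ?p (\<lambda>x. ?H (1, x)) ?v = cmap ?p ?R ?v" by (rule cmapS_eq[OF v]) auto
  moreover have "cmap ?p (\<lambda>x. ?H (0, x)) ?v = ?v" by (rule cmapS_id[OF v]) auto
  ultimately have "?v \<in> relb ?p ?C ?B"
    using relb_add by (metis (no_types, lifting) F2_self_left)
  then show ?thesis using relbound_cylinder[OF a] that by blast
qed

end

section \<open>Counting homology classes\<close>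

definition F2_subspace :: "('b \<Rightarrow>\<^sub>0 bit) set \<Rightarrow> bool" where
  "F2_subspace S \<longleftrightarrow> 0 \<in> S \<and> (\<forall>x\<in>S. \<forall>y\<in>S. x + y \<in> S)"

lemma F2_subspace_0: "F2_subspace S \<Longrightarrow> 0 \<in> S"
  by (simp add: F2_subspace_def)

lemma F2_subspace_add: "F2_subspace S \<Longrightarrow> x \<in> S \<Longrightarrow> y \<in> S \<Longrightarrow> x + y \<in> S"
  by (simp add: F2_subspace_def)

text \<open>The order of Z/B for subspaces B \<subseteq> Z. Over F_2 this is 2 to the dimension, so
  counting cosets replaces bases.\<close>

definition has_index :: "('b \<Rightarrow>\<^sub>0 bit) set \<Rightarrow> ('b \<Rightarrow>\<^sub>0 bit) set \<Rightarrow> nat \<Rightarrow> bool" where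
  "has_index B Z n \<longleftrightarrow> finite ((\<lambda>z. (+) z ` B) ` Z) \<and> card ((\<lambda>z. (+) z ` B) ` Z) = n"

lemma coset_eq_iff:
  assumes "F2_subspace B" shows "(+) z ` B = (+) w ` B \<longleftrightarrow> z + w \<in> B"
proof
  assume "(+) z ` B = (+) w ` B"
  moreover have "z \<in> (+) z ` B" using F2_subspace_0[OF assms] by force
  ultimately obtain b where "b \<in> B" "z = w + b" by auto
  then show "z + w \<in> B" by (simp add: F2_ac)
next
  have *: "(+) z ` B \<subseteq> (+) w ` B" if "z + w \<in> B" for z w
  proof
    fix x assume "x \<in> (+) z ` B"
    then obtain b where b: "b \<in> B" "x = z + b" by auto
    then have "x = w + ((z + w) + b)" by (simp add: F2_ac)
    then show "x \<in> (+) w ` B" using F2_subspace_add[OF assms that b(1)] by blast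
  qed
  assume "z + w \<in> B"
  then show "(+) z ` B = (+) w ` B" using *[of z w] *[of w z] by (simp add: add.commute subset_antisym)
qed

lemma has_index_1:
  assumes "F2_subspace B" "Z \<subseteq> B" "0 \<in> Z" shows "has_index B Z 1"
proof -
  have "(+) z ` B = (+) 0 ` B" if "z \<in> Z" for z
    using coset_eq_iff[OF assms(1), of z 0] that assms by auto
  then have "(\<lambda>z. (+) z ` B) ` Z = {(+) 0 ` B}" using assms(3) by auto
  then show ?thesis by (simp add: has_index_def)
qed

lemma has_index_2:
  assumes "F2_subspace B" "p \<in> Z" "p \<notin> B" "0 \<in> Z" "\<And>z. z \<in> Z \<Longrightarrow> z \<in> B \<or> z + p \<in> B"
  shows "has_index B Z 2"
proof -
  have "(+) z ` B = (+) 0 ` B \<or> (+) z ` B = (+) p ` B" if "z \<in> Z" for z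
    unfolding coset_eq_iff[OF assms(1)] using assms(5)[OF that] by simp
  then have "(\<lambda>z. (+) z ` B) ` Z = {(+) 0 ` B, (+) p ` B}" using assms(2,4) by blast
  moreover have "(+) 0 ` B \<noteq> (+) p ` B" using coset_eq_iff[OF assms(1), of 0 p] assms(3) by simp
  ultimately show ?thesis by (simp add: has_index_def)
qed

text \<open>Short exact sequences multiply indices; \<open>g\<close> is a set-theoretic section, additive only
  modulo \<open>Z1 + B\<close>.\<close>
lemma has_index_mult:
  assumes B: "F2_subspace B" "F2_subspace B1" "F2_subspace B2" "F2_subspace Z" "F2_subspace Z1"
    and "Z1 \<subseteq> Z"
    and n: "has_index B1 Z1 n1" "has_index B2 Z2 n2"
    and g: "\<And>a. a \<in> Z2 \<Longrightarrow> g a \<in> Z"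
    and surj: "\<And>z. z \<in> Z \<Longrightarrow> \<exists>a\<in>Z2. \<exists>s\<in>Z1. z + g a + s \<in> B"
    and inj: "\<And>a a' s. a \<in> Z2 \<Longrightarrow> a' \<in> Z2 \<Longrightarrow> s \<in> Z1 \<Longrightarrow> g a + g a' + s \<in> B \<Longrightarrow> a + a' \<in> B2"
    and cong: "\<And>a a'. a \<in> Z2 \<Longrightarrow> a' \<in> Z2 \<Longrightarrow> a + a' \<in> B2 \<Longrightarrow> \<exists>s\<in>Z1. g a + g a' + s \<in> B"
    and ker: "\<And>s. s \<in> Z1 \<Longrightarrow> s \<in> B \<longleftrightarrow> s \<in> B1"
  shows "has_index B Z (n1 * n2)"
proof -
  define c where "c = (\<lambda>z. (+) z ` B)"
  define c1 where "c1 = (\<lambda>z. (+) z ` B1)"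
  define c2 where "c2 = (\<lambda>z. (+) z ` B2)"
  have ceq: "c z = c w \<longleftrightarrow> z + w \<in> B" "c1 z = c1 w \<longleftrightarrow> z + w \<in> B1" "c2 x = c2 y \<longleftrightarrow> x + y \<in> B2" for z w x y
    by (simp_all only: c_def c1_def c2_def coset_eq_iff[OF B(1)] coset_eq_iff[OF B(2)] coset_eq_iff[OF B(3)])
  define r1 where "r1 = inv_into Z1 c1"
  define r2 where "r2 = inv_into Z2 c2"
  have r1: "r1 C \<in> Z1" "c1 (r1 C) = C" if "C \<in> c1 ` Z1" for C
    using that by (auto simp: r1_def inv_into_into f_inv_into_f)
  have r2: "r2 C \<in> Z2" "c2 (r2 C) = C" if "C \<in> c2 ` Z2" for C
    using that by (auto simp: r2_def inv_into_into f_inv_into_f)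
  define F where "F = (\<lambda>(C1, C2). c (r1 C1 + g (r2 C2)))"
  have "bij_betw F (c1 ` Z1 \<times> c2 ` Z2) (c ` Z)"
  proof (rule bij_betw_imageI)
    show "inj_on F (c1 ` Z1 \<times> c2 ` Z2)"
    proof (rule inj_onI, clarify)
      fix s a s' a' assume *: "s \<in> Z1" "a \<in> Z2" "s' \<in> Z1" "a' \<in> Z2" "F (c1 s, c2 a) = F (c1 s', c2 a')"
      let ?s = "r1 (c1 s)" and ?s' = "r1 (c1 s')" and ?a = "r2 (c2 a)" and ?a' = "r2 (c2 a')"
      have m: "?s \<in> Z1" "?s' \<in> Z1" "?a \<in> Z2" "?a' \<in> Z2" using r1(1) r2(1) * by simp_all
      have eq: "(?s + g ?a) + (?s' + g ?a') \<in> B" using *(5) by (simp only: F_def ceq prod.case)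
      then have "g ?a + g ?a' + (?s + ?s') \<in> B" by (simp add: F2_ac)
      then have "?a + ?a' \<in> B2" by (rule inj[OF m(3,4) F2_subspace_add[OF B(5) m(1,2)]])
      then have "c2 ?a = c2 ?a'" by (simp only: ceq)
      then have a: "c2 a = c2 a'" using r2(2)[OF imageI[OF *(2)]] r2(2)[OF imageI[OF *(4)]] by simp
      then have "?s + ?s' \<in> B" using eq by (simp add: F2_ac)
      then have "?s + ?s' \<in> B1" using ker[OF F2_subspace_add[OF B(5) m(1,2)]] by simp
      then have "c1 ?s = c1 ?s'" by (simp only: ceq)
      then have "c1 s = c1 s'" using r1(2)[OF imageI[OF *(1)]] r1(2)[OF imageI[OF *(3)]] by simp
      with a show "c1 s = c1 s' \<and> c2 a = c2 a'" by simp
    qed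
    show "F ` (c1 ` Z1 \<times> c2 ` Z2) = c ` Z"
    proof
      show "F ` (c1 ` Z1 \<times> c2 ` Z2) \<subseteq> c ` Z"
      proof clarify
        fix s a assume "s \<in> Z1" "a \<in> Z2"
        then have "r1 (c1 s) \<in> Z" "g (r2 (c2 a)) \<in> Z" using r1(1) r2(1) g assms(6) by auto
        then show "F (c1 s, c2 a) \<in> c ` Z" using F2_subspace_add[OF B(4)] by (simp add: F_def)
      qed
      show "c ` Z \<subseteq> F ` (c1 ` Z1 \<times> c2 ` Z2)"
      proof clarify
        fix z assume "z \<in> Z"
        from surj[OF this] obtain a s where as: "a \<in> Z2" "s \<in> Z1" "z + g a + s \<in> B" by blast
        let ?a = "r2 (c2 a)"
        have a: "?a \<in> Z2" "c2 ?a = c2 a" using r2[OF imageI[OF as(1)]] by simp_all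
        have "a + ?a \<in> B2" using a(2)[symmetric] by (simp only: ceq)
        from cong[OF as(1) a(1) this] obtain s' where s': "s' \<in> Z1" "g a + g ?a + s' \<in> B" by blast
        let ?s = "r1 (c1 (s + s'))"
        have ss: "s + s' \<in> Z1" by (rule F2_subspace_add[OF B(5) as(2) s'(1)])
        have s: "?s \<in> Z1" "c1 ?s = c1 (s + s')" using r1[OF imageI[OF ss]] by simp_all
        have "?s + (s + s') \<in> B1" using s(2) by (simp only: ceq)
        then have 3: "?s + (s + s') \<in> B" using ker[OF F2_subspace_add[OF B(5) s(1) ss]] by simp
        \<comment> \<open>In this sum \<open>g a\<close>, \<open>s\<close> and \<open>s'\<close>
          occur twice and cancel, leaving \<open>z\<close> and the chosen representatives.\<close>
        have "(z + g a + s) + ((g a + g ?a + s') + (?s + (s + s'))) \<in> B"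
          by (rule F2_subspace_add[OF B(1) as(3) F2_subspace_add[OF B(1) s'(2) 3]])
        then have "z + (?s + g ?a) \<in> B" by (simp add: F2_ac)
        then have "c z = F (c1 (s + s'), c2 a)" by (simp only: F_def ceq prod.case)
        then show "c z \<in> F ` (c1 ` Z1 \<times> c2 ` Z2)" using ss as(1) by blast
      qed
    qed
  qed
  moreover have "finite (c1 ` Z1 \<times> c2 ` Z2)" "card (c1 ` Z1 \<times> c2 ` Z2) = n1 * n2"
    using n by (auto simp: has_index_def c1_def c2_def card_cartesian_product)
  ultimately have "finite (c ` Z)" "card (c ` Z) = n1 * n2"
    using bij_betw_finite bij_betw_same_card by metis+
  then show ?thesis by (simp add: has_index_def c_def)
qed

text \<open>The case of \<open>has_index_mult\<close> with trivial subspace: \<open>f\<close>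
  induces a bijection of cosets.\<close>

lemma has_index_transport:
  fixes B Z :: "('b \<Rightarrow>\<^sub>0 bit) set" and B' Z' :: "('c \<Rightarrow>\<^sub>0 bit) set"
  assumes B: "F2_subspace B" "F2_subspace B'" "F2_subspace Z'" and n: "has_index B Z n"
    and f: "\<And>a. a \<in> Z \<Longrightarrow> f a \<in> Z'" "\<And>z. z \<in> Z' \<Longrightarrow> \<exists>a\<in>Z. z + f a \<in> B'"
    and eq: "\<And>a b. a \<in> Z \<Longrightarrow> b \<in> Z \<Longrightarrow> f a + f b \<in> B' \<longleftrightarrow> a + b \<in> B"
  shows "has_index B' Z' n"
proof -
  have "has_index B' Z' (1 * n)"
  proof (rule has_index_mult[OF B(2) _ B(1) B(3) _ _ _ n, of "{0}" "{0}"])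
    show "has_index {0} {0 :: 'c \<Rightarrow>\<^sub>0 bit} 1" by (rule has_index_1) (auto simp: F2_subspace_def)
    show "\<exists>a\<in>Z. \<exists>s\<in>{0}. z + f a + s \<in> B'" if "z \<in> Z'" for z using f(2)[OF that] by simp
    show "F2_subspace {0 :: 'c \<Rightarrow>\<^sub>0 bit}" "F2_subspace {0 :: 'c \<Rightarrow>\<^sub>0 bit}" by (auto simp: F2_subspace_def)
    show "{0} \<subseteq> Z'" using F2_subspace_0[OF B(3)] by simp
    show "a + a' \<in> B" if "a \<in> Z" "a' \<in> Z" "s \<in> {0}" "f a + f a' + s \<in> B'" for a a' s
      using eq[OF that(1,2)] that(3,4) by simp
    show "\<exists>s\<in>{0}. f a + f a' + s \<in> B'" if "a \<in> Z" "a' \<in> Z" "a + a' \<in> B" for a a'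
      using eq[OF that(1,2)] that(3) by simp
    show "s \<in> B' \<longleftrightarrow> s \<in> {0}" if "s \<in> {0}" for s using that F2_subspace_0[OF B(2)] by simp
  qed (rule f(1))
  then show ?thesis by simp
qed

section \<open>Cycles, boundaries, points and components\<close>

definition cyc :: "nat \<Rightarrow> 'a topology \<Rightarrow> 'a chain2 set" where
  "cyc p X = {c \<in> ch p X. bd p c = 0}"

definition bnd :: "nat \<Rightarrow> 'a topology \<Rightarrow> 'a chain2 set" where
  "bnd p X = bd (Suc p) ` ch (Suc p) X"

abbreviation cycS :: "nat \<Rightarrow> 'a::topological_space set \<Rightarrow> 'a chain2 set" where
  "cycS p S \<equiv> cyc p (top_of_set S)"

abbreviation bndS :: "nat \<Rightarrow> 'a::topological_space set \<Rightarrow> 'a chain2 set" where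
  "bndS p S \<equiv> bnd p (top_of_set S)"

lemma cycI: "c \<in> ch p X \<Longrightarrow> bd p c = 0 \<Longrightarrow> c \<in> cyc p X"
  by (simp add: cyc_def)

lemma cycD: "c \<in> cyc p X \<Longrightarrow> c \<in> ch p X" "c \<in> cyc p X \<Longrightarrow> bd p c = 0"
  by (simp_all add: cyc_def)

lemma bndI: "d \<in> ch (Suc p) X \<Longrightarrow> bd (Suc p) d \<in> bnd p X"
  by (simp add: bnd_def)

lemma F2_subspace_cyc: "F2_subspace (cyc p X)"
  by (auto simp: F2_subspace_def cyc_def bd_add)

lemma F2_subspace_bnd: "F2_subspace (bnd p X)"
  unfolding F2_subspace_def
proof (intro conjI ballI)
  show "0 \<in> bnd p X" using bndI[of 0 p X] by simp
  fix x y assume "x \<in> bnd p X" "y \<in> bnd p X"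
  then show "x + y \<in> bnd p X" unfolding bnd_def by (auto simp flip: bd_add intro!: imageI)
qed

lemmas cyc_0 = F2_subspace_0[OF F2_subspace_cyc]
lemmas bnd_0 = F2_subspace_0[OF F2_subspace_bnd]
lemmas cyc_add = F2_subspace_add[OF F2_subspace_cyc]
lemmas bnd_add = F2_subspace_add[OF F2_subspace_bnd]

lemma cycS_mono: "c \<in> cycS p S \<Longrightarrow> S \<subseteq> T \<Longrightarrow> c \<in> cycS p T"
  using chS_mono by (auto simp: cyc_def)

lemma bndS_mono: "c \<in> bndS p S \<Longrightarrow> S \<subseteq> T \<Longrightarrow> c \<in> bndS p T"
  using chS_mono by (fastforce simp: bnd_def)

lemma cyc_cmap: "c \<in> cyc p X \<Longrightarrow> continuous_map X Y f \<Longrightarrow> cmap p f c \<in> cyc p Y"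
  by (auto simp: cyc_def bd_cmap cmap_in)

lemma bnd_cmap: "c \<in> bnd p X \<Longrightarrow> continuous_map X Y f \<Longrightarrow> cmap p f c \<in> bnd p Y"
  unfolding bnd_def by (auto simp flip: bd_cmap_Suc intro!: imageI cmap_in)

lemma continuous_map_S: "continuous_on S f \<Longrightarrow> (\<And>x. x \<in> S \<Longrightarrow> f x \<in> T) \<Longrightarrow> continuous_map (top_of_set S) (top_of_set T) f"
  by (auto simp: continuous_map_subtopology_eu)

lemma cycS_cmap: "c \<in> cycS p S \<Longrightarrow> continuous_on S f \<Longrightarrow> (\<And>x. x \<in> S \<Longrightarrow> f x \<in> T) \<Longrightarrow> cmap p f c \<in> cycS p T"
  by (rule cyc_cmap[OF _ continuous_map_S])

lemma bndS_cmap: "c \<in> bndS p S \<Longrightarrow> continuous_on S f \<Longrightarrow> (\<And>x. x \<in> S \<Longrightarrow> f x \<in> T) \<Longrightarrow> cmap p f c \<in> bndS p T"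
  by (rule bnd_cmap[OF _ continuous_map_S])

text \<open>In odd degree every integral chain of a point bounds. In positive even degree the
  boundary of k times the simplex is k times the lower simplex, so a cycle modulo 2 has even k and
  is zero modulo 2.\<close>

lemma cyc_bnd_point:
  assumes X: "topspace X = {a}" and p: "p \<ge> 1" shows "cyc p X \<subseteq> bnd p X"
proof
  fix c assume "c \<in> cyc p X"
  then have c: "c \<in> ch p X" "bd p c = 0" by (simp_all add: cycD)
  obtain c' where c': "c = red c'" "singular_chain p X c'" using c(1) ch_cases by metis
  show "c \<in> bnd p X"
  proof (cases "odd p")
    case True
    then have "singular_relboundary p X {} c'" using singular_boundary_singleton[OF X] c' by blast
    then obtain d where "singular_chain (Suc p) X d" "chain_boundary (Suc p) d = c'"
      by (auto simp: singular_boundary)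
    then show ?thesis using bndI[OF ch_red] c'(1) by (metis bd_red)
  next
    case False
    obtain k where k: "c' = frag_cmul k (frag_of (restrict (\<lambda>x. a) (standard_simplex p)))"
      using singular_chain_singleton[OF X] c'(2) by blast
    have "chain_boundary p c' = frag_cmul k (frag_of (restrict (\<lambda>x. a) (standard_simplex (p - 1))))"
      using chain_boundary_of_singleton[OF X c'(2)] p False by (simp add: k frag_extend_cmul)
    moreover have "red (chain_boundary p c') = 0" using c(2) unfolding c'(1) bd_red .
    ultimately have "coeff (red (frag_cmul k (frag_of (restrict (\<lambda>x. a) (standard_simplex (p - 1)))))) (restrict (\<lambda>x. a) (standard_simplex (p - 1))) = 0"
      by simp
    then have "even k" unfolding lookup_red by (simp add: of_int_bit_eq_0 del: bit_not_zero_iff)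
    then have "c = 0" unfolding c'(1) k
      by (intro poly_mapping_eqI) (auto simp: lookup_red of_int_bit_eq_0 simp del: bit_not_zero_iff)
    then show ?thesis using bnd_0 by simp
  qed
qed

text \<open>The augmentation, encoded as the chain map induced by the map to a point. Its values are
  0 and \<open>pt 0\<close>, and its naturality is plain functoriality.\<close>

definition aug :: "'a chain2 \<Rightarrow> real chain2" where
  "aug c = cmap 0 (\<lambda>_. 0) c"

lemma aug_add: "aug (c + d) = aug c + aug d"
  by (simp add: aug_def cmap_add)

lemma aug_0 [simp]: "aug 0 = 0"
  by (simp add: aug_def)

lemma aug_cmap: "aug (cmap 0 f c) = aug c"
  by (simp add: aug_def cmap_cmap o_def)

abbreviation pt_simplex :: "'a \<Rightarrow> (nat \<Rightarrow> real) \<Rightarrow> 'a" where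
  "pt_simplex a \<equiv> restrict (\<lambda>_. a) (standard_simplex 0)"

definition pt :: "'a \<Rightarrow> 'a chain2" where
  "pt a = red (frag_of (pt_simplex a))"

lemma pt_in: "a \<in> topspace X \<Longrightarrow> pt a \<in> ch 0 X"
  unfolding pt_def by (rule ch_red) (auto simp: singular_chain_of singular_simplex_def intro!: continuous_map_eq[OF continuous_map_const[THEN iffD2]])

lemma ptS_in: "a \<in> S \<Longrightarrow> pt a \<in> chS 0 S"
  by (rule pt_in) simp

lemma cmap_pt: "cmap 0 f (pt a) = pt (f a)"
  by (auto simp: pt_def cmap_red simplex_map_def fun_eq_iff restrict_def intro!: arg_cong[of _ _ red] arg_cong[of _ _ frag_of])

lemma pt_nonzero: "pt a \<noteq> 0"
proof
  assume "pt a = 0"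
  then have "coeff (pt a) (pt_simplex a) = 0" by simp
  then show False by (simp add: pt_def lookup_red)
qed

lemma aug_pt: "aug (pt a) = pt 0"
  by (simp add: aug_def cmap_pt)

text \<open>The image of a 1-chain in a one-point space has zero boundary.\<close>

lemma aug_bnd: assumes "c \<in> bnd 0 X" shows "aug c = 0"
proof -
  obtain d where d: "d \<in> ch (Suc 0) X" "c = bd (Suc 0) d" using assms by (auto simp: bnd_def)
  have "cmap (Suc 0) (\<lambda>_. 0::real) d \<in> ch (Suc 0) (top_of_set {0})"
    by (rule cmap_in[OF d(1)]) auto
  then obtain e where e: "cmap (Suc 0) (\<lambda>_. 0::real) d = red e" "singular_chain (Suc 0) (top_of_set {0}) e"
    using ch_cases by metis
  have "chain_boundary (Suc 0) e = 0"
    using chain_boundary_of_singleton[of "top_of_set {0}" "0::real" "Suc 0" e] e(2) by simp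
  then show ?thesis
    unfolding aug_def d(2) bd_cmap_Suc[OF d(1), symmetric] e(1) bd_red by simp
qed

lemma path_connected_bnd_0:
  assumes S: "path_connected S" "x0 \<in> S" and c: "c \<in> chS 0 S"
  shows "c + cmap 0 (\<lambda>_. x0) c \<in> bndS 0 S"
proof -
  obtain c' where c': "c = red c'" "singular_chain 0 (top_of_set S) c'" using c ch_cases by metis
  from c'(2) have "red c' + cmap 0 (\<lambda>_. x0) (red c') \<in> bndS 0 S"
    unfolding singular_chain_def
  proof (induction rule: frag_induction)
    case (one \<sigma>)
    define x where "x = \<sigma> (\<lambda>j. if j = 0 then 1 else 0)"
    have "x \<in> S" using one by (auto simp: x_def singular_simplex_def continuous_map_def Pi_iff standard_simplex_0)
    have \<sigma>: "red (frag_of \<sigma>) = pt x"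
      unfolding pt_def
    proof (rule arg_cong[of _ _ red], rule arg_cong[of _ _ frag_of], rule ext)
      show "\<sigma> y = pt_simplex x y" for y
        using one by (cases "y \<in> standard_simplex 0") (auto simp: x_def singular_simplex_def standard_simplex_0 extensional_def)
    qed
    obtain p where p: "path p" "path_image p \<subseteq> S" "pathstart p = x0" "pathfinish p = x"
      using S \<open>x \<in> S\<close> unfolding path_connected_def by metis
    \<comment> \<open>The path is read as a homotopy of maps from a one-point space; the prism over
      that point then connects \<open>x0\<close> to \<open>x\<close>.\<close>
    let ?H = "\<lambda>(t::real, u::real). p t" and ?u = "pt 0 :: real chain2"
    have u: "?u \<in> chS 0 {0}" by (rule ptS_in) simp
    have "bd (Suc 0) (cmap (Suc 0) ?H (prism 0 ?u)) = cmap 0 (\<lambda>_. p 1) ?u + cmap 0 (\<lambda>_. p 0) ?u"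
      using bd_prism_cmap[OF u, of ?H] by simp
    also have "\<dots> = pt x + pt x0" using p by (simp add: cmap_pt pathstart_def pathfinish_def)
    finally have "pt x + pt x0 = bd (Suc 0) (cmap (Suc 0) ?H (prism 0 ?u))" ..
    moreover have "cmap (Suc 0) ?H (prism 0 ?u) \<in> chS (Suc 0) S"
    proof (rule cmapS_in[OF prismS_in[OF u]])
      show "continuous_on ({0..1} \<times> {0}) ?H"
        unfolding case_prod_unfold by (rule continuous_on_compose2[OF p(1)[unfolded path_def]]) (auto intro: continuous_intros)
    qed (use p(2) in \<open>auto simp: path_image_def\<close>)
    ultimately have "pt x + pt x0 \<in> bndS 0 S" using bndI by metis
    then show ?case by (simp add: \<sigma> cmap_pt)
  next
    case (diff a b)
    then have "(red a + cmap 0 (\<lambda>_. x0) (red a)) + (red b + cmap 0 (\<lambda>_. x0) (red b)) \<in> bndS 0 S"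
      by (rule bnd_add)
    then show ?case by (simp add: red_diff cmap_add F2_ac)
  qed (simp add: bnd_0)
  then show ?thesis by (simp add: c'(1))
qed

lemma aug_cases: "aug c = 0 \<or> aug c = pt 0"
proof -
  have "simplex_map 0 (\<lambda>_. 0) \<sigma> = pt_simplex 0" for \<sigma> :: "(nat \<Rightarrow> real) \<Rightarrow> 'a"
    by (simp add: simplex_map_def o_def)
  then have "keys (chain_map 0 (\<lambda>_. 0) (lift2 c)) \<subseteq> {pt_simplex (0::real)}"
    unfolding chain_map_def by (intro order.trans[OF keys_frag_extend]) auto
  then have k: "keys (aug c) \<subseteq> {pt_simplex 0}"
    unfolding aug_def cmap_def ext2_def by (rule order.trans[OF keys_red_subset])
  let ?l = "coeff (aug c) (pt_simplex 0)"
  have l: "coeff (aug c) s = (if s = pt_simplex 0 then ?l else 0)" for s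
    using k by (auto simp: in_keys_iff subset_iff)
  have p: "coeff (pt 0) s = (if s = pt_simplex 0 then 1 else 0)" for s :: "(nat \<Rightarrow> real) \<Rightarrow> real"
    by (auto simp: pt_def lookup_red Poly_Mapping.lookup_single when_def)
  show ?thesis
  proof (cases "?l = 0")
    case True
    have "aug c = 0"
    proof (rule poly_mapping_eqI)
      show "coeff (aug c) s = coeff 0 s" for s
        by (subst l) (simp only: True lookup_zero if_cancel)
    qed
    then show ?thesis ..
  next
    case False
    then have "?l = 1" by simp
    have "aug c = pt 0"
    proof (rule poly_mapping_eqI)
      show "coeff (aug c) s = coeff (pt 0) s" for s
        by (subst l, subst p) (simp only: \<open>?l = 1\<close>)
    qed
    then show ?thesis ..
  qed
qed

lemma aug_0_bnd:
  assumes S: "path_connected S" "c \<in> chS 0 S" "aug c = 0"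
  shows "c \<in> bndS 0 S"
proof (cases "S = {}")
  case True
  then show ?thesis using S(2) ch_empty[of c 0 euclidean] bnd_0 by simp
next
  case False
  then obtain x0 where x0: "x0 \<in> S" by blast
  have "cmap 0 (\<lambda>_. x0) c = cmap 0 (\<lambda>_. x0) (aug c)" by (simp add: aug_def cmap_cmap o_def)
  then show ?thesis using path_connected_bnd_0[OF S(1) x0 S(2)] unfolding S(3) by simp
qed

lemma path_connected_index_0:
  assumes S: "path_connected S" "x0 \<in> S"
  shows "has_index (bndS 0 S) (cycS 0 S) 2"
proof (rule has_index_2[OF F2_subspace_bnd, of "pt x0"])
  show "pt x0 \<in> cycS 0 S" using ptS_in[OF S(2)] by (simp add: cyc_def)
  show "pt x0 \<notin> bndS 0 S" using aug_bnd[of "pt x0"] pt_nonzero[of "0::real"] by (auto simp: aug_pt)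
  show "z \<in> bndS 0 S \<or> z + pt x0 \<in> bndS 0 S" if "z \<in> cycS 0 S" for z
  proof -
    have z: "z \<in> chS 0 S" using that cycD by blast
    then have "z + pt x0 \<in> chS 0 S" using ptS_in[OF S(2)] by auto
    moreover have "aug (z + pt x0) = 0" if "aug z = pt 0" using that by (simp add: aug_add aug_pt)
    ultimately show ?thesis
      using aug_0_bnd[OF S(1) z] aug_0_bnd[OF S(1), of "z + pt x0"] aug_cases[of z] by argo
  qed
qed (simp add: cyc_0)

section \<open>Tori and their quotients by conjugation\<close>

text \<open>Coordinates beyond \<open>m\<close> are fixed to \<open>1\<close>, so that the tori are nested in one function space.\<close>
definition torus :: "nat \<Rightarrow> (nat \<Rightarrow> complex) set" where
  "torus m = {x. (\<forall>k. cmod (x k) = 1) \<and> (\<forall>k\<ge>m. x k = 1)}"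

text \<open>The entries of \<open>invs x\<close> generate the invariants of simultaneous conjugation, so its image is a
  concrete model of the quotient.\<close>
definition invs :: "(nat \<Rightarrow> complex) \<Rightarrow> (nat \<Rightarrow> real) \<times> (nat \<Rightarrow> nat \<Rightarrow> real)" where
  "invs x = (\<lambda>j. Re (x j), \<lambda>j k. Im (x j) * Im (x k))"

definition conjs :: "(nat \<Rightarrow> complex) \<Rightarrow> nat \<Rightarrow> complex" where
  "conjs x = (\<lambda>k. cnj (x k))"

definition qtorus :: "nat \<Rightarrow> ((nat \<Rightarrow> real) \<times> (nat \<Rightarrow> nat \<Rightarrow> real)) set" where
  "qtorus m = invs ` torus m"

lemma cont_fun: "(\<And>i. continuous_on S (\<lambda>x. f x i)) \<Longrightarrow> continuous_on S f"
  by (rule continuous_on_coordinatewise_then_product)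

lemma cont_app: "continuous_on S f \<Longrightarrow> continuous_on S (\<lambda>x. f x i)"
  by (rule continuous_on_product_then_coordinatewise)

lemma cont_upd: "continuous_on S f \<Longrightarrow> continuous_on S g \<Longrightarrow> continuous_on S (\<lambda>x. (f x)(m := g x))"
proof (rule cont_fun)
  fix i assume "continuous_on S f" "continuous_on S g"
  then show "continuous_on S (\<lambda>x. ((f x)(m := g x)) i)" by (cases "i = m") (auto intro: cont_app)
qed

lemma cont_Complex: "continuous_on S f \<Longrightarrow> continuous_on S g \<Longrightarrow> continuous_on S (\<lambda>x. Complex (f x) (g x))"
  unfolding Complex_eq by (intro continuous_intros)

lemma cont_invs: "continuous_on S f \<Longrightarrow> continuous_on S (\<lambda>x. invs (f x))"
proof -
  assume f: "continuous_on S f"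
  have "continuous_on S (\<lambda>x j. Re (f x j))" "continuous_on S (\<lambda>x j k. Im (f x j) * Im (f x k))"
    by (rule cont_fun, rule continuous_on_Re, rule cont_app[OF f])
      (rule cont_fun, rule cont_fun, rule continuous_on_mult; rule continuous_on_Im, rule cont_app[OF f])
  then show ?thesis unfolding invs_def by (rule continuous_on_Pair)
qed

lemma torus_mono: "torus m \<subseteq> torus (Suc m)"
  by (auto simp: torus_def)

lemma qtorus_mono: "qtorus m \<subseteq> qtorus (Suc m)"
  unfolding qtorus_def using torus_mono by blast

lemma torus_upd: "x \<in> torus m \<Longrightarrow> cmod z = 1 \<Longrightarrow> x(m := z) \<in> torus (Suc m)"
  by (auto simp: torus_def)

lemma torus_upd1: "x \<in> torus (Suc m) \<Longrightarrow> x(m := 1) \<in> torus m"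
  by (auto simp: torus_def Suc_le_eq)

lemma torus_upd_Suc: "x \<in> torus (Suc m) \<Longrightarrow> cmod z = 1 \<Longrightarrow> x(m := z) \<in> torus (Suc m)"
  by (auto simp: torus_def)

lemma torus_at: "x \<in> torus m \<Longrightarrow> x m = 1"
  by (auto simp: torus_def)

lemma torus_norm: "x \<in> torus m \<Longrightarrow> cmod (x k) = 1"
  by (auto simp: torus_def)

lemma torus_upd_same: "x \<in> torus m \<Longrightarrow> x(m := 1) = x"
  by (auto simp: torus_def)

lemma conjs_conjs [simp]: "conjs (conjs x) = x"
  by (simp add: conjs_def)

lemma conjs_torus: "x \<in> torus m \<Longrightarrow> conjs x \<in> torus m"
  by (auto simp: torus_def conjs_def)

lemma conjs_upd: "conjs (x(m := z)) = (conjs x)(m := cnj z)"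
  by (auto simp: conjs_def)

lemma invs_conjs [simp]: "invs (conjs x) = invs x"
  by (simp add: invs_def conjs_def)

lemma unit_Re_Im: "cmod z = 1 \<Longrightarrow> (Re z)\<^sup>2 + (Im z)\<^sup>2 = 1"
  by (simp add: cmod_def)

lemma unit_Im_0: "cmod z = 1 \<Longrightarrow> Im z = 0 \<longleftrightarrow> z = 1 \<or> z = -1"
  using unit_Re_Im[of z] by (auto simp: complex_eq_iff power2_eq_1_iff)

subsection \<open>Arcs of the circle\<close>

text \<open>The half circle from 1 to -1 on the side of sign \<epsilon>. Taking the real part linear
  in t makes \<open>arc_time\<close> an affine left inverse; the imaginary part is forced by 1 - (1
  - 2t)^2 = 4(t - t^2).\<close>

definition half_arc :: "real \<Rightarrow> real \<Rightarrow> complex" where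
  "half_arc \<epsilon> t = Complex (1 - 2 * t) (\<epsilon> * (2 * sqrt (t - t\<^sup>2)))"

definition arc_time :: "complex \<Rightarrow> real" where
  "arc_time z = (1 - Re z) / 2"

text \<open>A function of the square of the imaginary part, because only even expressions descend to
  the quotient by conjugation. At s = 0 it is 1; at s = 1 it vanishes on the collar
  \<open>y2 \<le> 1/4\<close> and grows to 3 at \<open>y2 = 1\<close>.\<close>

definition stretch_factor :: "real \<Rightarrow> real \<Rightarrow> real" where
  "stretch_factor s y2 = (1 - s) + s * max 0 (4 * y2 - 1)"

definition stretch_norm :: "real \<Rightarrow> real \<Rightarrow> real \<Rightarrow> real" where
  "stretch_norm s r y2 = sqrt (r\<^sup>2 + (stretch_factor s y2)\<^sup>2 * y2)"

text \<open>Scales the imaginary part and renormalises to length 1. At time 1 points of the circle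
  in the collar around 1 and -1 land on 1 or -1.\<close>

definition stretch :: "real \<Rightarrow> complex \<Rightarrow> complex" where
  "stretch s z = Complex (Re z / stretch_norm s (Re z) ((Im z)\<^sup>2))
     (stretch_factor s ((Im z)\<^sup>2) / stretch_norm s (Re z) ((Im z)\<^sup>2) * Im z)"

section \<open>Properties of the arcs and of the stretching\<close>

lemma t_t2: "0 \<le> t \<Longrightarrow> t \<le> 1 \<Longrightarrow> 0 \<le> t - t\<^sup>2" for t :: real
  by (simp add: power2_eq_square mult_left_le)

lemma norm_arc: assumes "\<epsilon> = 1 \<or> \<epsilon> = -1" "0 \<le> t" "t \<le> 1" shows "cmod (half_arc \<epsilon> t) = 1"
proof -
  have "\<epsilon>\<^sup>2 = 1" using assms(1) by auto
  then show ?thesis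
    using t_t2[OF assms(2,3)] by (simp add: half_arc_def cmod_def power_mult_distrib) (simp add: power2_eq_square algebra_simps)
qed

lemma arc_ends [simp]: "half_arc \<epsilon> 0 = 1" "half_arc \<epsilon> 1 = -1"
  by (simp_all add: half_arc_def complex_eq_iff)

lemma arc_time_arc [simp]: "arc_time (half_arc \<epsilon> t) = t"
  by (simp add: arc_time_def half_arc_def)

lemma cnj_arc: "cnj (half_arc \<epsilon> t) = half_arc (- \<epsilon>) t"
  by (simp add: half_arc_def complex_eq_iff)

lemma arc_arc_time:
  assumes "cmod z = 1" "\<epsilon> = 1 \<or> \<epsilon> = -1" "0 \<le> \<epsilon> * Im z" shows "half_arc \<epsilon> (arc_time z) = z"
proof -
  have "arc_time z - (arc_time z)\<^sup>2 = (Im z / 2)\<^sup>2"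
    using unit_Re_Im[OF assms(1)] by (simp add: arc_time_def power2_eq_square field_simps)
  then have "sqrt (arc_time z - (arc_time z)\<^sup>2) = \<bar>Im z\<bar> / 2" by simp
  moreover have "1 - 2 * arc_time z = Re z" by (simp add: arc_time_def field_simps)
  ultimately show ?thesis using assms(2,3) by (auto simp: half_arc_def complex_eq_iff)
qed

lemma arc_time_range: "cmod z = 1 \<Longrightarrow> arc_time z \<in> {0..1}"
  using abs_Re_le_cmod[of z] by (auto simp: arc_time_def)

lemma cont_arc: "continuous_on S f \<Longrightarrow> continuous_on S g \<Longrightarrow> continuous_on S (\<lambda>x. half_arc (f x) (g x))"
  unfolding half_arc_def by (intro cont_Complex continuous_intros)

lemma cont_arc_time: "continuous_on S f \<Longrightarrow> continuous_on S (\<lambda>x. arc_time (f x))"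
  unfolding arc_time_def by (intro continuous_intros) auto

lemma stretch_factor_nonneg: "0 \<le> s \<Longrightarrow> s \<le> 1 \<Longrightarrow> 0 \<le> stretch_factor s y2"
  by (simp add: stretch_factor_def)

text \<open>The length could vanish only for real part 0; but then the squared imaginary part is 1,
  well outside the collar.\<close>

lemma stretch_norm_pos:
  assumes "cmod z = 1" "0 \<le> s" "s \<le> 1" shows "0 < stretch_norm s (Re z) ((Im z)\<^sup>2)"
proof (cases "Re z = 0")
  case True
  then have "(Im z)\<^sup>2 = 1" using unit_Re_Im[OF assms(1)] by simp
  \<comment> \<open>With squared imaginary part 1 the factor is (1 - s) + 3 s = 1 + 2 s.\<close>
  moreover have "0 < 1 + 2 * s" using assms by simp
  ultimately show ?thesis using True by (simp add: stretch_norm_def stretch_factor_def)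
next
  case False
  then have "0 < (Re z)\<^sup>2 + (stretch_factor s ((Im z)\<^sup>2))\<^sup>2 * (Im z)\<^sup>2"
    by (intro add_pos_nonneg) auto
  then show ?thesis by (simp add: stretch_norm_def)
qed

lemma norm_stretch: assumes "cmod z = 1" "0 \<le> s" "s \<le> 1" shows "cmod (stretch s z) = 1"
proof -
  let ?n = "stretch_norm s (Re z) ((Im z)\<^sup>2)" and ?f = "stretch_factor s ((Im z)\<^sup>2)"
  have n: "0 < ?n" using stretch_norm_pos[OF assms] .
  have "(Re z)\<^sup>2 + ?f\<^sup>2 * (Im z)\<^sup>2 = ?n\<^sup>2" by (simp add: stretch_norm_def)
  then have "(Re z / ?n)\<^sup>2 + (?f / ?n * Im z)\<^sup>2 = 1"
    using n by (simp add: power_divide power_mult_distrib flip: add_divide_distrib)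
  then show ?thesis by (simp add: stretch_def cmod_def)
qed

lemma stretch_0: "cmod z = 1 \<Longrightarrow> stretch 0 z = z"
  using unit_Re_Im[of z] by (simp add: stretch_def stretch_factor_def stretch_norm_def)

lemma stretch_fix: assumes "Im z = 0" "cmod z = 1" shows "stretch s z = z"
proof -
  have "(Re z)\<^sup>2 = 1" using unit_Re_Im[OF assms(2)] assms(1) by simp
  then show ?thesis using assms(1) by (simp add: stretch_def stretch_norm_def complex_eq_iff)
qed

lemma stretch_1: "(Im z)\<^sup>2 < 1/4 \<Longrightarrow> Im (stretch 1 z) = 0"
  by (simp add: stretch_def stretch_factor_def)

lemma stretch_cnj: "stretch s (cnj z) = cnj (stretch s z)"
  by (simp add: stretch_def complex_eq_iff)

lemma stretch_sgn:
  assumes "cmod z = 1" "0 \<le> s" "s \<le> 1" "0 \<le> \<epsilon> * Im z" shows "0 \<le> \<epsilon> * Im (stretch s z)"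
proof -
  have "0 \<le> stretch_factor s ((Im z)\<^sup>2) / stretch_norm s (Re z) ((Im z)\<^sup>2) * (\<epsilon> * Im z)"
    using stretch_norm_pos[OF assms(1-3)] stretch_factor_nonneg[OF assms(2,3)] assms(4) by simp
  then show ?thesis by (simp add: stretch_def mult.left_commute)
qed

lemma cont_stretch_factor: "continuous_on S f \<Longrightarrow> continuous_on S g \<Longrightarrow> continuous_on S (\<lambda>x. stretch_factor (f x) (g x))"
  unfolding stretch_factor_def by (intro continuous_intros)

lemma cont_stretch_norm: "continuous_on S f \<Longrightarrow> continuous_on S r \<Longrightarrow> continuous_on S g \<Longrightarrow> continuous_on S (\<lambda>x. stretch_norm (f x) (r x) (g x))"
  unfolding stretch_norm_def by (intro continuous_intros cont_stretch_factor)

lemma cont_stretch: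
  assumes "continuous_on S f" "continuous_on S g" "\<And>x. x \<in> S \<Longrightarrow> cmod (g x) = 1 \<and> 0 \<le> f x \<and> f x \<le> 1"
  shows "continuous_on S (\<lambda>x. stretch (f x) (g x))"
proof -
  have "stretch_norm (f x) (Re (g x)) ((Im (g x))\<^sup>2) \<noteq> 0" if "x \<in> S" for x
    using stretch_norm_pos[of "g x" "f x"] assms(3)[OF that] by simp
  then show ?thesis
    unfolding stretch_def by (intro cont_Complex continuous_intros cont_stretch_norm cont_stretch_factor assms) auto
qed

text \<open>The reparametrisation of the arc caused by the full stretching, constant near both ends.
  It serves as \<rho> for the tori and for their quotients alike, since stretching commutes with
  conjugation.\<close>

definition arc_profile :: "real \<Rightarrow> real" where
  "arc_profile t = arc_time (stretch 1 (half_arc 1 t))"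

lemma cont_arc_profile: "continuous_on {0..1} arc_profile"
  unfolding arc_profile_def by (intro cont_arc_time cont_stretch cont_arc continuous_intros) (auto simp: norm_arc)

lemma arc_profile_range: "arc_profile ` {0..1} \<subseteq> {0..1}"
  unfolding arc_profile_def using arc_time_range norm_stretch norm_arc by auto

lemma arc_profile_ends: "arc_profile 0 = 0" "arc_profile 1 = 1"
  unfolding arc_profile_def by (simp_all add: stretch_fix arc_time_def)

lemma arc_profile_collar:
  assumes "t \<in> {0..1}" "(Im (half_arc 1 t))\<^sup>2 < 1/4" shows "arc_profile t \<in> {0, 1}"
proof -
  have "cmod (stretch 1 (half_arc 1 t)) = 1" using assms norm_stretch norm_arc by simp
  then have "stretch 1 (half_arc 1 t) = 1 \<or> stretch 1 (half_arc 1 t) = -1"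
    using stretch_1[OF assms(2)] unit_Im_0 by blast
  then show ?thesis by (auto simp: arc_profile_def arc_time_def)
qed

lemma arc_time_stretch_arc:
  assumes "\<epsilon> = 1 \<or> \<epsilon> = -1" shows "arc_time (stretch 1 (half_arc \<epsilon> t)) = arc_profile t"
proof -
  have "arc_time (stretch 1 (cnj (half_arc 1 t))) = arc_profile t"
    by (simp add: stretch_cnj arc_profile_def arc_time_def)
  then show ?thesis using assms by (auto simp: cnj_arc arc_profile_def)
qed

lemma Im_arc_sq: "\<epsilon> = 1 \<or> \<epsilon> = -1 \<Longrightarrow> (Im (half_arc \<epsilon> t))\<^sup>2 = (Im (half_arc 1 t))\<^sup>2"
  by (auto simp: half_arc_def power_mult_distrib)

lemma sgn_Im_arc:
  assumes "\<epsilon> = 1 \<or> \<epsilon> = -1" "0 \<le> t" "t \<le> 1" "Im (half_arc \<epsilon> t) \<noteq> 0" shows "sgn (Im (half_arc \<epsilon> t)) = \<epsilon>"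
  using assms t_t2[of t] by (auto simp: half_arc_def sgn_mult sgn_if)

text \<open>Removing 1 and -1 from the circle in coordinate \<open>m\<close> leaves two open half
  circles, so the cylinder is over two copies of \<open>torus m\<close>, labelled by the sign
  \<epsilon> of the imaginary part.\<close>

lemma glued_cylinder_torus:
  "glued_cylinder ({1, -1} \<times> torus m) (torus (Suc m)) {x \<in> torus (Suc m). Im (x m) = 0}
    {x \<in> torus (Suc m). Im (x m) \<noteq> 0} {x \<in> torus (Suc m). (Im (x m))\<^sup>2 < 1/4}
    (\<lambda>(t, (\<epsilon>, x)). x(m := half_arc \<epsilon> t)) (\<lambda>(s, x). x(m := stretch s (x m)))
    (\<lambda>x. (arc_time (stretch 1 (x m)), (sgn (Im (x m)), x(m := 1)))) arc_profile"
  (is "glued_cylinder ?A ?D ?E ?M ?N ?h ?G ?k ?\<rho>")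
proof
  have cm: "continuous_on S (\<lambda>x. Im (x m))" for S :: "(nat \<Rightarrow> complex) set"
    by (intro continuous_intros cont_app[of S "\<lambda>x. x"])
  show "continuous_on ({0..1} \<times> ?A) ?h"
    unfolding case_prod_unfold by (intro cont_upd cont_arc continuous_intros)
  show "?h ` ({0..1} \<times> ?A) \<subseteq> ?D"
    by (auto intro!: torus_upd norm_arc)
  show "?h ` ({0, 1} \<times> ?A) \<subseteq> ?E"
  proof (rule image_subsetI)
    fix p :: "real \<times> real \<times> (nat \<Rightarrow> complex)" assume p: "p \<in> {0, 1} \<times> ?A"
    obtain t \<epsilon> x where "p = (t, \<epsilon>, x)" by (cases p) auto
    with p show "?h p \<in> ?E" using torus_upd[of x m "half_arc \<epsilon> t"] by auto
  qed
  show "openin (top_of_set ?D) ?M"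
  proof -
    have "?M = ?D \<inter> (\<lambda>x. Im (x m)) -` (- {0})" by auto
    then show ?thesis using continuous_openin_preimage_gen[OF cm[of ?D], of "- {0}"] by (simp add: open_Compl)
  qed
  show "openin (top_of_set ?D) ?N"
  proof -
    have "?N = ?D \<inter> (\<lambda>x. (Im (x m))\<^sup>2) -` {..<1/4}" by auto
    then show ?thesis using continuous_openin_preimage_gen[OF continuous_on_power[OF cm[of ?D], of 2], of "{..<1/4}"] by simp
  qed
  show "?D \<subseteq> ?M \<union> ?N" "?E \<subseteq> ?N" by auto
  show "continuous_on ({0..1} \<times> ?D) ?G"
    unfolding case_prod_unfold
    by (intro cont_upd cont_stretch continuous_intros cont_app[of _ snd]) (auto simp: torus_norm)
  show "?G ` ({0..1} \<times> ?D) \<subseteq> ?D"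
    by (auto intro!: torus_upd_Suc norm_stretch simp: torus_norm)
  show "?G (0, x) = x" if "x \<in> ?D" for x using that by (simp add: stretch_0 torus_norm)
  show "?G ` ({0..1} \<times> ?E) \<subseteq> ?E" by (auto simp: stretch_fix torus_norm)
  show "?G (1, x) \<in> ?E" if "x \<in> ?N" for x
    using that by (auto intro!: torus_upd_Suc norm_stretch stretch_1 simp: torus_norm)
  show "continuous_on ?M ?k"
    by (intro cont_upd cont_stretch cont_arc_time continuous_intros cm continuous_on_id cont_app[of _ "\<lambda>x. x"]) (auto simp: torus_norm)
  show "?k ` ?M \<subseteq> {0..1} \<times> ?A"
  proof (rule image_subsetI)
    fix x assume "x \<in> ?M"
    then have x: "x \<in> ?D" "Im (x m) \<noteq> 0" by auto
    have "arc_time (stretch 1 (x m)) \<in> {0..1}"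
      by (intro arc_time_range norm_stretch torus_norm[OF x(1)]) auto
    then show "?k x \<in> {0..1} \<times> ?A" using torus_upd1[OF x(1)] x(2) by (simp add: sgn_if)
  qed
  show "?h (?k x) = ?G (1, x)" if "x \<in> ?M" for x
  proof -
    have c: "cmod (x m) = 1" using that torus_norm by blast
    have "0 \<le> sgn (Im (x m)) * Im (x m)" by (simp add: sgn_if)
    then have "half_arc (sgn (Im (x m))) (arc_time (stretch 1 (x m))) = stretch 1 (x m)"
      using that c by (intro arc_arc_time norm_stretch stretch_sgn) (auto simp: sgn_if)
    then show ?thesis by simp
  qed
  show "?k ` (?M \<inter> ?N) \<subseteq> {0, 1} \<times> ?A"
  proof -
    have "arc_time (stretch 1 z) = 0 \<or> arc_time (stretch 1 z) = 1" if "cmod z = 1" "(Im z)\<^sup>2 < 1/4" for z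
      using stretch_1[OF that(2)] unit_Im_0[OF norm_stretch[OF that(1)], of 1] by (auto simp: arc_time_def)
    then show ?thesis using torus_norm by (fastforce intro!: torus_upd1 simp: sgn_if)
  qed
  show "continuous_on {0..1} ?\<rho>" "?\<rho> ` {0..1} \<subseteq> {0..1}" "?\<rho> 0 = 0" "?\<rho> 1 = 1"
    by (fact cont_arc_profile arc_profile_range arc_profile_ends)+
  show "?k (?h (t, a)) = (?\<rho> t, a)" if "t \<in> {0..1}" "a \<in> ?A" "?h (t, a) \<in> ?M" for t a
  proof (cases a)
    case (Pair \<epsilon> x)
    then have x: "x \<in> torus m" "\<epsilon> = 1 \<or> \<epsilon> = -1" using that by auto
    then show ?thesis
      using that Pair arc_time_stretch_arc[OF x(2)] sgn_Im_arc[OF x(2)] by (auto simp: torus_upd_same)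
  qed
  show "?\<rho> t \<in> {0, 1}" if "t \<in> {0..1}" "a \<in> ?A" "?h (t, a) \<in> ?N" for t a
  proof (cases a)
    case (Pair \<epsilon> x)
    then have x: "\<epsilon> = 1 \<or> \<epsilon> = -1" using that by auto
    show ?thesis using that Pair Im_arc_sq[OF x] by (intro arc_profile_collar) auto
  qed
qed

text \<open>The stretching of coordinate \<open>m\<close> expressed in the invariants: each
  imaginary part is multiplied by its factor \<open>c\<close>, so the products are multiplied by two
  factors.\<close>

definition qstretch :: "nat \<Rightarrow> real \<times> ((nat \<Rightarrow> real) \<times> (nat \<Rightarrow> nat \<Rightarrow> real)) \<Rightarrow> (nat \<Rightarrow> real) \<times> (nat \<Rightarrow> nat \<Rightarrow> real)" where
  "qstretch m p = (let s = fst p; r = fst (snd p); S = snd (snd p); n = stretch_norm s (r m) (S m m);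
      c = (\<lambda>j. if j = m then stretch_factor s (S m m) / n else 1)
    in (r(m := r m / n), \<lambda>j k. c j * c k * S j k))"

text \<open>The inverse of \<open>invs\<close> with the sign fixed by making the imaginary part of coordinate \<open>m\<close> positive.\<close>
definition qcoords :: "nat \<Rightarrow> (nat \<Rightarrow> real) \<times> (nat \<Rightarrow> nat \<Rightarrow> real) \<Rightarrow> real \<times> (nat \<Rightarrow> complex)" where
  "qcoords m y = ((1 - fst y m / stretch_norm 1 (fst y m) (snd y m m)) / 2,
     (\<lambda>j. Complex (fst y j) (snd y j m / sqrt (snd y m m)))(m := 1))"

lemma qstretch_invs: "qstretch m (s, invs x) = invs (x(m := stretch s (x m)))"
  unfolding qstretch_def invs_def stretch_def Let_def
  by (auto simp: fun_eq_iff power2_eq_square)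

text \<open>The quotient of Im x_j Im x_m by |Im x_m| is Im x_j times the sign of Im x_m, which
  gives the representative with positive coordinate \<open>m\<close>.\<close>

lemma qcoords_invs:
  assumes "Im (x m) \<noteq> 0"
  shows "qcoords m (invs x) = (arc_time (stretch 1 (x m)), (if Im (x m) > 0 then x else conjs x)(m := 1))"
proof -
  have "Im (x j) * Im (x m) / sqrt (Im (x m) * Im (x m)) = (if Im (x m) > 0 then Im (x j) else - Im (x j))" for j
    using assms by simp
  then show ?thesis
    unfolding qcoords_def invs_def stretch_def arc_time_def
    by (auto simp: fun_eq_iff complex_eq_iff conjs_def power2_eq_square)
qed

text \<open>Off the slice where coordinate \<open>m\<close> is real, each orbit has exactly one
  representative in the upper half plane of that coordinate, so a single copy of
  \<open>torus m\<close> suffices. On the slice conjugation still acts on the other coordinates,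
  which is the collapse of the ends.\<close>

lemma glued_cylinder_qtorus:
  "glued_cylinder (torus m) (qtorus (Suc m)) {y \<in> qtorus (Suc m). snd y m m = 0}
    {y \<in> qtorus (Suc m). snd y m m \<noteq> 0} {y \<in> qtorus (Suc m). snd y m m < 1/4}
    (\<lambda>(t, x). invs (x(m := half_arc 1 t))) (qstretch m) (qcoords m) arc_profile"
  (is "glued_cylinder ?A ?D ?E ?M ?N ?h ?G ?k ?\<rho>")
proof
  have c1: "continuous_on S (\<lambda>y. fst y j)" "continuous_on S (\<lambda>y. snd y j k)"
    for S :: "((nat \<Rightarrow> real) \<times> (nat \<Rightarrow> nat \<Rightarrow> real)) set" and j k
    by (rule cont_app[OF continuous_on_fst[OF continuous_on_id]], rule cont_app[OF cont_app[OF continuous_on_snd[OF continuous_on_id]]])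
  have c2: "continuous_on S (\<lambda>y. fst (snd y) j)" "continuous_on S (\<lambda>y. snd (snd y) j k)"
    for S :: "(real \<times> (nat \<Rightarrow> real) \<times> (nat \<Rightarrow> nat \<Rightarrow> real)) set" and j k
    by (rule cont_app[OF continuous_on_fst[OF continuous_on_snd[OF continuous_on_id]]], rule cont_app[OF cont_app[OF continuous_on_snd[OF continuous_on_snd[OF continuous_on_id]]]])
  have D: "\<exists>x. y = invs x \<and> x \<in> torus (Suc m) \<and> cmod (x m) = 1" if "y \<in> ?D" for y
    using that torus_norm unfolding qtorus_def by blast
  have Smm: "snd (invs x) m m = (Im (x m))\<^sup>2" for x by (simp add: invs_def power2_eq_square)
  have inD: "invs x \<in> ?D" if "x \<in> torus (Suc m)" for x using that by (simp add: qtorus_def)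
  have st: "x(m := stretch s (x m)) \<in> torus (Suc m)" if "x \<in> torus (Suc m)" "0 \<le> s" "s \<le> 1" for x s
    using that by (intro torus_upd_Suc norm_stretch torus_norm)
  have pos: "0 < stretch_norm s (fst y m) (snd y m m)" if "y \<in> ?D" "0 \<le> s" "s \<le> 1" for y s
    using D[OF that(1)] stretch_norm_pos[OF _ that(2,3)] by (auto simp: Smm) (simp add: invs_def)
  show "continuous_on ({0..1} \<times> ?A) ?h"
    unfolding case_prod_unfold by (intro cont_invs cont_upd cont_arc continuous_intros)
  show "?h ` ({0..1} \<times> ?A) \<subseteq> ?D"
    by (auto intro!: inD torus_upd norm_arc)
  show "?h ` ({0, 1} \<times> ?A) \<subseteq> ?E"
  proof (rule image_subsetI)
    fix p :: "real \<times> (nat \<Rightarrow> complex)" assume p: "p \<in> {0, 1} \<times> ?A"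
    then show "?h p \<in> ?E" using torus_upd[of "snd p" m "half_arc 1 (fst p)"] by (auto simp: inD Smm)
  qed
  show "openin (top_of_set ?D) ?M"
  proof -
    have "?M = ?D \<inter> (\<lambda>y. snd y m m) -` (- {0})" by auto
    then show ?thesis using continuous_openin_preimage_gen[OF c1(2)[of ?D], of "- {0}"] by (simp add: open_Compl)
  qed
  show "openin (top_of_set ?D) ?N"
  proof -
    have "?N = ?D \<inter> (\<lambda>y. snd y m m) -` {..<1/4}" by auto
    then show ?thesis using continuous_openin_preimage_gen[OF c1(2)[of ?D], of "{..<1/4}"] by simp
  qed
  show "?D \<subseteq> ?M \<union> ?N" "?E \<subseteq> ?N" by auto
  show "continuous_on ({0..1} \<times> ?D) ?G"
  proof -
    let ?n = "\<lambda>p. stretch_norm (fst p) (fst (snd p) m) (snd (snd p) m m)"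
    let ?c = "\<lambda>j p. if j = m then stretch_factor (fst p) (snd (snd p) m m) / ?n p else 1"
    have nz: "\<forall>p\<in>{0..1} \<times> ?D. ?n p \<noteq> 0" using pos by fastforce
    have n: "continuous_on ({0..1} \<times> ?D) ?n"
      by (intro cont_stretch_norm c2 continuous_on_fst continuous_on_id)
    have f: "continuous_on ({0..1} \<times> ?D) (\<lambda>p. stretch_factor (fst p) (snd (snd p) m m))"
      by (intro cont_stretch_factor c2 continuous_on_fst continuous_on_id)
    have c: "continuous_on ({0..1} \<times> ?D) (?c j)" for j
      by (cases "j = m") (simp_all add: continuous_on_divide[OF f n nz])
    have 1: "continuous_on ({0..1} \<times> ?D) (\<lambda>p. (fst (snd p))(m := fst (snd p) m / ?n p))"
      by (intro cont_upd continuous_on_divide[OF c2(1) n nz] continuous_on_fst continuous_on_snd continuous_on_id)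
    have 2: "continuous_on ({0..1} \<times> ?D) (\<lambda>p j k. ?c j p * ?c k p * snd (snd p) j k)"
      by (rule cont_fun, rule cont_fun, intro continuous_on_mult c c2)
    show ?thesis unfolding qstretch_def Let_def by (rule continuous_on_Pair[OF 1 2])
  qed
  show "?G ` ({0..1} \<times> ?D) \<subseteq> ?D"
  proof (rule image_subsetI)
    fix p :: "real \<times> (nat \<Rightarrow> real) \<times> (nat \<Rightarrow> nat \<Rightarrow> real)" assume p: "p \<in> {0..1} \<times> ?D"
    then have "snd p \<in> ?D" by auto
    from D[OF this] obtain x where "snd p = invs x" "x \<in> torus (Suc m)" by blast
    then show "?G p \<in> ?D" using p qstretch_invs[of m "fst p" x] inD st[of x "fst p"] by (cases p) auto
  qed
  show "?G (0, y) = y" if "y \<in> ?D" for y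
    using D[OF that] by (auto simp: qstretch_invs stretch_0)
  show "?G ` ({0..1} \<times> ?E) \<subseteq> ?E"
  proof (rule image_subsetI)
    fix p :: "real \<times> (nat \<Rightarrow> real) \<times> (nat \<Rightarrow> nat \<Rightarrow> real)" assume p: "p \<in> {0..1} \<times> ?E"
    then have "snd p \<in> ?D" by auto
    from D[OF this] obtain x where x: "snd p = invs x" "x \<in> torus (Suc m)" "cmod (x m) = 1" by blast
    then have "Im (x m) = 0" using p Smm[of x] by auto
    then show "?G p \<in> ?E" using p x qstretch_invs[of m "fst p" x] stretch_fix by (cases p) (auto simp: Smm)
  qed
  show "?G (1, y) \<in> ?E" if "y \<in> ?N" for y
  proof -
    have "y \<in> ?D" using that by auto
    from D[OF this] obtain x where x: "y = invs x" "x \<in> torus (Suc m)" "cmod (x m) = 1" by blast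
    then have "(Im (x m))\<^sup>2 < 1/4" using that Smm[of x] by auto
    then have "Im (stretch 1 (x m)) = 0" by (rule stretch_1)
    then show ?thesis using x st[of x 1] inD by (simp add: qstretch_invs Smm)
  qed
  show "continuous_on ?M ?k"
  proof -
    have nz: "\<forall>y\<in>?M. stretch_norm 1 (fst y m) (snd y m m) \<noteq> 0" using pos[of _ 1] by fastforce
    have sq: "\<forall>y\<in>?M. sqrt (snd y m m) \<noteq> 0" by auto
    have n: "continuous_on ?M (\<lambda>y. stretch_norm 1 (fst y m) (snd y m m))"
      by (intro cont_stretch_norm c1 continuous_on_const)
    have 1: "continuous_on ?M (\<lambda>y. (1 - fst y m / stretch_norm 1 (fst y m) (snd y m m)) / 2)"
      by (intro continuous_intros continuous_on_divide[OF c1(1) n nz]) auto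
    have "continuous_on ?M (\<lambda>y. Complex (fst y j) (snd y j m / sqrt (snd y m m)))" for j
      by (intro cont_Complex c1 continuous_on_divide[OF c1(2) continuous_on_real_sqrt[OF c1(2)] sq])
    then have 2: "continuous_on ?M (\<lambda>y. (\<lambda>j. Complex (fst y j) (snd y j m / sqrt (snd y m m)))(m := 1))"
      by (intro cont_upd continuous_on_const cont_fun)
    show ?thesis unfolding qcoords_def by (rule continuous_on_Pair[OF 1 2])
  qed
  have kx: "\<exists>x x'. y = invs x \<and> x \<in> torus (Suc m) \<and> cmod (x m) = 1 \<and> Im (x m) \<noteq> 0 \<and>
      x' = (if Im (x m) > 0 then x else conjs x) \<and> x' \<in> torus (Suc m) \<and> ?k y = (arc_time (stretch 1 (x m)), x'(m := 1))" if "y \<in> ?M" for y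
  proof -
    have "y \<in> ?D" using that by auto
    from D[OF this] obtain x where x: "y = invs x" "x \<in> torus (Suc m)" "cmod (x m) = 1" by blast
    then have "Im (x m) \<noteq> 0" using that Smm[of x] by auto
    then show ?thesis using x qcoords_invs conjs_torus[OF x(2)]
      by (intro exI[of _ x] exI[of _ "if Im (x m) > 0 then x else conjs x"]) auto
  qed
  show "?k ` ?M \<subseteq> {0..1} \<times> ?A"
  proof (rule image_subsetI)
    fix y assume "y \<in> ?M"
    then obtain x x' where x: "cmod (x m) = 1" "x' \<in> torus (Suc m)" "?k y = (arc_time (stretch 1 (x m)), x'(m := 1))"
      using kx by blast
    have "arc_time (stretch 1 (x m)) \<in> {0..1}"
      by (intro arc_time_range norm_stretch x(1)) auto
    then show "?k y \<in> {0..1} \<times> ?A" using torus_upd1[OF x(2)] x(3) by simp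
  qed
  show "?h (?k y) = ?G (1, y)" if "y \<in> ?M" for y
  proof -
    from kx[OF that] obtain x x' where x: "y = invs x" "cmod (x m) = 1" "x' = (if Im (x m) > 0 then x else conjs x)" "?k y = (arc_time (stretch 1 (x m)), x'(m := 1))"
      by blast
    show ?thesis
    proof (cases "Im (x m) > 0")
      case True
      then have "half_arc 1 (arc_time (stretch 1 (x m))) = stretch 1 (x m)"
        using x(2) stretch_sgn[of "x m" 1 1] by (intro arc_arc_time norm_stretch) auto
      then show ?thesis using x True by (simp add: qstretch_invs)
    next
      \<comment> \<open>The representative is now the conjugate point, which has the same
        invariants.\<close>
      case False
      then have "half_arc 1 (arc_time (stretch 1 (cnj (x m)))) = stretch 1 (cnj (x m))"
        using x(2) stretch_sgn[of "cnj (x m)" 1 1] by (intro arc_arc_time norm_stretch) auto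
      then have "half_arc 1 (arc_time (stretch 1 (x m))) = cnj (stretch 1 (x m))"
        by (simp add: stretch_cnj arc_time_def)
      moreover have "invs ((conjs x)(m := cnj (stretch 1 (x m)))) = invs (x(m := stretch 1 (x m)))"
        by (metis conjs_upd invs_conjs)
      ultimately show ?thesis using x False by (simp add: qstretch_invs)
    qed
  qed
  show "?k ` (?M \<inter> ?N) \<subseteq> {0, 1} \<times> ?A"
  proof (rule image_subsetI)
    fix y assume y: "y \<in> ?M \<inter> ?N"
    then obtain x x' where x: "y = invs x" "cmod (x m) = 1" "x' \<in> torus (Suc m)" "?k y = (arc_time (stretch 1 (x m)), x'(m := 1))"
      using kx by blast
    then have "(Im (x m))\<^sup>2 < 1/4" using y Smm[of x] by auto
    then have "Im (stretch 1 (x m)) = 0" by (rule stretch_1)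
    then have "arc_time (stretch 1 (x m)) \<in> {0, 1}"
      using unit_Im_0[OF norm_stretch[OF x(2)], of 1] by (auto simp: arc_time_def)
    then show "?k y \<in> {0, 1} \<times> ?A" using torus_upd1[OF x(3)] x(4) by simp
  qed
  show "continuous_on {0..1} ?\<rho>" "?\<rho> ` {0..1} \<subseteq> {0..1}" "?\<rho> 0 = 0" "?\<rho> 1 = 1"
    by (fact cont_arc_profile arc_profile_range arc_profile_ends)+
  show "?k (?h (t, x)) = (?\<rho> t, x)" if "t \<in> {0..1}" "x \<in> ?A" "?h (t, x) \<in> ?M" for t x
  proof -
    let ?x = "x(m := half_arc 1 t)"
    have "Im (half_arc 1 t) \<noteq> 0" using that(3) Smm[of ?x] by auto
    moreover have "0 \<le> Im (half_arc 1 t)" using that(1) t_t2[of t] by (simp add: half_arc_def)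
    ultimately have "Im (?x m) > 0" by simp
    then show ?thesis using qcoords_invs[of ?x m] that(2) arc_time_stretch_arc[of 1 t] by (simp add: torus_upd_same)
  qed
  show "?\<rho> t \<in> {0, 1}" if "t \<in> {0..1}" "x \<in> ?A" "?h (t, x) \<in> ?N" for t x
    using that Smm[of "x(m := half_arc 1 t)"] by (intro arc_profile_collar) auto
qed

section \<open>Homology of tori\<close>

text \<open>\<open>E\<close> is the disjoint union of \<open>B\<close> and a second copy of it,
  embedded by \<open>j\<close>. Continuity of \<open>\<psi>\<close>, which records the sign of the
  end and the point of \<open>B\<close>, is what separates the copies and lets chains split.\<close>

locale two_ends =
  fixes B E :: "'a::topological_space set" and j :: "'a \<Rightarrow> 'a" and \<psi> :: "'a \<Rightarrow> real \<times> 'a"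
  assumes j: "continuous_on B j" "\<And>b. b \<in> B \<Longrightarrow> j b \<in> E" "B \<subseteq> E"
    and \<psi>: "continuous_on E \<psi>" "\<And>b. b \<in> B \<Longrightarrow> \<psi> b = (1, b)" "\<And>b. b \<in> B \<Longrightarrow> \<psi> (j b) = (-1, b)"
    and cover: "\<And>e. e \<in> E \<Longrightarrow> e \<in> B \<or> (\<exists>b\<in>B. e = j b)"
begin

lemma split:
  assumes "s \<in> chS p E"
  obtains x y where "x \<in> chS p B" "y \<in> chS p B" "s = x + cmap p j y"
proof -
  have "cmap p \<psi> s \<in> chS p ({1, -1} \<times> B)"
  proof (rule cmapS_in[OF assms \<psi>(1)])
    show "\<psi> e \<in> {1, -1} \<times> B" if "e \<in> E" for e using cover[OF that] \<psi>(2,3) by auto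
  qed
  then obtain x y where xy: "x \<in> chS p B" "y \<in> chS p B" "cmap p \<psi> s = cmap p (Pair 1) x + cmap p (Pair (-1)) y"
    using chS_ends_split[of _ p 1 "-1::real" B] by auto
  define \<phi> where "\<phi> = (\<lambda>(\<epsilon>::real, b). if \<epsilon> = 1 then b else j b)"
  have "cmap p \<phi> (cmap p \<psi> s) = s"
    unfolding cmap_cmap
  proof (rule cmapS_id[OF assms])
    show "(\<phi> \<circ> \<psi>) e = e" if "e \<in> E" for e using cover[OF that] \<psi>(2,3) by (auto simp: \<phi>_def)
  qed
  moreover have "cmap p \<phi> (cmap p (Pair 1) x) = x"
    unfolding cmap_cmap by (rule cmapS_id[OF xy(1)]) (simp add: \<phi>_def)
  moreover have "cmap p \<phi> (cmap p (Pair (-1)) y) = cmap p j y"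
    unfolding cmap_cmap by (rule cmapS_eq[OF xy(2)]) (simp add: \<phi>_def)
  ultimately have "s = x + cmap p j y" unfolding xy(3) cmap_add by simp
  then show ?thesis using that xy by blast
qed

lemma unique:
  assumes "x \<in> chS p B" "y \<in> chS p B" "x + cmap p j y = 0"
  shows "x = 0" "y = 0"
proof -
  have "cmap p \<psi> x = cmap p (Pair 1) x" by (rule cmapS_eq[OF assms(1)]) (rule \<psi>(2))
  moreover have "cmap p \<psi> (cmap p j y) = cmap p (Pair (-1)) y"
    unfolding cmap_cmap by (rule cmapS_eq[OF assms(2)]) (simp add: \<psi>(3))
  ultimately have "cmap p (Pair (1::real)) x + cmap p (Pair (-1)) y = 0"
    using arg_cong[OF assms(3), of "cmap p \<psi>"] by (simp add: cmap_add)
  then show "x = 0" "y = 0"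
    using chS_ends_unique[OF assms(1,2), of "1::real" "-1"] by auto
qed

lemma unique_eq:
  assumes "x \<in> chS p B" "y \<in> chS p B" "x' \<in> chS p B" "y' \<in> chS p B" "x + cmap p j y = x' + cmap p j y'"
  shows "x = x'" "y = y'"
proof -
  have "(x + x') + cmap p j (y + y') = 0"
    using assms(5) F2_eq_iff[of "x + cmap p j y" "x' + cmap p j y'"] by (simp add: cmap_add F2_ac)
  then have "x + x' = 0" "y + y' = 0"
    using unique[OF ch_add[OF assms(1,3)] ch_add[OF assms(2,4)]] by simp_all
  then show "x = x'" "y = y'" unfolding F2_eq_iff[of x x'] F2_eq_iff[of y y'] .
qed

lemma j_in: "y \<in> chS p B \<Longrightarrow> cmap p j y \<in> chS p E"
  by (rule cmapS_in[OF _ j(1)]) (auto intro: j)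

lemma cycle_split:
  assumes "s \<in> cycS p E"
  obtains x y where "x \<in> cycS p B" "y \<in> cycS p B" "s = x + cmap p j y"
proof -
  obtain x y where xy: "x \<in> chS p B" "y \<in> chS p B" "s = x + cmap p j y"
    by (rule split[OF cycD(1)[OF assms]])
  have "bd p x + cmap (p - 1) j (bd p y) = 0"
    using cycD(2)[OF assms] unfolding xy(3) bd_add bd_cmap[OF xy(2)] .
  then have "bd p x = 0" "bd p y = 0" using unique[OF bd_in[OF xy(1)] bd_in[OF xy(2)]] by simp_all
  then show ?thesis using that[OF cycI[OF xy(1)] cycI[OF xy(2)] xy(3)] by simp
qed

text \<open>Chains of \<open>E\<close> are uniquely pairs of chains of \<open>B\<close>, compatibly
  with boundaries, so the order of homology is squared.\<close>

lemma index:
  assumes "has_index (bndS p B) (cycS p B) n"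
  shows "has_index (bndS p E) (cycS p E) (n * n)"
proof (rule has_index_mult[OF F2_subspace_bnd F2_subspace_bnd F2_subspace_bnd F2_subspace_cyc F2_subspace_cyc _ assms assms])
  show "cycS p B \<subseteq> cycS p E" using cycS_mono[OF _ j(3)] by blast
  show jc: "cmap p j a \<in> cycS p E" if "a \<in> cycS p B" for a by (rule cycS_cmap[OF that j(1,2)])
  show "\<exists>a\<in>cycS p B. \<exists>s\<in>cycS p B. z + cmap p j a + s \<in> bndS p E" if z: "z \<in> cycS p E" for z
  proof -
    obtain x y where "x \<in> cycS p B" "y \<in> cycS p B" "z = x + cmap p j y" using cycle_split[OF z] .
    then show ?thesis using bnd_0 by (intro bexI[of _ y] bexI[of _ x]) (auto simp: F2_ac)
  qed
  have key: "s \<in> bndS p B \<and> a \<in> bndS p B" if as: "s \<in> chS p B" "a \<in> chS p B" "s + cmap p j a \<in> bndS p E" for s a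
  proof -
    obtain d where d: "d \<in> chS (Suc p) E" "s + cmap p j a = bd (Suc p) d" using as(3) by (auto simp: bnd_def)
    obtain x y where xy: "x \<in> chS (Suc p) B" "y \<in> chS (Suc p) B" "d = x + cmap (Suc p) j y" using split[OF d(1)] .
    have "s + cmap p j a = bd (Suc p) x + cmap p j (bd (Suc p) y)"
      unfolding d(2) xy(3) bd_add bd_cmap_Suc[OF xy(2)] ..
    from unique_eq[OF as(1,2) bd_in_Suc[OF xy(1)] bd_in_Suc[OF xy(2)] this] show ?thesis
      using bndI[OF xy(1)] bndI[OF xy(2)] by simp
  qed
  show "a + a' \<in> bndS p B" if "a \<in> cycS p B" "a' \<in> cycS p B" "s \<in> cycS p B" "cmap p j a + cmap p j a' + s \<in> bndS p E" for a a' s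
    using key[of s "a + a'"] that cycD(1) by (auto simp: cmap_add F2_ac)
  show "\<exists>s\<in>cycS p B. cmap p j a + cmap p j a' + s \<in> bndS p E" if "a + a' \<in> bndS p B" for a a'
    using bndS_cmap[OF that j(1,2)] cyc_0 by (intro bexI[of _ 0]) (auto simp: cmap_add)
  show "s \<in> bndS p E \<longleftrightarrow> s \<in> bndS p B" if "s \<in> cycS p B" for s
    using key[of s 0] that cycD(1) bndS_mono[OF _ j(3)] by auto
qed

end

definition flip_end :: "nat \<Rightarrow> (nat \<Rightarrow> complex) \<Rightarrow> nat \<Rightarrow> complex" where
  "flip_end m x = x(m := -1)"

lemma two_ends_torus:
  "two_ends (torus m) {x \<in> torus (Suc m). Im (x m) = 0} (flip_end m) (\<lambda>x. (Re (x m), x(m := 1)))"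
proof
  show "continuous_on (torus m) (flip_end m)"
    unfolding flip_end_def by (intro cont_upd continuous_on_id continuous_on_const)
  show "continuous_on {x \<in> torus (Suc m). Im (x m) = 0} (\<lambda>x. (Re (x m), x(m := 1)))"
    by (intro continuous_on_Pair cont_upd continuous_on_id continuous_on_const continuous_on_Re cont_app[of _ "\<lambda>x. x"])
  show "b \<in> torus m \<or> (\<exists>e\<in>torus m. b = flip_end m e)" if "b \<in> {x \<in> torus (Suc m). Im (x m) = 0}" for b
  proof -
    have b: "b(m := 1) \<in> torus m" using that torus_upd1 by blast
    have "b m = 1 \<or> b m = -1" using that unit_Im_0[of "b m"] torus_norm by auto
    moreover have "b = b(m := 1)" if "b m = 1" using that by auto
    moreover have "b = flip_end m (b(m := 1))" if "b m = -1" using that by (auto simp: flip_end_def)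
    ultimately show ?thesis using b by metis
  qed
  show "torus m \<subseteq> {x \<in> torus (Suc m). Im (x m) = 0}"
    using torus_mono[of m] by (auto simp: torus_at)
qed (auto simp: flip_end_def torus_upd_same torus_at intro!: torus_upd)

section \<open>Sweeping chains around the new circle\<close>

definition half_turn :: "real \<Rightarrow> nat \<Rightarrow> real \<times> (nat \<Rightarrow> complex) \<Rightarrow> nat \<Rightarrow> complex" where
  "half_turn \<epsilon> m = (\<lambda>(t, x). x(m := half_arc \<epsilon> t))"

lemma cont_half_turn: "continuous_on S (half_turn \<epsilon> m)"
  unfolding half_turn_def case_prod_unfold by (intro cont_upd cont_arc continuous_intros)

lemma half_turn_in: "\<epsilon> = 1 \<or> \<epsilon> = -1 \<Longrightarrow> p \<in> {0..1} \<times> torus m \<Longrightarrow> half_turn \<epsilon> m p \<in> torus (Suc m)"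
  by (auto simp: half_turn_def intro!: torus_upd norm_arc)

text \<open>The cross product of \<open>a\<close> with the half circle of sign \<epsilon> in
  coordinate \<open>m\<close>.\<close>

definition sweep :: "real \<Rightarrow> nat \<Rightarrow> nat \<Rightarrow> (nat \<Rightarrow> complex) chain2 \<Rightarrow> (nat \<Rightarrow> complex) chain2" where
  "sweep \<epsilon> m q a = cmap (Suc q) (half_turn \<epsilon> m) (prism q a)"

lemma sweep_add: "sweep \<epsilon> m q (a + b) = sweep \<epsilon> m q a + sweep \<epsilon> m q b"
  by (simp add: sweep_def prism_add cmap_add)

lemma sweep_0 [simp]: "sweep \<epsilon> m q 0 = 0"
  by (simp add: sweep_def)

lemma sweep_in: "\<epsilon> = 1 \<or> \<epsilon> = -1 \<Longrightarrow> a \<in> chS q (torus m) \<Longrightarrow> sweep \<epsilon> m q a \<in> chS (Suc q) (torus (Suc m))"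
  unfolding sweep_def by (rule cmapS_in[OF prismS_in cont_half_turn half_turn_in])

lemma bd_sweep:
  assumes "a \<in> chS q (torus m)"
  shows "bd (Suc q) (sweep \<epsilon> m q a) = a + cmap q (flip_end m) a + cmap q (half_turn \<epsilon> m) (prism (q - 1) (bd q a))"
proof -
  have "cmap q (\<lambda>x. half_turn \<epsilon> m (0, x)) a = a"
    by (rule cmapS_id[OF assms]) (simp add: half_turn_def torus_upd_same)
  then show ?thesis
    unfolding sweep_def bd_prism_cmap[OF assms] by (simp add: half_turn_def flip_end_def[abs_def] F2_ac)
qed

lemma bd_sweep_cyc: "a \<in> cycS q (torus m) \<Longrightarrow> bd (Suc q) (sweep \<epsilon> m q a) = a + cmap q (flip_end m) a"
  by (simp add: bd_sweep cycD)

lemma bd_sweep_Suc: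
  "a \<in> chS (Suc q) (torus m) \<Longrightarrow> bd (Suc (Suc q)) (sweep \<epsilon> m (Suc q) a) = a + cmap (Suc q) (flip_end m) a + sweep \<epsilon> m q (bd (Suc q) a)"
  by (simp add: bd_sweep) (simp add: sweep_def)

text \<open>The cross product of \<open>a\<close> with the full circle; no sign appears modulo
  2.\<close>

definition circ :: "nat \<Rightarrow> nat \<Rightarrow> (nat \<Rightarrow> complex) chain2 \<Rightarrow> (nat \<Rightarrow> complex) chain2" where
  "circ m q a = sweep 1 m q a + sweep (-1) m q a"

lemma circ_add: "circ m q (a + b) = circ m q a + circ m q b"
  by (simp add: circ_def sweep_add F2_ac)

lemma circ_cyc: "a \<in> cycS q (torus m) \<Longrightarrow> circ m q a \<in> cycS (Suc q) (torus (Suc m))"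
  unfolding circ_def by (rule cycI) (auto simp: bd_add bd_sweep_cyc intro!: ch_add sweep_in dest: cycD(1))

lemma circ_bnd: assumes "a \<in> bndS q (torus m)" shows "circ m q a \<in> bndS (Suc q) (torus (Suc m))"
proof -
  obtain e where e: "e \<in> chS (Suc q) (torus m)" "a = bd (Suc q) e" using assms by (auto simp: bnd_def)
  have "circ m q a = bd (Suc (Suc q)) (circ m (Suc q) e)"
    unfolding circ_def bd_add bd_sweep_Suc[OF e(1)] e(2) by (simp add: F2_ac)
  moreover have "circ m (Suc q) e \<in> chS (Suc (Suc q)) (torus (Suc m))"
    unfolding circ_def by (intro ch_add sweep_in e) auto
  ultimately show ?thesis using bndI[of "circ m (Suc q) e" "Suc q" "top_of_set (torus (Suc m))"] by simp
qed

interpretation tor: two_ends "torus m" "{x \<in> torus (Suc m). Im (x m) = 0}" "flip_end m" "\<lambda>x. (Re (x m), x(m := 1))" for m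
  by (rule two_ends_torus)

lemma cyl_sweep:
  assumes "a \<in> chS q (torus m)"
  shows "cmap (Suc q) (\<lambda>(t, (\<epsilon>, x)). x(m := half_arc \<epsilon> t)) (prism q (cmap q (Pair \<epsilon>) a)) = sweep \<epsilon> m q a"
proof -
  have "(\<lambda>(t, (\<epsilon>, x)). x(m := half_arc \<epsilon> t)) \<circ> (\<lambda>(t::real, x). (t, Pair \<epsilon> x)) = half_turn \<epsilon> m"
    by (auto simp: half_turn_def)
  then show ?thesis
    unfolding sweep_def prism_natural[OF assms, symmetric] cmap_cmap by simp
qed

text \<open>The gluing gives a cycle \<open>a1\<close> for the upper and \<open>a2\<close> for the
  lower half turn. Comparing boundaries on the two ends shows that they are homologous, so the two
  half sweeps can be completed to one full turn of \<open>a1\<close>.\<close>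

lemma torus_cycle_decomp:
  assumes z: "z \<in> cycS (Suc q) (torus (Suc m))"
  obtains a s where "a \<in> cycS q (torus m)" "s \<in> cycS (Suc q) (torus m)" "z + circ m q a + s \<in> bndS (Suc q) (torus (Suc m))"
proof -
  let ?p = "Suc (Suc q)" and ?E = "{x \<in> torus (Suc m). Im (x m) = 0}" and ?D = "torus (Suc m)" and ?j = "cmap (Suc q) (flip_end m)"
  obtain a where a: "a \<in> chS q ({1, -1} \<times> torus m)" "bd q a = 0"
    "z + cmap (Suc q) (\<lambda>(t, (\<epsilon>, x)). x(m := half_arc \<epsilon> t)) (prism q a) \<in> relb (Suc q) ?D ?E"
    using glued_cylinder.relcycle_prism[OF glued_cylinder_torus cycD(1)[OF z]] cycD(2)[OF z] by auto
  obtain a1 a2 where a12: "a1 \<in> chS q (torus m)" "a2 \<in> chS q (torus m)" "a = cmap q (Pair 1) a1 + cmap q (Pair (-1)) a2"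
    using chS_ends_split[OF a(1)] by auto
  have "cmap (q - 1) (Pair 1) (bd q a1) + cmap (q - 1) (Pair (-1::real)) (bd q a2) = 0"
    using a(2) unfolding a12(3) bd_add bd_cmap[OF a12(1)] bd_cmap[OF a12(2)] .
  then have "bd q a1 = 0" "bd q a2 = 0"
    using chS_ends_unique[OF bd_in[OF a12(1)] bd_in[OF a12(2)], of "1::real" "-1"] by auto
  then have ac: "a1 \<in> cycS q (torus m)" "a2 \<in> cycS q (torus m)" using a12 cycI by blast+
  have "z + (sweep 1 m q a1 + sweep (-1) m q a2) \<in> relb (Suc q) ?D ?E"
    using a(3) unfolding a12(3) prism_add cmap_add cyl_sweep[OF a12(1)] cyl_sweep[OF a12(2)] .
  then obtain d s where d: "d \<in> chS ?p ?D" and s: "s \<in> chS (Suc q) ?E"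
    and eq: "z + (sweep 1 m q a1 + sweep (-1) m q a2) = bd ?p d + s" by (rule relb_E)
  obtain x y where xy: "x \<in> chS (Suc q) (torus m)" "y \<in> chS (Suc q) (torus m)" "s = x + ?j y"
    using tor.split[OF s] .
  have "bd (Suc q) (z + (sweep 1 m q a1 + sweep (-1) m q a2)) = bd (Suc q) x + cmap q (flip_end m) (bd (Suc q) y)"
    unfolding eq bd_add bd_bd_Suc[OF d] xy(3) bd_cmap_Suc[OF xy(2)] by simp
  then have "(a1 + a2) + cmap q (flip_end m) (a1 + a2) = bd (Suc q) x + cmap q (flip_end m) (bd (Suc q) y)"
    unfolding bd_add cycD(2)[OF z] bd_sweep_cyc[OF ac(1)] bd_sweep_cyc[OF ac(2)] by (simp add: cmap_add F2_ac)
  then have e: "a1 + a2 = bd (Suc q) x" "a1 + a2 = bd (Suc q) y"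
    using tor.unique_eq[OF _ _ bd_in_Suc[OF xy(1)] bd_in_Suc[OF xy(2)]] a12 by blast+
  \<comment> \<open>The sweep of \<open>x\<close> replaces \<open>a2\<close> by \<open>a1\<close>
    and turns the end term \<open>x + ?j y\<close> into \<open>?j (x + y)\<close>; the sweep of
    \<open>x + y\<close> then carries this from the end -1 to the end 1.\<close>
  let ?d = "d + sweep (-1) m (Suc q) x + sweep 1 m (Suc q) (x + y)"
  have dd: "?d \<in> chS ?p ?D" by (intro ch_add d sweep_in xy) auto
  have a2: "a2 = a1 + bd (Suc q) x" using e(1) by (simp only: F2_move add.commute)
  have "bd (Suc q) x = bd (Suc q) y" using e by simp
  then have bdxy: "bd (Suc q) (x + y) = 0" by (simp add: bd_add)
  have xyc: "x + y \<in> chS (Suc q) (torus m)" using xy by auto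
  have z': "z = (sweep 1 m q a1 + sweep (-1) m q a2) + (bd ?p d + (x + ?j y))"
    using eq unfolding xy(3) by (rule F2_move[THEN iffD2])
  have "bd ?p (sweep 1 m (Suc q) (x + y)) = (x + y) + ?j (x + y)"
    by (simp only: bd_sweep_Suc[OF xyc] bdxy sweep_0 add_0_right)
  then have "bd ?p ?d = bd ?p d + (x + ?j x + sweep (-1) m q (bd (Suc q) x)) + ((x + y) + ?j (x + y))"
    by (simp only: bd_add bd_sweep_Suc[OF xy(1)])
  then have "z + circ m q a1 + (x + y) = bd ?p ?d"
    unfolding z' circ_def a2 sweep_add by (simp add: cmap_add F2_ac)
  then have "z + circ m q a1 + (x + y) \<in> bndS (Suc q) ?D" using bndI[OF dd] by simp
  then show ?thesis using that[OF ac(1)] cycI[OF xyc bdxy] by blast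
qed

text \<open>The two summands are detected separately: \<open>a\<close> by the relative class modulo
  the ends, \<open>s\<close> by the retraction that forgets coordinate \<open>m\<close>.\<close>

lemma torus_cycle_indep:
  assumes a: "a \<in> cycS q (torus m)" and s: "s \<in> cycS (Suc q) (torus m)"
    and b: "circ m q a + s \<in> bndS (Suc q) (torus (Suc m))"
  shows "a \<in> bndS q (torus m)" "s \<in> bndS (Suc q) (torus m)"
proof -
  let ?p = "Suc (Suc q)" and ?E = "{x \<in> torus (Suc m). Im (x m) = 0}" and ?D = "torus (Suc m)"
  let ?a = "cmap q (Pair (1::real)) a + cmap q (Pair (-1)) a"
  obtain d where d: "d \<in> chS ?p ?D" "circ m q a + s = bd ?p d" using b by (auto simp: bnd_def)
  have ac: "a \<in> chS q (torus m)" "bd q a = 0" using a cycD by blast+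
  have "cmap (Suc q) (\<lambda>(t, (\<epsilon>, x)). x(m := half_arc \<epsilon> t)) (prism q ?a) = circ m q a"
    unfolding prism_add cmap_add cyl_sweep[OF ac(1)] circ_def ..
  moreover have "circ m q a \<in> relb (Suc q) ?D ?E"
  proof (rule relb_I[OF d(1)])
    show "s \<in> chS (Suc q) ?E" using chS_mono[OF cycD(1)[OF s]] tor.j(3) by blast
    show "circ m q a = bd ?p d + s"
      using F2_move[THEN iffD2, OF d(2)] by (simp only: add.commute)
  qed
  moreover have "?a \<in> chS q ({1, -1} \<times> torus m)" by (intro ch_add cmap_Pair_in[OF ac(1)]) auto
  moreover have "bd q ?a = 0" by (simp add: bd_add bd_cmap[OF ac(1)] ac(2))
  ultimately obtain e where e: "e \<in> chS (Suc q) ({1, -1} \<times> torus m)" "?a = bd (Suc q) e"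
    using glued_cylinder.prism_relbound[OF glued_cylinder_torus, of ?a q m] by auto
  obtain e1 e2 where e12: "e1 \<in> chS (Suc q) (torus m)" "e2 \<in> chS (Suc q) (torus m)" "e = cmap (Suc q) (Pair 1) e1 + cmap (Suc q) (Pair (-1)) e2"
    using chS_ends_split[OF e(1)] by auto
  have "?a = cmap q (Pair 1) (bd (Suc q) e1) + cmap q (Pair (-1)) (bd (Suc q) e2)"
    unfolding e(2) e12(3) bd_add bd_cmap_Suc[OF e12(1)] bd_cmap_Suc[OF e12(2)] ..
  then have "cmap q (Pair 1) (a + bd (Suc q) e1) + cmap q (Pair (-1::real)) (a + bd (Suc q) e2) = 0"
    unfolding cmap_add by (subst (asm) F2_eq_iff) (simp add: F2_ac)
  then have "a + bd (Suc q) e1 = 0"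
    using chS_ends_unique(1)[of "a + bd (Suc q) e1" q "torus m" "a + bd (Suc q) e2" "1::real" "-1"] ac bd_in_Suc e12 by auto
  then show "a \<in> bndS q (torus m)" using bndI[OF e12(1)] F2_eq_iff[of a "bd (Suc q) e1"] by simp
  \<comment> \<open>This retraction does not distinguish the two half turns, so it kills
    \<open>circ\<close> modulo 2.\<close>
  let ?r = "\<lambda>x::nat \<Rightarrow> complex. x(m := 1)"
  have "?r \<circ> half_turn 1 m = ?r \<circ> half_turn (-1) m" by (auto simp: half_turn_def)
  then have "cmap (Suc q) ?r (circ m q a) = 0"
    unfolding circ_def sweep_def cmap_add cmap_cmap by simp
  moreover have "cmap (Suc q) ?r s = s"
    by (rule cmapS_id[OF cycD(1)[OF s]]) (rule torus_upd_same)
  moreover have "cmap (Suc q) ?r (circ m q a + s) \<in> bndS (Suc q) (torus m)"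
    by (rule bndS_cmap[OF b]) (auto intro: cont_upd continuous_on_id continuous_on_const torus_upd1)
  ultimately show "s \<in> bndS (Suc q) (torus m)" by (simp add: cmap_add)
qed

lemma torus_0: "torus 0 = {\<lambda>_. 1}"
  by (auto simp: torus_def)

lemma torus_path_connected: "path_connected (torus m)"
proof (induction m)
  case (Suc m)
  have "torus (Suc m) = (\<lambda>(x, z). x(m := z)) ` (torus m \<times> sphere 0 1)"
  proof
    show "torus (Suc m) \<subseteq> (\<lambda>(x, z). x(m := z)) ` (torus m \<times> sphere 0 1)"
    proof
      fix x assume x: "x \<in> torus (Suc m)"
      have "x = (\<lambda>(x, z). x(m := z)) (x(m := 1), x m)" by simp
      moreover have "(x(m := 1), x m) \<in> torus m \<times> sphere 0 1" using torus_upd1[OF x] torus_norm[OF x] by simp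
      ultimately show "x \<in> (\<lambda>(x, z). x(m := z)) ` (torus m \<times> sphere 0 1)" by (rule image_eqI)
    qed
  qed (auto intro: torus_upd)
  moreover have "path_connected (torus m \<times> sphere (0::complex) 1)"
    by (intro path_connected_Times Suc.IH path_connected_sphere) simp
  moreover have "continuous_on (torus m \<times> sphere (0::complex) 1) (\<lambda>(x, z). x(m := z))"
    unfolding case_prod_unfold by (intro cont_upd continuous_intros)
  ultimately show ?case by (simp only: path_connected_continuous_image)
qed (simp add: torus_0)

lemma one_in_torus: "(\<lambda>_. 1) \<in> torus m"
  by (simp add: torus_def)

text \<open>Pascal's rule: classes in degree q + 1 come from degree q + 1 of the smaller torus or,
  through \<open>circ\<close>, from degree q.\<close>

lemma torus_index: "has_index (bndS i (torus m)) (cycS i (torus m)) (2 ^ (m choose i))"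
proof (induction m arbitrary: i)
  case 0
  show ?case
  proof (cases "i = 0")
    case True
    then show ?thesis using path_connected_index_0[OF torus_path_connected one_in_torus] by simp
  next
    case False
    then have "cycS i (torus 0) \<subseteq> bndS i (torus 0)"
      by (intro cyc_bnd_point[of _ "\<lambda>_. 1"]) (auto simp: torus_0)
    then have "has_index (bndS i (torus 0)) (cycS i (torus 0)) 1"
      by (intro has_index_1 F2_subspace_bnd F2_subspace_0 F2_subspace_cyc)
    then show ?thesis using False by (simp add: binomial_eq_0)
  qed
next
  case (Suc m)
  show ?case
  proof (cases i)
    case 0
    then show ?thesis using path_connected_index_0[OF torus_path_connected one_in_torus] by simp
  next
    case (Suc q)
    have "has_index (bndS (Suc q) (torus (Suc m))) (cycS (Suc q) (torus (Suc m))) (2 ^ (m choose Suc q) * 2 ^ (m choose q))"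
    proof (rule has_index_mult[OF F2_subspace_bnd F2_subspace_bnd F2_subspace_bnd F2_subspace_cyc F2_subspace_cyc _ Suc.IH Suc.IH, where g = "circ m q"])
      show "cycS (Suc q) (torus m) \<subseteq> cycS (Suc q) (torus (Suc m))" using cycS_mono[OF _ torus_mono] by blast
      show "circ m q a \<in> cycS (Suc q) (torus (Suc m))" if "a \<in> cycS q (torus m)" for a using circ_cyc[OF that] .
      show "\<exists>a\<in>cycS q (torus m). \<exists>s\<in>cycS (Suc q) (torus m). z + circ m q a + s \<in> bndS (Suc q) (torus (Suc m))"
        if z: "z \<in> cycS (Suc q) (torus (Suc m))" for z
        by (rule torus_cycle_decomp[OF z]) blast
      show "a + a' \<in> bndS q (torus m)" if "a \<in> cycS q (torus m)" "a' \<in> cycS q (torus m)" "s \<in> cycS (Suc q) (torus m)"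
        "circ m q a + circ m q a' + s \<in> bndS (Suc q) (torus (Suc m))" for a a' s
        using torus_cycle_indep(1)[OF cyc_add[OF that(1,2)] that(3)] that(4) by (simp add: circ_add)
      show "\<exists>s\<in>cycS (Suc q) (torus m). circ m q a + circ m q a' + s \<in> bndS (Suc q) (torus (Suc m))"
        if "a + a' \<in> bndS q (torus m)" for a a'
        using circ_bnd[OF that] cyc_0 by (intro bexI[of _ 0]) (auto simp: circ_add)
      show "s \<in> bndS (Suc q) (torus (Suc m)) \<longleftrightarrow> s \<in> bndS (Suc q) (torus m)" if "s \<in> cycS (Suc q) (torus m)" for s
      proof
        assume "s \<in> bndS (Suc q) (torus (Suc m))"
        then have "circ m q 0 + s \<in> bndS (Suc q) (torus (Suc m))" by (simp add: circ_def)
        then show "s \<in> bndS (Suc q) (torus m)"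
          using torus_cycle_indep(2)[OF cyc_0 that] by blast
      qed (rule bndS_mono[OF _ torus_mono])
    qed
    then show ?thesis using Suc by (simp add: add.commute flip: power_add)
  qed
qed

section \<open>The quotient map kills homology in positive degrees\<close>

text \<open>The fundamental cycle of the torus as an iterated product of circles.\<close>

fun top_cycle :: "nat \<Rightarrow> (nat \<Rightarrow> complex) chain2" where
  "top_cycle 0 = pt (\<lambda>_. 1)"
| "top_cycle (Suc k) = circ k k (top_cycle k)"

lemma top_cycle_cyc: "top_cycle k \<in> cycS k (torus k)"
proof (induction k)
  case 0
  show ?case using ptS_in[OF one_in_torus, of 0] by (simp add: cyc_def)
qed (simp add: circ_cyc)

text \<open>Exact naturality of the prism turns a pointwise identity of maps into an equality of
  chains.\<close>

lemma sweep_natural: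
  assumes a: "a \<in> chS q (torus i)"
    and g: "\<And>t x. t \<in> {0..1} \<Longrightarrow> x \<in> torus i \<Longrightarrow> g (half_turn \<epsilon> i (t, x)) = g' (half_turn \<epsilon>' m (t, f x))"
  shows "cmap (Suc q) g (sweep \<epsilon> i q a) = cmap (Suc q) g' (sweep \<epsilon>' m q (cmap q f a))"
proof -
  have "cmap (Suc q) (g \<circ> half_turn \<epsilon> i) (prism q a) = cmap (Suc q) (g' \<circ> half_turn \<epsilon>' m \<circ> (\<lambda>(t, x). (t, f x))) (prism q a)"
    by (rule cmapS_eq[OF prismS_in[OF a]]) (auto simp: g)
  then show ?thesis
    unfolding sweep_def prism_natural[OF a, symmetric] cmap_cmap by (simp add: o_assoc)
qed

lemma conjs_half_turn: "conjs (half_turn \<epsilon> m (t, x)) = half_turn (- \<epsilon>) m (t, conjs x)"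
  by (simp add: half_turn_def conjs_upd cnj_arc)

text \<open>Conjugation exchanges the two half turns that make up \<open>circ\<close>.\<close>
lemma conjs_top_cycle: "cmap k conjs (top_cycle k) = top_cycle k"
proof (induction k)
  case 0
  show ?case by (simp add: cmap_pt conjs_def)
next
  case (Suc k)
  have e: "top_cycle k \<in> chS k (torus k)" by (rule cycD(1)[OF top_cycle_cyc])
  have "cmap (Suc k) conjs (sweep \<epsilon> k k (top_cycle k)) = sweep (- \<epsilon>) k k (top_cycle k)" if "\<epsilon> = 1 \<or> \<epsilon> = -1" for \<epsilon>
  proof -
    have "cmap (Suc k) conjs (sweep \<epsilon> k k (top_cycle k)) = cmap (Suc k) id (sweep (- \<epsilon>) k k (cmap k conjs (top_cycle k)))"
      by (rule sweep_natural[OF e]) (simp add: conjs_half_turn)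
    also have "\<dots> = sweep (- \<epsilon>) k k (cmap k conjs (top_cycle k))"
      by (rule cmapS_id[OF sweep_in]) (use that e Suc.IH in auto)
    finally show ?thesis by (simp add: Suc.IH)
  qed
  from this[of 1] this[of "-1"] show ?case by (simp add: circ_def cmap_add add.commute)
qed

text \<open>A property of homology classes stated for chains: boundaries are included as generators,
  next to images of the fundamental cycle under conjugation equivariant maps.\<close>

inductive_set equiv_span :: "nat \<Rightarrow> nat \<Rightarrow> (nat \<Rightarrow> complex) chain2 set" for m i where
  bnd: "c \<in> bndS i (torus m) \<Longrightarrow> c \<in> equiv_span m i"
| gen: "continuous_on (torus i) \<phi> \<Longrightarrow> (\<And>x. x \<in> torus i \<Longrightarrow> \<phi> x \<in> torus m) \<Longrightarrow>
    (\<And>x. x \<in> torus i \<Longrightarrow> \<phi> (conjs x) = conjs (\<phi> x)) \<Longrightarrow> cmap i \<phi> (top_cycle i) \<in> equiv_span m i"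
| add: "c \<in> equiv_span m i \<Longrightarrow> d \<in> equiv_span m i \<Longrightarrow> c + d \<in> equiv_span m i"

lemma equiv_span_mono: "c \<in> equiv_span m i \<Longrightarrow> c \<in> equiv_span (Suc m) i"
proof (induction rule: equiv_span.induct)
  case (bnd c)
  then show ?case using bndS_mono[OF _ torus_mono] equiv_span.bnd by blast
next
  case (gen \<phi>)
  then show ?case using torus_mono by (intro equiv_span.gen) auto
qed (rule equiv_span.add)

lemma equiv_span_circ: "c \<in> equiv_span m i \<Longrightarrow> circ m i c \<in> equiv_span (Suc m) (Suc i)"
proof (induction rule: equiv_span.induct)
  case (bnd c)
  then show ?case by (intro equiv_span.bnd circ_bnd)
next
  case (gen \<phi>)
  \<comment> \<open>The product of \<phi> with the identity of the new circle; it is again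
    equivariant because conjugation acts coordinatewise.\<close>
  define \<phi>' where "\<phi>' = (\<lambda>x. (\<phi> (x(i := 1)))(m := x i))"
  have e: "top_cycle i \<in> chS i (torus i)" by (rule cycD(1)[OF top_cycle_cyc])
  have p: "cmap i \<phi> (top_cycle i) \<in> chS i (torus m)" by (rule cmapS_in[OF e gen(1,2)])
  have "cmap (Suc i) \<phi>' (sweep \<epsilon> i i (top_cycle i)) = sweep \<epsilon> m i (cmap i \<phi> (top_cycle i))" if "\<epsilon> = 1 \<or> \<epsilon> = -1" for \<epsilon>
  proof -
    have "cmap (Suc i) \<phi>' (sweep \<epsilon> i i (top_cycle i)) = cmap (Suc i) id (sweep \<epsilon> m i (cmap i \<phi> (top_cycle i)))"
      by (rule sweep_natural[OF e]) (auto simp: \<phi>'_def half_turn_def torus_upd_same)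
    also have "\<dots> = sweep \<epsilon> m i (cmap i \<phi> (top_cycle i))"
      by (rule cmapS_id[OF sweep_in[OF that p]]) auto
    finally show ?thesis .
  qed
  then have "circ m i (cmap i \<phi> (top_cycle i)) = cmap (Suc i) \<phi>' (top_cycle (Suc i))"
    by (simp add: circ_def cmap_add)
  moreover have "cmap (Suc i) \<phi>' (top_cycle (Suc i)) \<in> equiv_span (Suc m) (Suc i)"
  proof (rule equiv_span.gen)
    show "continuous_on (torus (Suc i)) \<phi>'"
      unfolding \<phi>'_def
    proof (intro cont_upd)
      show "continuous_on (torus (Suc i)) (\<lambda>x. \<phi> (x(i := 1)))"
        by (rule continuous_on_compose2[OF gen(1)]) (auto intro: cont_upd continuous_on_id continuous_on_const torus_upd1)
      show "continuous_on (torus (Suc i)) (\<lambda>x. x i)" by (rule cont_app[OF continuous_on_id])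
    qed
    show "\<phi>' x \<in> torus (Suc m)" if "x \<in> torus (Suc i)" for x
      unfolding \<phi>'_def by (intro torus_upd gen(2) torus_upd1 that torus_norm[OF that])
    show "\<phi>' (conjs x) = conjs (\<phi>' x)" if "x \<in> torus (Suc i)" for x
    proof -
      have "(conjs x)(i := 1) = conjs (x(i := 1))" by (simp add: conjs_upd)
      then show ?thesis using gen(3)[OF torus_upd1[OF that]] unfolding \<phi>'_def conjs_upd by (simp add: conjs_def)
    qed
  qed
  ultimately show ?case by simp
next
  case (add c d)
  then show ?case unfolding circ_add by (intro equiv_span.add)
qed

lemma cycle_0_in_equiv_span:
  assumes "a \<in> cycS 0 (torus m)" shows "a \<in> equiv_span m 0"
proof -
  have a: "a \<in> chS 0 (torus m)" using assms cycD(1) by blast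
  have p: "pt (\<lambda>_. 1) \<in> equiv_span m 0"
    using equiv_span.gen[of 0 "\<lambda>_ _. 1" m] by (simp add: cmap_pt one_in_torus conjs_def)
  have "a \<in> bndS 0 (torus m) \<or> a + pt (\<lambda>_. 1) \<in> bndS 0 (torus m)"
    using aug_cases[of a] aug_0_bnd[OF torus_path_connected a]
      aug_0_bnd[OF torus_path_connected ch_add[OF a ptS_in[OF one_in_torus]]] by (auto simp: aug_add aug_pt)
  then show ?thesis
  proof
    assume "a + pt (\<lambda>_. 1) \<in> bndS 0 (torus m)"
    then have "(a + pt (\<lambda>_. 1)) + pt (\<lambda>_. 1) \<in> equiv_span m 0"
      by (intro equiv_span.add p equiv_span.bnd)
    then show ?thesis by (simp add: F2_ac)
  qed (rule equiv_span.bnd)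
qed

lemma cycle_in_equiv_span: "a \<in> cycS i (torus m) \<Longrightarrow> a \<in> equiv_span m i"
proof (induction m arbitrary: i a)
  case 0
  show ?case
  proof (cases "i = 0")
    case False
    then have "cycS i (torus 0) \<subseteq> bndS i (torus 0)"
      by (intro cyc_bnd_point[of _ "\<lambda>_. 1"]) (auto simp: torus_0)
    then show ?thesis using 0 equiv_span.bnd by blast
  qed (use 0 cycle_0_in_equiv_span in blast)
next
  case (Suc m)
  show ?case
  proof (cases i)
    case 0
    then show ?thesis using Suc.prems cycle_0_in_equiv_span by blast
  next
    case (Suc q)
    obtain b s where bs: "b \<in> cycS q (torus m)" "s \<in> cycS (Suc q) (torus m)" "a + circ m q b + s \<in> bndS (Suc q) (torus (Suc m))"
      using torus_cycle_decomp Suc.prems Suc by blast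
    have "(a + circ m q b + s) + (circ m q b + s) \<in> equiv_span (Suc m) (Suc q)"
      by (rule equiv_span.add[OF equiv_span.bnd[OF bs(3)]
            equiv_span.add[OF equiv_span_circ[OF Suc.IH[OF bs(1)]] equiv_span_mono[OF Suc.IH[OF bs(2)]]]])
    then show ?thesis using Suc by (simp add: F2_ac)
  qed
qed

lemma invs_in: "x \<in> torus m \<Longrightarrow> invs x \<in> qtorus m"
  by (simp add: qtorus_def)

lemma cont_invs_on: "continuous_on S invs"
  by (rule cont_invs[OF continuous_on_id])

lemma equiv_span_quotient:
  "c \<in> equiv_span m (Suc q) \<Longrightarrow> cmap (Suc q) invs c \<in> bndS (Suc q) (qtorus m)"
proof (induction rule: equiv_span.induct)
  case (bnd c)
  then show ?case by (rule bndS_cmap[OF _ cont_invs_on invs_in])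
next
  case (gen \<phi>)
  let ?e = "top_cycle q"
  have e: "?e \<in> chS q (torus q)" by (rule cycD(1)[OF top_cycle_cyc])
  \<comment> \<open>A lower half turn of x is the conjugate of the upper half turn of the conjugate
    of x. Since \<phi> is equivariant and \<open>invs\<close> forgets conjugation, both have the
    same image.\<close>
  have "cmap (Suc q) (invs \<circ> \<phi>) (sweep (-1) q q ?e) = cmap (Suc q) (invs \<circ> \<phi>) (sweep 1 q q (cmap q conjs ?e))"
  proof (rule sweep_natural[OF e])
    fix t :: real and x assume "t \<in> {0..1}" "x \<in> torus q"
    then have "half_turn 1 q (t, conjs x) \<in> torus (Suc q)" by (intro half_turn_in) (auto intro: conjs_torus)
    from gen(3)[OF this] have "invs (\<phi> (conjs (half_turn 1 q (t, conjs x)))) = invs (\<phi> (half_turn 1 q (t, conjs x)))"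
      by simp
    then show "(invs \<circ> \<phi>) (half_turn (-1) q (t, x)) = (invs \<circ> \<phi>) (half_turn 1 q (t, conjs x))"
      by (simp add: conjs_half_turn)
  qed
  then have "cmap (Suc q) invs (cmap (Suc q) \<phi> (top_cycle (Suc q))) = 0"
    unfolding conjs_top_cycle by (simp add: cmap_cmap circ_def cmap_add)
  then show ?case using bnd_0 by simp
next
  case (add c d)
  show ?case unfolding cmap_add by (rule bnd_add[OF add.IH])
qed

lemma quotient_kills:
  "c \<in> cycS (Suc q) (torus m) \<Longrightarrow> cmap (Suc q) invs c \<in> bndS (Suc q) (qtorus m)"
  by (intro equiv_span_quotient cycle_in_equiv_span)

section \<open>Homology of the quotients\<close>

text \<open>When coordinate \<open>m\<close> is 1 or -1, all products involving its imaginary part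
  vanish, so only the real part changes.\<close>

definition qflip_end :: "nat \<Rightarrow> (nat \<Rightarrow> real) \<times> (nat \<Rightarrow> nat \<Rightarrow> real) \<Rightarrow> (nat \<Rightarrow> real) \<times> (nat \<Rightarrow> nat \<Rightarrow> real)" where
  "qflip_end m y = ((fst y)(m := -1), snd y)"

lemma qflip_end_invs: "x m = 1 \<or> x m = -1 \<Longrightarrow> qflip_end m (invs x) = invs (flip_end m x)"
  by (auto simp: qflip_end_def flip_end_def invs_def fun_eq_iff)

lemma two_ends_qtorus:
  "two_ends (qtorus m) {y \<in> qtorus (Suc m). snd y m m = 0} (qflip_end m) (\<lambda>y. (fst y m, ((fst y)(m := 1), snd y)))"
proof
  have c: "continuous_on S (\<lambda>y. (fst y)(m := c))" for S :: "((nat \<Rightarrow> real) \<times> (nat \<Rightarrow> nat \<Rightarrow> real)) set" and c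
    by (intro cont_upd continuous_on_fst continuous_on_id continuous_on_const)
  show "continuous_on (qtorus m) (qflip_end m)"
    unfolding qflip_end_def by (intro continuous_on_Pair c continuous_on_snd continuous_on_id)
  show "continuous_on {y \<in> qtorus (Suc m). snd y m m = 0} (\<lambda>y. (fst y m, ((fst y)(m := 1), snd y)))"
    by (intro continuous_on_Pair c continuous_on_snd continuous_on_id cont_app[OF continuous_on_fst[OF continuous_on_id]])
  have B: "\<exists>x. y = invs x \<and> x \<in> torus m \<and> x m = 1" if "y \<in> qtorus m" for y
    using that torus_at by (auto simp: qtorus_def)
  show "qflip_end m b \<in> {y \<in> qtorus (Suc m). snd y m m = 0}" if b: "b \<in> qtorus m" for b
  proof -
    from B[OF b] obtain x where x: "b = invs x" "x \<in> torus m" "x m = 1" by blast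
    then have "flip_end m x \<in> torus (Suc m)" unfolding flip_end_def by (intro torus_upd) auto
    then have "qflip_end m b \<in> qtorus (Suc m)" using x by (simp add: qflip_end_invs invs_in)
    then show ?thesis using x by (simp add: qflip_end_def invs_def)
  qed
  show "qtorus m \<subseteq> {y \<in> qtorus (Suc m). snd y m m = 0}"
    using B qtorus_mono[of m] by (fastforce simp: invs_def)
  show "(fst b m, (fst b)(m := 1), snd b) = (1, b)" if b: "b \<in> qtorus m" for b
    using B[OF b] by (auto simp: invs_def)
  show "(fst (qflip_end m b) m, (fst (qflip_end m b))(m := 1), snd (qflip_end m b)) = (- 1, b)" if b: "b \<in> qtorus m" for b
    using B[OF b] by (auto simp: invs_def qflip_end_def)
  show "e \<in> qtorus m \<or> (\<exists>b\<in>qtorus m. e = qflip_end m b)" if "e \<in> {y \<in> qtorus (Suc m). snd y m m = 0}" for e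
  proof -
    have e: "e \<in> qtorus (Suc m)" "snd e m m = 0" using that by auto
    obtain x where x: "e = invs x" "x \<in> torus (Suc m)"
      using e(1) unfolding qtorus_def by blast
    moreover have "Im (x m) = 0" using e(2) x by (simp add: invs_def)
    ultimately have "x m = 1 \<or> x m = -1" using unit_Im_0 torus_norm by blast
    then show ?thesis
    proof
      assume "x m = 1"
      then have "x \<in> torus m" using torus_upd1[OF x(2)] by (metis fun_upd_triv)
      then show ?thesis using x invs_in by blast
    next
      assume "x m = -1"
      then have "flip_end m (x(m := 1)) = x" by (auto simp: flip_end_def)
      then have "e = qflip_end m (invs (x(m := 1)))" using x(1) qflip_end_invs[of "x(m := 1)" m] by simp
      then show ?thesis using invs_in[OF torus_upd1[OF x(2)]] by blast
    qed
  qed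
qed

interpretation qtor: two_ends "qtorus m" "{y \<in> qtorus (Suc m). snd y m m = 0}" "qflip_end m" "\<lambda>y. (fst y m, ((fst y)(m := 1), snd y))" for m
  by (rule two_ends_qtorus)

text \<open>Written with the gluing map of \<open>glued_cylinder_qtorus\<close>, so that the results
  of that locale apply verbatim.\<close>

definition qsweep :: "nat \<Rightarrow> nat \<Rightarrow> (nat \<Rightarrow> complex) chain2 \<Rightarrow> ((nat \<Rightarrow> real) \<times> (nat \<Rightarrow> nat \<Rightarrow> real)) chain2" where
  "qsweep m q a = cmap (Suc q) (\<lambda>(t, x). invs (x(m := half_arc 1 t))) (prism q a)"

lemma qsweep_sweep: "qsweep m q a = cmap (Suc q) invs (sweep 1 m q a)"
proof -
  have "(\<lambda>(t, x). invs (x(m := half_arc 1 t))) = invs \<circ> half_turn 1 m" by (auto simp: half_turn_def)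
  then show ?thesis by (simp add: qsweep_def sweep_def cmap_cmap)
qed

lemma qsweep_add: "qsweep m q (a + b) = qsweep m q a + qsweep m q b"
  by (simp add: qsweep_def prism_add cmap_add)

lemma qsweep_in: "a \<in> chS q (torus m) \<Longrightarrow> qsweep m q a \<in> chS (Suc q) (qtorus (Suc m))"
  unfolding qsweep_sweep by (rule cmapS_in[OF sweep_in cont_invs_on invs_in]) auto

lemma invs_flip_end:
  assumes "a \<in> chS q (torus m)" shows "cmap q invs (cmap q (flip_end m) a) = cmap q (qflip_end m) (cmap q invs a)"
  unfolding cmap_cmap by (rule cmapS_eq[OF assms]) (simp add: qflip_end_invs torus_at)

lemma bd_qsweep_cyc:
  assumes "a \<in> cycS q (torus m)"
  shows "bd (Suc q) (qsweep m q a) = cmap q invs a + cmap q (qflip_end m) (cmap q invs a)"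
  unfolding qsweep_sweep bd_cmap_Suc[OF sweep_in[OF disjI1[OF refl] cycD(1)[OF assms]]] bd_sweep_cyc[OF assms]
  by (simp add: cmap_add invs_flip_end cycD(1)[OF assms])

lemma bd_qsweep_Suc:
  assumes "a \<in> chS (Suc q) (torus m)"
  shows "bd (Suc (Suc q)) (qsweep m (Suc q) a) = cmap (Suc q) invs a + cmap (Suc q) (qflip_end m) (cmap (Suc q) invs a)
    + qsweep m q (bd (Suc q) a)"
  unfolding qsweep_sweep bd_cmap_Suc[OF sweep_in[OF disjI1[OF refl] assms]] bd_sweep_Suc[OF assms]
  by (simp add: cmap_add invs_flip_end[OF assms])

lemma cmap_invs_in: "a \<in> chS q (torus m) \<Longrightarrow> cmap q invs a \<in> chS q (qtorus m)"
  by (rule cmapS_in[OF _ cont_invs_on invs_in])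

text \<open>The exact sequence of the pair of \<open>qtorus (Suc m)\<close> and its two ends. The
  ends contribute the factor \<open>n * n\<close>. A relative class given by the prism over
  \<open>a\<close> lifts to an absolute cycle exactly when the image of \<open>a\<close> bounds in
  \<open>qtorus m\<close>, so the other factor counts the kernel of the quotient map in degree
  q.\<close>

lemma qtorus_step:
  assumes n: "has_index (bndS (Suc q) (qtorus m)) (cycS (Suc q) (qtorus m)) n"
    and n2: "has_index (bndS q (torus m)) {a \<in> cycS q (torus m). cmap q invs a \<in> bndS q (qtorus m)} n2"
  shows "has_index (bndS (Suc q) (qtorus (Suc m))) (cycS (Suc q) (qtorus (Suc m))) (n * n * n2)"
proof -
  let ?r = "Suc q" and ?p = "Suc (Suc q)" and ?E = "{y \<in> qtorus (Suc m). snd y m m = 0}" and ?D = "qtorus (Suc m)" and ?T = "torus m" and ?B = "qtorus m"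
  let ?Z2 = "{a \<in> cycS q ?T. cmap q invs a \<in> bndS q ?B}" and ?i = "cmap q invs" and ?j = "cmap ?r (qflip_end m)"
  note jB = qtor.j_in
  have ED: "?E \<subseteq> ?D" by blast
  \<comment> \<open>A chosen chain bounding the image of \<open>a\<close>. One copy at each end caps
    off the sweep of \<open>a\<close>, which makes \<open>g a\<close> a cycle.\<close>
  define b where "b = (\<lambda>a. SOME b. b \<in> chS ?r ?B \<and> ?i a = bd ?r b)"
  have b: "b a \<in> chS ?r ?B" "bd ?r (b a) = ?i a" if "a \<in> ?Z2" for a
  proof -
    have "\<exists>b. b \<in> chS ?r ?B \<and> ?i a = bd ?r b" using that by (auto simp: bnd_def)
    from someI_ex[OF this] show "b a \<in> chS ?r ?B" "bd ?r (b a) = ?i a" by (simp_all add: b_def)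
  qed
  define r where "r = (\<lambda>a. b a + ?j (b a))"
  define g where "g = (\<lambda>a. qsweep m q a + r a)"
  have BE: "c \<in> chS p ?E" if "c \<in> chS p ?B" for c p using chS_mono[OF that qtor.j(3)] .
  have r: "r a \<in> chS ?r ?E" "bd ?r (r a) = ?i a + cmap q (qflip_end m) (?i a)" if "a \<in> ?Z2" for a
  proof -
    show "r a \<in> chS ?r ?E" unfolding r_def by (intro ch_add jB BE b that)
    show "bd ?r (r a) = ?i a + cmap q (qflip_end m) (?i a)"
      by (simp only: r_def bd_add bd_cmap_Suc[OF b(1)[OF that]] b(2)[OF that])
  qed
  have gc: "g a \<in> cycS ?r ?D" if "a \<in> ?Z2" for a
  proof (rule cycI)
    have a: "a \<in> cycS q ?T" using that by simp
    show "g a \<in> chS ?r ?D"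
      unfolding g_def by (intro ch_add qsweep_in cycD(1)[OF a] chS_mono[OF r(1)[OF that] ED])
    show "bd ?r (g a) = 0"
      by (simp add: g_def bd_add bd_qsweep_cyc[OF a] r(2)[OF that])
  qed
  show ?thesis
  proof (rule has_index_mult[OF F2_subspace_bnd F2_subspace_bnd F2_subspace_bnd F2_subspace_cyc F2_subspace_cyc _ qtor.index[OF n] n2, where g = g])
    show "cycS ?r ?E \<subseteq> cycS ?r ?D" using cycS_mono[OF _ ED] by blast
    show "g a \<in> cycS ?r ?D" if "a \<in> ?Z2" for a by (rule gc[OF that])
    show "\<exists>a\<in>?Z2. \<exists>s\<in>cycS ?r ?E. z + g a + s \<in> bndS ?r ?D" if z: "z \<in> cycS ?r ?D" for z
    proof -
      obtain a where a: "a \<in> chS q ?T" "bd q a = 0" "z + qsweep m q a \<in> relb ?r ?D ?E"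
        using glued_cylinder.relcycle_prism[OF glued_cylinder_qtorus cycD(1)[OF z]] cycD(2)[OF z] unfolding qsweep_def by auto
      obtain d s where d: "d \<in> chS ?p ?D" and s: "s \<in> chS ?r ?E" and eq: "z + qsweep m q a = bd ?p d + s"
        using a(3) by (rule relb_E)
      have ac: "a \<in> cycS q ?T" using a cycI by blast
      obtain x y where xy: "x \<in> chS ?r ?B" "y \<in> chS ?r ?B" "s = x + ?j y" using qtor.split[OF s] .
      have bs: "bd ?r s = ?i a + cmap q (qflip_end m) (?i a)"
        using arg_cong[OF eq, of "bd ?r"] by (simp add: bd_add cycD(2)[OF z] bd_bd_Suc[OF d] bd_qsweep_cyc[OF ac])
      then have "?i a + cmap q (qflip_end m) (?i a) = bd ?r x + cmap q (qflip_end m) (bd ?r y)"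
        unfolding xy(3) bd_add bd_cmap_Suc[OF xy(2)] by simp
      then have "?i a = bd ?r x"
        by (rule qtor.unique_eq(1)[OF cmap_invs_in[OF a(1)] cmap_invs_in[OF a(1)] bd_in_Suc[OF xy(1)] bd_in_Suc[OF xy(2)]])
      then have aZ: "a \<in> ?Z2" using ac bndI[OF xy(1)] by simp
      have "s + r a \<in> cycS ?r ?E"
        by (rule cycI) (use s r[OF aZ] bs in \<open>auto simp: bd_add\<close>)
      moreover have "z + g a + (s + r a) = bd ?p d"
      proof -
        have "z + g a + (s + r a) = (z + qsweep m q a) + s" by (simp add: g_def F2_ac)
        also have "\<dots> = bd ?p d" unfolding eq by (simp add: F2_ac)
        finally show ?thesis .
      qed
      ultimately show ?thesis using aZ bndI[OF d] by (intro bexI[of _ a] bexI[of _ "s + r a"]) auto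
    qed
    show "a + a' \<in> bndS q ?T" if a: "a \<in> ?Z2" "a' \<in> ?Z2" and s: "s \<in> cycS ?r ?E" and bn: "g a + g a' + s \<in> bndS ?r ?D" for a a' s
    proof -
      obtain d where d: "d \<in> chS ?p ?D" "g a + g a' + s = bd ?p d" using bn by (auto simp: bnd_def)
      have "qsweep m q (a + a') \<in> relb ?r ?D ?E"
      proof (rule relb_I[OF d(1)])
        show "r a + r a' + s \<in> chS ?r ?E" using r(1) a cycD(1)[OF s] by (intro ch_add) auto
        show "qsweep m q (a + a') = bd ?p d + (r a + r a' + s)"
          unfolding d(2)[symmetric] g_def qsweep_add by (simp add: F2_ac)
      qed
      moreover have "a + a' \<in> cycS q ?T" using a cyc_add by blast
      ultimately obtain e where "e \<in> chS ?r ?T" "a + a' = bd ?r e"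
        using glued_cylinder.prism_relbound[OF glued_cylinder_qtorus, of "a + a'" q m] unfolding qsweep_def by (auto simp: cyc_def)
      then show ?thesis using bndI by simp
    qed
    show "\<exists>s\<in>cycS ?r ?E. g a + g a' + s \<in> bndS ?r ?D" if a: "a \<in> ?Z2" "a' \<in> ?Z2" and bn: "a + a' \<in> bndS q ?T" for a a'
    proof -
      obtain e where e: "e \<in> chS ?r ?T" "a + a' = bd ?r e" using bn by (auto simp: bnd_def)
      let ?ie = "cmap ?r invs e"
      \<comment> \<open>Besides the sweep of \<open>a + a'\<close>, the boundary of the sweep of
        \<open>e\<close> has one copy of the image of \<open>e\<close> at each end; \<open>s\<close>
        collects these and the caps.\<close>
      define s where "s = r a + r a' + (?ie + ?j ?ie)"
      have ie: "?ie \<in> chS ?r ?B" by (rule cmap_invs_in[OF e(1)])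
      have sE: "s \<in> chS ?r ?E" unfolding s_def
        by (rule ch_add[OF ch_add[OF r(1)[OF a(1)] r(1)[OF a(2)]] ch_add[OF BE[OF ie] jB[OF ie]]])
      have gg: "g a + g a' + s = bd ?p (qsweep m (Suc q) e)"
      proof -
        have "g a + g a' + s = qsweep m q (a + a') + (?ie + ?j ?ie)"
          by (simp add: g_def s_def qsweep_add F2_ac)
        also have "\<dots> = bd ?p (qsweep m (Suc q) e)"
          unfolding bd_qsweep_Suc[OF e(1)] e(2) by (simp add: F2_ac)
        finally show ?thesis .
      qed
      have qe: "qsweep m (Suc q) e \<in> chS ?p ?D" by (rule qsweep_in[OF e(1)])
      have "bd ?r (g a + g a' + s) = 0" unfolding gg by (rule bd_bd_Suc[OF qe])
      then have "bd ?r s = 0" using cycD(2)[OF gc[OF a(1)]] cycD(2)[OF gc[OF a(2)]] by (simp add: bd_add)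
      then have "s \<in> cycS ?r ?E" using sE cycI by blast
      then show ?thesis using bndI[OF qe] gg by (intro bexI[of _ s]) auto
    qed
    show "s \<in> bndS ?r ?D \<longleftrightarrow> s \<in> bndS ?r ?E" if s: "s \<in> cycS ?r ?E" for s
    proof
      assume "s \<in> bndS ?r ?D"
      then obtain d where d: "d \<in> chS ?p ?D" "s = bd ?p d" by (auto simp: bnd_def)
      have "bd ?p d \<in> chS ?r ?E" using cycD(1)[OF s] d(2) by simp
      then obtain a where a: "a \<in> chS ?r ?T" "bd ?r a = 0" "d + qsweep m (Suc q) a \<in> relb ?p ?D ?E"
        using glued_cylinder.relcycle_prism[OF glued_cylinder_qtorus d(1)] unfolding qsweep_def by auto
      obtain d' t where d': "d' \<in> chS (Suc ?p) ?D" and t: "t \<in> chS ?p ?E"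
        and eq: "d + qsweep m (Suc q) a = bd (Suc ?p) d' + t" using a(3) by (rule relb_E)
      have ac: "a \<in> cycS ?r ?T" using a cycI by blast
      \<comment> \<open>The vanishing of the quotient map enters here: \<open>a\<close> has degree
        at least 1, so its image bounds in each end, and the null-homology of \<open>s\<close> can
        be corrected to lie in the ends.\<close>
      let ?ia = "cmap ?r invs a"
      obtain b where b: "b \<in> chS ?p ?B" "?ia = bd ?p b"
        using quotient_kills[OF ac] by (auto simp: bnd_def)
      have "s + (?ia + ?j ?ia) = bd ?p t"
        using arg_cong[OF eq, of "bd ?p"] by (simp add: bd_add bd_bd_Suc[OF d'] bd_qsweep_cyc[OF ac] d(2))
      moreover have "?ia + ?j ?ia = bd ?p (b + cmap ?p (qflip_end m) b)"
        unfolding bd_add bd_cmap_Suc[OF b(1)] b(2) ..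
      ultimately have "s + bd ?p (b + cmap ?p (qflip_end m) b) = bd ?p t"
        by simp
      then have "s = bd ?p (b + cmap ?p (qflip_end m) b) + bd ?p t"
        by (rule F2_move[THEN iffD2])
      also have "\<dots> = bd ?p ((b + cmap ?p (qflip_end m) b) + t)"
        by (simp only: bd_add)
      finally have "s = bd ?p ((b + cmap ?p (qflip_end m) b) + t)" .
      moreover have "(b + cmap ?p (qflip_end m) b) + t \<in> chS ?p ?E"
        by (intro ch_add t jB BE b)
      ultimately show "s \<in> bndS ?r ?E" using bndI by simp
    qed (rule bndS_mono[OF _ ED])
  qed
qed

section \<open>Reduced cycles and the Betti number recurrence\<close>

definition rcyc :: "nat \<Rightarrow> 'a topology \<Rightarrow> 'a chain2 set" where
  "rcyc p X = {c \<in> cyc p X. p = 0 \<longrightarrow> aug c = 0}"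

lemma F2_subspace_rcyc: "F2_subspace (rcyc p X)"
  using F2_subspace_cyc[of p X] by (auto simp: F2_subspace_def rcyc_def aug_add)

text \<open>The solution of the recurrence that doubles and adds \<open>m choose (i - 1)\<close>
  when \<open>m\<close> grows by one, starting from 0 at \<open>m = 0\<close>. Summing over all
  \<open>j < m\<close> keeps the range independent of \<open>i\<close>; the surplus terms are
  zero.\<close>

definition qbetti :: "nat \<Rightarrow> nat \<Rightarrow> nat" where
  "qbetti m i = (if 2 \<le> i then \<Sum>j<m. 2 ^ j * ((m - 1 - j) choose (i - 1)) else 0)"

lemma qbetti_Suc: "qbetti (Suc m) (Suc (Suc p)) = qbetti m (Suc (Suc p)) + qbetti m (Suc (Suc p)) + (m choose Suc p)"
proof -
  have "(\<Sum>j<Suc m. 2 ^ j * ((m - j) choose Suc p)) = (m choose Suc p) + (\<Sum>j<m. 2 ^ Suc j * ((m - Suc j) choose Suc p))"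
    by (subst sum.lessThan_Suc_shift) simp
  also have "(\<Sum>j<m. 2 ^ Suc j * ((m - Suc j) choose Suc p)) = 2 * (\<Sum>j<m. 2 ^ j * ((m - 1 - j) choose Suc p))"
    by (simp add: sum_distrib_left mult.assoc)
  finally show ?thesis by (simp add: qbetti_def)
qed

lemma qtorus_0: "qtorus 0 = {invs (\<lambda>_. 1)}"
  by (simp add: qtorus_def torus_0)

lemma qtorus_path_connected: "path_connected (qtorus m)"
  unfolding qtorus_def by (intro path_connected_continuous_image cont_invs_on torus_path_connected)

text \<open>In degree 1 the kernel consists of 0-cycles of augmentation 0, which all bound in the
  torus, so nothing is added. In higher degrees every torus cycle is in the kernel, which gives the
  binomial.\<close>

lemma qtorus_cyc_index: "has_index (bndS (Suc q) (qtorus m)) (cycS (Suc q) (qtorus m)) (2 ^ qbetti m (Suc q))"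
proof (induction m)
  case 0
  have "cycS (Suc q) (qtorus 0) \<subseteq> bndS (Suc q) (qtorus 0)"
    by (intro cyc_bnd_point[of _ "invs (\<lambda>_. 1)"]) (auto simp: qtorus_0)
  then have "has_index (bndS (Suc q) (qtorus 0)) (cycS (Suc q) (qtorus 0)) 1"
    by (intro has_index_1 F2_subspace_bnd F2_subspace_0 F2_subspace_cyc)
  then show ?case by (simp add: qbetti_def)
next
  case (Suc m)
  let ?Z = "{a \<in> cycS q (torus m). cmap q invs a \<in> bndS q (qtorus m)}"
  show ?case
  proof (cases q)
    case 0
    have "?Z \<subseteq> bndS q (torus m)"
    proof
      fix a assume a: "a \<in> ?Z"
      then have "aug a = 0" using aug_bnd[of "cmap 0 invs a" "top_of_set (qtorus m)"] 0 by (simp add: aug_cmap)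
      then show "a \<in> bndS q (torus m)" using a 0 aug_0_bnd[OF torus_path_connected] cycD(1) by blast
    qed
    then have "has_index (bndS q (torus m)) ?Z 1"
      by (intro has_index_1 F2_subspace_bnd) (simp_all add: F2_subspace_0 F2_subspace_cyc F2_subspace_bnd)
    from qtorus_step[OF Suc.IH this] show ?thesis using 0 by (simp add: qbetti_def)
  next
    case (Suc p)
    have "?Z = cycS q (torus m)" using quotient_kills[of _ p m] Suc by blast
    then have "has_index (bndS q (torus m)) ?Z (2 ^ (m choose q))" using torus_index by simp
    from qtorus_step[OF Suc.IH this] show ?thesis
      using Suc by (simp add: qbetti_Suc power_add)
  qed
qed

lemma qtorus_index: "has_index (bndS i (qtorus m)) (rcyc i (top_of_set (qtorus m))) (2 ^ qbetti m i)"
proof (cases i)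
  case 0
  have "rcyc 0 (top_of_set (qtorus m)) \<subseteq> bndS 0 (qtorus m)"
    using aug_0_bnd[OF qtorus_path_connected] by (auto simp: rcyc_def cyc_def)
  then have "has_index (bndS 0 (qtorus m)) (rcyc 0 (top_of_set (qtorus m))) 1"
    by (intro has_index_1 F2_subspace_bnd F2_subspace_0 F2_subspace_rcyc)
  then show ?thesis using 0 by (simp add: qbetti_def)
next
  case (Suc q)
  then have "rcyc i (top_of_set (qtorus m)) = cycS i (qtorus m)" by (auto simp: rcyc_def)
  then show ?thesis using qtorus_cyc_index Suc by simp
qed

section \<open>The homology groups of the statement\<close>

lemma has_index_homeomorphic:
  assumes fg: "homeomorphic_maps X Y f g" and n: "has_index (bnd p X) (rcyc p X) n"
  shows "has_index (bnd p Y) (rcyc p Y) n"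
proof -
  have f: "continuous_map X Y f" and g: "continuous_map Y X g"
    and gf: "\<And>x. x \<in> topspace X \<Longrightarrow> g (f x) = x" and gf': "\<And>y. y \<in> topspace Y \<Longrightarrow> f (g y) = y"
    using fg by (auto simp: homeomorphic_maps_def)
  have r: "cmap p h c \<in> rcyc p W" if "c \<in> rcyc p V" "continuous_map V W h" for c h and V :: "'x topology" and W :: "'y topology"
    using that cyc_cmap by (auto simp: rcyc_def aug_cmap)
  have gfc: "cmap p g (cmap p f c) = c" if "c \<in> ch p X" for c
    unfolding cmap_cmap by (rule cmap_id[OF that]) (simp add: gf)
  have fgc: "cmap p f (cmap p g c) = c" if "c \<in> ch p Y" for c
    unfolding cmap_cmap by (rule cmap_id[OF that]) (simp add: gf')
  have rc: "c \<in> ch p V" if "c \<in> rcyc p V" for c and V :: "'x topology" using that by (simp add: rcyc_def cyc_def)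
  show ?thesis
  proof (rule has_index_transport[OF F2_subspace_bnd F2_subspace_bnd F2_subspace_rcyc n, where f = "cmap p f"])
    show "cmap p f a \<in> rcyc p Y" if "a \<in> rcyc p X" for a by (rule r[OF that f])
    show "\<exists>a\<in>rcyc p X. z + cmap p f a \<in> bnd p Y" if "z \<in> rcyc p Y" for z
      using r[OF that g] fgc[OF rc[OF that]] bnd_0 by (intro bexI[of _ "cmap p g z"]) auto
    show "cmap p f a + cmap p f b \<in> bnd p Y \<longleftrightarrow> a + b \<in> bnd p X" if "a \<in> rcyc p X" "b \<in> rcyc p X" for a b
    proof
      assume "cmap p f a + cmap p f b \<in> bnd p Y"
      from bnd_cmap[OF this g] show "a + b \<in> bnd p X" by (simp add: cmap_add gfc rc that)
    next
      assume "a + b \<in> bnd p X"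
      from bnd_cmap[OF this f] show "cmap p f a + cmap p f b \<in> bnd p Y" by (simp add: cmap_add)
    qed
  qed
qed

lemma aug_red: "aug (red c) = 0 \<longleftrightarrow> even (\<Sum>s\<in>keys c. coeff c s)"
proof -
  let ?n = "\<Sum>s\<in>keys c. coeff c s" and ?p = "pt_simplex (0::real)"
  have s: "simplex_map 0 (\<lambda>_. 0) \<sigma> = ?p" for \<sigma> :: "(nat \<Rightarrow> real) \<Rightarrow> 'a"
    by (simp add: simplex_map_def o_def)
  have "coeff (chain_map 0 (\<lambda>_. 0) c) t = (if t = ?p then ?n else 0)" for t
    by (auto simp: chain_map_def frag_extend_def s lookup_sum)
  then have l: "coeff (aug (red c)) t = (if t = ?p then of_int ?n else 0)" for t
    by (simp add: aug_def cmap_red lookup_red)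
  show ?thesis
  proof
    assume "aug (red c) = 0"
    then have "of_int ?n = (0::bit)" using l[of ?p] by simp
    then show "even ?n" by (simp only: of_int_bit_eq_0)
  next
    assume "even ?n"
    then have "of_int ?n = (0::bit)" by (simp only: of_int_bit_eq_0)
    then show "aug (red c) = 0" by (intro poly_mapping_eqI) (simp only: l lookup_zero if_cancel)
  qed
qed

lemma even_chain:
  assumes "singular_chain p X c" "red c = 0"
  obtains e where "singular_chain p X e" "c = e + e"
proof -
  obtain e where "keys e \<subseteq> keys c" "c = e + e" using assms(2) unfolding red_eq_0_iff by blast
  then show ?thesis using that assms(1) by (auto simp: singular_chain_def)
qed

text \<open>An integral boundary is divisible by 2 exactly when its reduction vanishes, and half of
  it is then a chain of the same space.\<close>

lemma mod2_reduced_cycles_iff: "c \<in> mod2_reduced_cycles p X \<longleftrightarrow> singular_chain p X c \<and> red c \<in> rcyc p X"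
proof -
  have "red c \<in> rcyc p X \<longleftrightarrow> (\<exists>e. singular_chain (p - 1) X e \<and> chain_boundary p c = e + e) \<and> (p = 0 \<longrightarrow> aug (red c) = 0)"
    if c: "singular_chain p X c"
  proof -
    have b: "singular_chain (p - 1) X (chain_boundary p c)" using singular_chain_boundary[OF c] by simp
    have "bd p (red c) = 0 \<longleftrightarrow> (\<exists>e. singular_chain (p - 1) X e \<and> chain_boundary p c = e + e)"
    proof
      assume "bd p (red c) = 0"
      then show "\<exists>e. singular_chain (p - 1) X e \<and> chain_boundary p c = e + e"
        using even_chain[OF b] by (metis bd_red)
    next
      assume "\<exists>e. singular_chain (p - 1) X e \<and> chain_boundary p c = e + e"
      then show "bd p (red c) = 0" by (auto simp: bd_red red_add)
    qed
    then show ?thesis using ch_red[OF c] by (simp add: rcyc_def cyc_def)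
  qed
  then show ?thesis unfolding mod2_reduced_cycles_def by (auto simp: aug_red)
qed

lemma mod2_boundaries_iff:
  assumes c: "singular_chain p X c" shows "c \<in> mod2_boundaries p X \<longleftrightarrow> red c \<in> bnd p X"
proof
  assume "c \<in> mod2_boundaries p X"
  then obtain d e where d: "singular_chain (Suc p) X d" "c = chain_boundary (Suc p) d + (e + e)"
    unfolding mod2_boundaries_def by blast
  then have "red c = bd (Suc p) (red d)" by (simp add: red_add bd_red)
  then show "red c \<in> bnd p X" using bndI[OF ch_red[OF d(1)]] by simp
next
  assume "red c \<in> bnd p X"
  then obtain d2 where d2: "d2 \<in> ch (Suc p) X" "red c = bd (Suc p) d2" by (auto simp: bnd_def)
  obtain d where d: "d2 = red d" "singular_chain (Suc p) X d" using d2(1) by (rule ch_cases)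
  have "red (c - chain_boundary (Suc p) d) = 0" by (simp add: red_diff d2(2) d(1) bd_red)
  moreover have "singular_chain p X (c - chain_boundary (Suc p) d)"
    by (intro singular_chain_diff c singular_chain_boundary_alt d)
  ultimately obtain e where "singular_chain p X e" "c - chain_boundary (Suc p) d = e + e" using even_chain by metis
  then have "singular_chain p X e" "c = chain_boundary (Suc p) d + (e + e)" by (simp_all add: algebra_simps)
  then show "c \<in> mod2_boundaries p X"
    unfolding mod2_boundaries_def using d(2) by blast
qed

lemma mod2_boundaries_chain: "c \<in> mod2_boundaries p X \<Longrightarrow> singular_chain p X c"
  unfolding mod2_boundaries_def by (auto intro!: singular_chain_add singular_chain_boundary_alt)

lemma card_image_cong:
  assumes "\<And>x y. x \<in> A \<Longrightarrow> y \<in> A \<Longrightarrow> f x = f y \<longleftrightarrow> g x = g y"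
  shows "finite (f ` A) \<longleftrightarrow> finite (g ` A)" "card (f ` A) = card (g ` A)"
proof -
  have "bij_betw (\<lambda>z. g (inv_into A f z)) (f ` A) (g ` A)"
  proof (rule bij_betw_imageI)
    have i: "inv_into A f (f x) \<in> A" "f (inv_into A f (f x)) = f x" if "x \<in> A" for x
      using that by (auto simp: inv_into_into f_inv_into_f)
    show "inj_on (\<lambda>z. g (inv_into A f z)) (f ` A)"
      by (rule inj_onI) (metis assms i imageE)
    have "g (inv_into A f (f x)) = g x" if "x \<in> A" for x
      using assms[OF i(1)[OF that] that] i(2)[OF that] by simp
    then show "(\<lambda>z. g (inv_into A f z)) ` f ` A = g ` A" by (force simp: image_image)
  qed
  then show "finite (f ` A) \<longleftrightarrow> finite (g ` A)" "card (f ` A) = card (g ` A)"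
    using bij_betw_finite bij_betw_same_card by blast+
qed

lemma carrier_reduced_mod2:
  "carrier (reduced_mod2_homology_group p X) = (\<lambda>c. (\<lambda>b. b + c) ` mod2_boundaries p X) ` mod2_reduced_cycles p X"
proof -
  let ?G = "chain_group p X" and ?C = "mod2_reduced_cycles p X"
  have "subgroup ?C ?G"
  proof
    show "?C \<subseteq> carrier ?G" by (auto simp: mod2_reduced_cycles_iff)
    show "\<one>\<^bsub>?G\<^esub> \<in> ?C" using F2_subspace_0[OF F2_subspace_rcyc] by (simp add: mod2_reduced_cycles_iff)
    show "x \<otimes>\<^bsub>?G\<^esub> y \<in> ?C" if "x \<in> ?C" "y \<in> ?C" for x y
      using that F2_subspace_add[OF F2_subspace_rcyc] by (auto simp: mod2_reduced_cycles_iff red_add singular_chain_add)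
    show "inv\<^bsub>?G\<^esub> x \<in> ?C" if x: "x \<in> ?C" for x
    proof -
      have "keys x \<subseteq> singular_simplex_set p X" using x by (simp add: mod2_reduced_cycles_iff singular_chain_def)
      then show ?thesis using x by (simp add: mod2_reduced_cycles_iff singular_chain_minus)
    qed
  qed
  then have "carrier (subgroup_generated ?G ?C) = ?C" by (rule subgroup.carrier_subgroup_generated_subgroup)
  then show ?thesis
    unfolding reduced_mod2_homology_group_def carrier_FactGroup r_coset_def by (auto simp: image_iff)
qed

text \<open>The integral boundaries modulo 2 contain all doubled chains, the kernel of
  \<open>red\<close>, so reduction matches the cosets on the integral side with those over
  F_2.\<close>

lemma reduced_mod2_betti_index:
  assumes n: "has_index (bnd p X) (rcyc p X) (2 ^ k)"
  shows "finite (carrier (reduced_mod2_homology_group p X)) \<and> reduced_mod2_betti p X = k"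
proof -
  let ?C = "mod2_reduced_cycles p X" and ?B = "mod2_boundaries p X"
  let ?f = "\<lambda>c. (\<lambda>b. b + c) ` ?B" and ?g = "\<lambda>c. (+) (red c) ` bnd p X"
  have C: "singular_chain p X c" if "c \<in> ?C" for c using that by (simp add: mod2_reduced_cycles_iff)
  have rc: "red ` ?C = rcyc p X"
  proof
    show "rcyc p X \<subseteq> red ` ?C"
    proof
      fix z assume z: "z \<in> rcyc p X"
      then have "z \<in> ch p X" by (simp add: rcyc_def cyc_def)
      then obtain c where "z = red c" "singular_chain p X c" by (rule ch_cases)
      then show "z \<in> red ` ?C" using z by (auto simp: mod2_reduced_cycles_iff)
    qed
  qed (auto simp: mod2_reduced_cycles_iff)
  have *: "?f x = ?f y \<longleftrightarrow> x - y \<in> ?B" if "x \<in> ?C" "y \<in> ?C" for x y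
  proof
    have "0 \<in> ?B" using mod2_boundaries_iff[of p X 0] bnd_0 by simp
    moreover assume "?f x = ?f y"
    ultimately have "0 + x \<in> ?f y" by blast
    then show "x - y \<in> ?B" by auto
  next
    have sub: "?f x \<subseteq> ?f y" if xy: "x - y \<in> ?B" for x y
    proof
      fix z assume "z \<in> ?f x"
      then obtain b where b: "b \<in> ?B" "z = b + x" by blast
      have "singular_chain p X (b + (x - y))" using mod2_boundaries_chain b(1) xy singular_chain_add by blast
      moreover have "red (b + (x - y)) \<in> bnd p X"
        unfolding red_add[of b] using mod2_boundaries_iff mod2_boundaries_chain b(1) xy by (intro bnd_add) blast+
      ultimately have "b + (x - y) \<in> ?B" using mod2_boundaries_iff by blast
      moreover have "z = (b + (x - y)) + y" by (simp add: b(2))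
      ultimately show "z \<in> ?f y" by blast
    qed
    assume "x - y \<in> ?B"
    moreover from this have "y - x \<in> ?B"
      using mod2_boundaries_iff[of p X "x - y"] mod2_boundaries_iff[of p X "y - x"] mod2_boundaries_chain[of "x - y" p X]
        singular_chain_minus[of p X "x - y"] by (simp add: red_diff add.commute)
    ultimately show "?f x = ?f y" using sub by blast
  qed
  have "?f x = ?f y \<longleftrightarrow> ?g x = ?g y" if "x \<in> ?C" "y \<in> ?C" for x y
    unfolding *[OF that] coset_eq_iff[OF F2_subspace_bnd]
    using mod2_boundaries_iff[OF singular_chain_diff[OF C C], OF that] by (simp add: red_diff)
  note card_image_cong[of ?C ?f ?g, OF this]
  moreover have "?g ` ?C = (\<lambda>z. (+) z ` bnd p X) ` rcyc p X" unfolding rc[symmetric] image_image ..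
  ultimately have "finite (carrier (reduced_mod2_homology_group p X))" "card (carrier (reduced_mod2_homology_group p X)) = 2 ^ k"
    using n unfolding carrier_reduced_mod2 has_index_def by simp_all
  then show ?thesis unfolding reduced_mod2_betti_def by (auto intro!: the_equality)
qed

section \<open>The orbit space of the circle power\<close>

lemma istopology_quotient: "istopology (\<lambda>U. U \<subseteq> f ` topspace X \<and> openin X {x \<in> topspace X. f x \<in> U})"
  unfolding istopology_def
proof (intro conjI allI impI)
  fix S T assume *: "S \<subseteq> f ` topspace X \<and> openin X {x \<in> topspace X. f x \<in> S}" "T \<subseteq> f ` topspace X \<and> openin X {x \<in> topspace X. f x \<in> T}"
  then show "S \<inter> T \<subseteq> f ` topspace X" by blast
  have "{x \<in> topspace X. f x \<in> S \<inter> T} = {x \<in> topspace X. f x \<in> S} \<inter> {x \<in> topspace X. f x \<in> T}" by blast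
  then show "openin X {x \<in> topspace X. f x \<in> S \<inter> T}" using * by auto
next
  fix \<K> assume *: "\<forall>K\<in>\<K>. K \<subseteq> f ` topspace X \<and> openin X {x \<in> topspace X. f x \<in> K}"
  then show "\<Union>\<K> \<subseteq> f ` topspace X" by blast
  have "{x \<in> topspace X. f x \<in> \<Union>\<K>} = (\<Union>K\<in>\<K>. {x \<in> topspace X. f x \<in> K})" by blast
  then show "openin X {x \<in> topspace X. f x \<in> \<Union>\<K>}" using * by auto
qed

lemma quotient_map_quotient_topology: "quotient_map X (quotient_topology X f) f"
proof -
  have o: "openin (quotient_topology X f) U \<longleftrightarrow> U \<subseteq> f ` topspace X \<and> openin X {x \<in> topspace X. f x \<in> U}" for U
    unfolding quotient_topology_def topology_inverse'[OF istopology_quotient] ..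
  have "topspace (quotient_topology X f) = f ` topspace X"
  proof
    show "topspace (quotient_topology X f) \<subseteq> f ` topspace X" using o openin_topspace by blast
    have "{x \<in> topspace X. f x \<in> f ` topspace X} = topspace X" by blast
    then have "openin (quotient_topology X f) (f ` topspace X)" by (simp add: o)
    then show "f ` topspace X \<subseteq> topspace (quotient_topology X f)" by (rule openin_subset)
  qed
  then show ?thesis unfolding quotient_map_def by (auto simp: o)
qed

lemma quotient_maps_homeomorphic:
  assumes f: "quotient_map X Y f" and h: "quotient_map X Z h"
    and eq: "\<And>x y. x \<in> topspace X \<Longrightarrow> y \<in> topspace X \<Longrightarrow> f x = f y \<longleftrightarrow> h x = h y"
  obtains g g' where "homeomorphic_maps Y Z g g'"
proof -
  obtain g where g: "continuous_map Y Z g" "\<And>x. x \<in> topspace X \<Longrightarrow> g (f x) = h x"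
    using quotient_map_lift_exists[OF f quotient_imp_continuous_map[OF h]] eq by metis
  obtain g' where g': "continuous_map Z Y g'" "\<And>x. x \<in> topspace X \<Longrightarrow> g' (h x) = f x"
    using quotient_map_lift_exists[OF h quotient_imp_continuous_map[OF f]] eq by metis
  have "topspace Y = f ` topspace X" "topspace Z = h ` topspace X"
    using f h quotient_imp_surjective_map by blast+
  then have "homeomorphic_maps Y Z g g'"
    unfolding homeomorphic_maps_def using g g' by auto
  then show ?thesis by (rule that)
qed

lemma topspace_circle_power: "topspace (circle_power m) = PiE {..<m} (\<lambda>_. sphere 0 1)"
  by (simp add: circle_power_def)

lemma compact_circle_power: "compact_space (circle_power m)"
  unfolding circle_power_def by (simp add: compact_space_product_topology compact_space_subtopology)

text \<open>The products of imaginary parts determine the vector of imaginary parts up to one common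
  sign, which any nonzero entry fixes.\<close>

lemma invs_eq_iff: "invs x = invs y \<longleftrightarrow> y = x \<or> y = conjs x"
proof
  assume eq: "invs x = invs y"
  have re: "Re (x j) = Re (y j)" and im: "Im (x j) * Im (x k) = Im (y j) * Im (y k)" for j k
    using eq by (simp_all add: invs_def fun_eq_iff)
  show "y = x \<or> y = conjs x"
  proof (cases "\<forall>j. Im (x j) = 0")
    case True
    then have "Im (y j) = 0" for j using im[of j j] by simp
    then have "y = x" using True re by (auto simp: complex_eq_iff)
    then show ?thesis ..
  next
    case False
    then obtain j where j: "Im (x j) \<noteq> 0" by blast
    have "Im (y j) = Im (x j) \<or> Im (y j) = - Im (x j)" using im[of j j, symmetric] by (simp add: square_eq_iff)
    then show ?thesis
    proof
      assume "Im (y j) = Im (x j)"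
      then have "Im (y k) = Im (x k)" for k using im[of j k] j by simp
      then have "y = x" using re by (auto simp: complex_eq_iff)
      then show ?thesis ..
    next
      assume "Im (y j) = - Im (x j)"
      then have "Im (x j) * (Im (y k) + Im (x k)) = 0" for k using im[of j k] by (simp add: algebra_simps)
      then have "Im (y k) = - Im (x k)" for k using j by (simp add: add_eq_0_iff)
      then have "y = conjs x" using re by (auto simp: complex_eq_iff conjs_def)
      then show ?thesis ..
    qed
  qed
qed auto

text \<open>Rotating the last coordinate to \<open>1\<close> leaves only conjugation.\<close>
definition normalize_last :: "nat \<Rightarrow> (nat \<Rightarrow> complex) \<Rightarrow> nat \<Rightarrow> complex" where
  "normalize_last m x = (\<lambda>k. if k < m then x k * cnj (x m) else 1)"

lemma circle_power_norm: "x \<in> topspace (circle_power (Suc m)) \<Longrightarrow> k \<le> m \<Longrightarrow> cmod (x k) = 1"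
  unfolding topspace_circle_power by (auto simp: PiE_iff)

lemma unit_mult_cnj: "cmod z = 1 \<Longrightarrow> z * cnj z = 1"
  using complex_norm_square[of z] by simp

lemma normalize_last_torus:
  assumes "x \<in> topspace (circle_power (Suc m))" shows "normalize_last m x \<in> torus m"
  using circle_power_norm[OF assms] by (auto simp: torus_def normalize_last_def norm_mult)

lemma normalize_last_surj:
  assumes "y \<in> torus m" obtains x where "x \<in> topspace (circle_power (Suc m))" "normalize_last m x = y"
proof
  show "restrict y {..<Suc m} \<in> topspace (circle_power (Suc m))"
    using torus_norm[OF assms] by (auto simp: topspace_circle_power)
  show "normalize_last m (restrict y {..<Suc m}) = y"
    using assms torus_at[OF assms] by (auto simp: normalize_last_def torus_def)
qed

lemma continuous_normalize_last: "continuous_map (circle_power (Suc m)) euclidean (normalize_last m)"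
proof -
  have c: "continuous_map (circle_power (Suc m)) euclidean (\<lambda>x. x k)" if "k < Suc m" for k
    using continuous_map_product_projection[of k "{..<Suc m}" "\<lambda>_. top_of_set (sphere (0::complex) 1)"] that
    unfolding circle_power_def by (auto intro: continuous_map_into_fulltopology)
  have "continuous_map (circle_power (Suc m)) euclidean (\<lambda>x. normalize_last m x k)" for k
  proof (cases "k < m")
    case True
    have "continuous_map (circle_power (Suc m)) euclidean (\<lambda>x. (x k, x m))"
      using continuous_map_pairedI[OF c[of k] c[of m]] True by simp
    moreover have "continuous_map euclidean euclidean (\<lambda>(a, b). a * cnj (b::complex))"
      by (simp add: case_prod_unfold) (intro continuous_intros)
    ultimately have "continuous_map (circle_power (Suc m)) euclidean ((\<lambda>(a, b). a * cnj (b::complex)) \<circ> (\<lambda>x. (x k, x m)))"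
      by (rule continuous_map_compose)
    then show ?thesis using True by (simp add: normalize_last_def o_def)
  qed (simp add: normalize_last_def)
  then have "continuous_map (circle_power (Suc m)) (product_topology (\<lambda>_. euclidean) UNIV) (normalize_last m)"
    unfolding continuous_map_componentwise_UNIV by blast
  then show ?thesis by (simp only: euclidean_product_topology)
qed

text \<open>In terms of inner products the invariance under O(2) is evident. For a unit vector c the
  identity used is Im(a cnj c) Im(b cnj c) = <a, b> - <a, c><b, c>.\<close>

lemma invs_normalize_last:
  assumes "x \<in> topspace (circle_power (Suc m))"
  shows "invs (normalize_last m x) = (\<lambda>j. if j < m then x j \<bullet> x m else 1,
    \<lambda>j k. if j < m \<and> k < m then x j \<bullet> x k - (x j \<bullet> x m) * (x k \<bullet> x m) else 0)"
proof -
  have re: "Re (x j * cnj (x m)) = x j \<bullet> x m" for j by (simp add: inner_complex_def)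
  have "Im (x j * cnj (x m)) * Im (x k * cnj (x m)) = x j \<bullet> x k - (x j \<bullet> x m) * (x k \<bullet> x m)" for j k
  proof -
    have "(Re (x m))\<^sup>2 + (Im (x m))\<^sup>2 = 1" using unit_Re_Im circle_power_norm[OF assms, of m] by simp
    moreover have "Im (x j * cnj (x m)) * Im (x k * cnj (x m)) + (x j \<bullet> x m) * (x k \<bullet> x m) = (x j \<bullet> x k) * ((Re (x m))\<^sup>2 + (Im (x m))\<^sup>2)"
      by (simp add: inner_complex_def power2_eq_square algebra_simps)
    ultimately show ?thesis by simp
  qed
  then show ?thesis using re unfolding invs_def normalize_last_def by (auto simp: fun_eq_iff)
qed

lemma orthogonal_transformation_unit:
  assumes "cmod c = 1" shows "orthogonal_transformation (\<lambda>z. c * z)" "orthogonal_transformation (\<lambda>z. c * cnj z)"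
proof -
  have lin: "linear (\<lambda>z. c * z)" "linear (\<lambda>z. c * cnj z)"
    by (unfold_locales; simp add: algebra_simps scaleR_conv_of_real)+
  have "cmod (c * z) = cmod z" "cmod (c * cnj z) = cmod z" for z using assms by (simp_all add: norm_mult)
  then show "orthogonal_transformation (\<lambda>z. c * z)" "orthogonal_transformation (\<lambda>z. c * cnj z)"
    unfolding orthogonal_transformation using lin by simp_all
qed

text \<open>One direction needs only that orthogonal maps preserve inner products; the other writes
  down a rotation or a reflection, so no classification of O(2) is involved.\<close>

lemma mem_O2_orbit_iff:
  assumes x: "x \<in> topspace (circle_power (Suc m))" and y: "y \<in> topspace (circle_power (Suc m))"
  shows "y \<in> O2_orbit (Suc m) x \<longleftrightarrow> invs (normalize_last m x) = invs (normalize_last m y)"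
proof
  assume "y \<in> O2_orbit (Suc m) x"
  then obtain g where g: "orthogonal_transformation g" "\<And>k. k < Suc m \<Longrightarrow> y k = g (x k)" by (auto simp: O2_orbit_def)
  then have "y j \<bullet> y k = x j \<bullet> x k" if "j < Suc m" "k < Suc m" for j k
    using that by (simp add: orthogonal_transformation_def)
  then show "invs (normalize_last m x) = invs (normalize_last m y)"
    unfolding invs_normalize_last[OF x] invs_normalize_last[OF y] by (auto simp: fun_eq_iff)
next
  have n: "cmod (x m) = 1" "cmod (y m) = 1" using circle_power_norm x y by blast+
  have yk: "y k = y m * normalize_last m y k" if "k < Suc m" for k
    using unit_mult_cnj[OF n(2)] that by (cases "k = m") (auto simp: normalize_last_def algebra_simps)
  have xk: "normalize_last m x k = cnj (x m) * x k" if "k < Suc m" for k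
    using unit_mult_cnj[OF n(1)] that by (cases "k = m") (auto simp: normalize_last_def algebra_simps)
  assume "invs (normalize_last m x) = invs (normalize_last m y)"
  then consider "normalize_last m y = normalize_last m x" | "normalize_last m y = conjs (normalize_last m x)"
    using invs_eq_iff by blast
  then have "\<exists>g. orthogonal_transformation g \<and> (\<forall>k<Suc m. y k = g (x k))"
  proof cases
    case 1
    have "orthogonal_transformation (\<lambda>z. (y m * cnj (x m)) * z)"
      by (rule orthogonal_transformation_unit(1)) (simp add: norm_mult n)
    moreover have "y k = (y m * cnj (x m)) * x k" if "k < Suc m" for k
      using yk[OF that] xk[OF that] 1 by simp
    ultimately show ?thesis by blast
  next
    case 2
    \<comment> \<open>Normalise \<open>x\<close> by \<open>cnj (x m)\<close>, conjugate, which turns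
      that factor into \<open>x m\<close>, and rotate back by \<open>y m\<close>.\<close>
    have "orthogonal_transformation (\<lambda>z. (y m * x m) * cnj z)"
      by (rule orthogonal_transformation_unit(2)) (simp add: norm_mult n)
    moreover have "y k = (y m * x m) * cnj (x k)" if "k < Suc m" for k
      using yk[OF that] xk[OF that] 2 by (simp add: conjs_def)
    ultimately show ?thesis by blast
  qed
  then show "y \<in> O2_orbit (Suc m) x" using y by (simp add: O2_orbit_def)
qed

lemma O2_orbit_eq_iff:
  assumes x: "x \<in> topspace (circle_power (Suc m))" and y: "y \<in> topspace (circle_power (Suc m))"
  shows "O2_orbit (Suc m) x = O2_orbit (Suc m) y \<longleftrightarrow> invs (normalize_last m x) = invs (normalize_last m y)"
proof
  assume "O2_orbit (Suc m) x = O2_orbit (Suc m) y"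
  moreover have "y \<in> O2_orbit (Suc m) y" using mem_O2_orbit_iff[OF y y] by simp
  ultimately show "invs (normalize_last m x) = invs (normalize_last m y)" using mem_O2_orbit_iff[OF x y] by simp
next
  have sub: "O2_orbit (Suc m) z \<subseteq> topspace (circle_power (Suc m))" for z by (auto simp: O2_orbit_def)
  assume "invs (normalize_last m x) = invs (normalize_last m y)"
  then have "z \<in> O2_orbit (Suc m) x \<longleftrightarrow> z \<in> O2_orbit (Suc m) y" for z
    using sub[of x] sub[of y] mem_O2_orbit_iff[OF x] mem_O2_orbit_iff[OF y] by auto
  then show "O2_orbit (Suc m) x = O2_orbit (Suc m) y" by blast
qed

text \<open>Two quotient maps of the circle power with the same fibres: the orbit map by
  construction, the invariants because a continuous surjection from a compact space onto a Hausdorff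
  space is a quotient map.\<close>

lemma X_space_homeomorphic: obtains g g' where "homeomorphic_maps (top_of_set (qtorus m)) (X_space (Suc m)) g g'"
proof -
  let ?X = "circle_power (Suc m)" and ?h = "invs \<circ> normalize_last m"
  have im: "?h ` topspace ?X = qtorus m"
  proof
    show "?h ` topspace ?X \<subseteq> qtorus m" using normalize_last_torus invs_in by auto
    show "qtorus m \<subseteq> ?h ` topspace ?X"
    proof
      fix z assume "z \<in> qtorus m"
      then obtain y where y: "y \<in> torus m" "z = invs y" by (auto simp: qtorus_def)
      obtain x where "x \<in> topspace ?X" "normalize_last m x = y" using y(1) by (rule normalize_last_surj)
      then show "z \<in> ?h ` topspace ?X" using y(2) by force
    qed
  qed
  have "continuous_map euclidean euclidean invs" using cont_invs_on by simp
  then have "continuous_map ?X euclidean ?h" by (rule continuous_map_compose[OF continuous_normalize_last])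
  then have "continuous_map ?X (top_of_set (qtorus m)) ?h"
    unfolding continuous_map_in_subtopology using im by blast
  then have "quotient_map ?X (top_of_set (qtorus m)) ?h"
    using im by (intro continuous_imp_quotient_map compact_circle_power Hausdorff_space_subtopology Hausdorff_space_euclidean) auto
  moreover have "quotient_map ?X (X_space (Suc m)) (O2_orbit (Suc m))"
    unfolding X_space_def by (rule quotient_map_quotient_topology)
  ultimately show ?thesis
    by (rule quotient_maps_homeomorphic) (use that O2_orbit_eq_iff in auto)
qed

text \<open>For j > n + 1 - i the upper entry n - j is less than i - 1, so those binomials vanish;
  for i > n + 1 all of them do.\<close>

lemma qbetti_formula:
  "qbetti (n + 1) i = (if 2 \<le> i \<and> i \<le> n + 1 then (\<Sum>j = 0..n + 1 - i. 2 ^ j * ((n - j) choose (i - 1))) else 0)"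
proof (cases "2 \<le> i \<and> i \<le> n + 1")
  case True
  have "(\<Sum>j = 0..n + 1 - i. 2 ^ j * ((n - j) choose (i - 1))) = (\<Sum>j<n + 1. 2 ^ j * ((n - j) choose (i - 1)))"
    by (rule sum.mono_neutral_left) (use True in \<open>auto intro!: binomial_eq_0\<close>)
  then show ?thesis using True by (simp add: qbetti_def)
next
  case False
  then show ?thesis by (auto simp: qbetti_def intro!: binomial_eq_0)
qed

theorem theorem4p3:
  fixes n i :: nat
  assumes "n \<ge> 1"
  shows "finite (carrier (reduced_mod2_homology_group i (X_space (n + 2)))) \<and>
         reduced_mod2_betti i (X_space (n + 2)) =
           (if 2 \<le> i \<and> i \<le> n + 1
            then (\<Sum>j = 0..n + 1 - i. 2 ^ j * ((n - j) choose (i - 1)))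
            else 0)"
proof -
  obtain g g' where "homeomorphic_maps (top_of_set (qtorus (n + 1))) (X_space (Suc (n + 1))) g g'"
    by (rule X_space_homeomorphic)
  from has_index_homeomorphic[OF this qtorus_index]
  have "has_index (bnd i (X_space (n + 2))) (rcyc i (X_space (n + 2))) (2 ^ qbetti (n + 1) i)" by simp
  from reduced_mod2_betti_index[OF this] show ?thesis unfolding qbetti_formula .
qed

end
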